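(* The effective BV action $W$ on $\mathcal F'=H^\bullet(\mathcal C,\mathfrak g)[1]$, induced from the abstract Chern–Simons action $S$ on $\mathcal F=\mathfrak g\otimes\mathcal C[1]$ with induction data $(\iota,K)$, has the form $$W(\alpha)=W_{\mathrm{prod}}(\alpha)+F(\alpha_{(1)}^1,\dots,\alpha_{(1)}^{B_1};\hbar),$$ where $F\in(\mathrm{Fun}(\mathfrak g^{B_1})[[\hbar]])^{\mathfrak g}$ is some $\hbar$-dependent function on $H^1(\mathcal C,\mathfrak g)[1]\cong\mathfrak g^{B_1}$, invariant under the diagonal adjoint action of $\mathfrak g$, i.e. $$F(\alpha_{(1)}^1+[X,\alpha_{(1)}^1],\dots,\alpha_{(1)}^{B_1}+[X,\alpha_{(1)}^{B_1}];\hbar)=F(\alpha_{(1)}^1,\dots,\alpha_{(1)}^{B_1};\hbar)\mod X^2$$ at first order in $X\in\mathfrak g$.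
   Context: **Algebraic data.** $\mathcal C=\mathcal C^0\oplus\mathcal C^1\oplus\mathcal C^2\oplus\mathcal C^3$ ($\mathcal C^k$ in degree $k$) is a finite-dimensional real dg Frobenius algebra: a unital differential graded commutative associative algebra with differential $d$ of degree $+1$, product $m$, and a nondegenerate graded-symmetric pairing $\pi$ with $\pi(a,b)\ne0\Rightarrow|a|+|b|=3$, such that $\pi(da,b)+(-1)^{|a|}\pi(a,db)=0$ and $\pi(a,m(b,c))=\pi(m(a,b),c)$. $B_k=\dim H^k(\mathcal C)$; assume $B_0=B_3=1$ (and $B_1=B_2$ by duality). $\mathfrak g$ is a finite-dimensional real Lie algebra with nondegenerate ad-invariant symmetric form $\pi_{\mathfrak g}$ and orthonormal basis $\{T_a\}$. On $\mathfrak g\otimes\mathcal C$ put $d(X\otimes a)=X\otimes da$, $l(X\otimes a,Y\otimes b)=[X,Y]\otimes m(a,b)$, $\pi(X\otimes a,Y\otimes b)=\pi_{\mathfrak g}(X,Y)\pi(a,b)$, extended to coefficients in graded commutative algebras by the Koszul rule. $\mathrm{Fun}$ of a graded vector space is the graded commutative algebra of (polynomial, completed to formal power series) functions on it. **Fields and action.** $\mathcal F=\mathfrak g\otimes\mathcal C[1]$ with odd symplectic form $\sigma(sA,sB)=(-1)^{|A|}\pi(A,B)$ ($s$ the suspension). $\omega=\sum T_ae_I\,\omega^{Ia}$ is the canonical element ($\{e_I\}$ a basis of $\mathcal C$, $\omega^{Ia}$ coordinates on $\mathcal F$ of ghost number $1-|e_I|$), and $S=\tfrac12\pi(\omega,d\omega)+\tfrac16\pi(\omega,l(\omega,\omega))$.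 **Induction data** $(\iota,K)$: $\iota:H^\bullet(\mathcal C)\to\mathcal C^\bullet$ is a linear map sending each class to a cocycle representing it; $\iota^T$ is its transpose with respect to $\pi$ and the induced pairing $\pi'=\pi(\iota\cdot,\iota\cdot)$ on cohomology; $K:\mathcal C^\bullet\to\mathcal C^{\bullet-1}$ is linear with $$dK+Kd=\mathrm{id}-\iota\iota^T,\quad \pi(Ka,b)=(-1)^{|a|}\pi(a,Kb),\quad K\iota=0,\quad K^2=0.$$ Then $\mathcal C=\mathrm{im}(\iota)\oplus\mathcal C_{d-ex}\oplus\mathcal C_{K-ex}$ with $\mathcal C_{d-ex}=\mathrm{im}(d)$, $\mathcal C_{K-ex}=\mathrm{im}(K)$, and $\mathcal L_K=\mathfrak g\otimes\mathcal C_{K-ex}[1]$ is a Lagrangian subspace of $\mathcal F''=(\mathfrak g\otimes\iota(H^\bullet(\mathcal C))[1])^\perp$. **Effective action.** $W\in\mathrm{Fun}(\mathcal F')[[\hbar]]$ is defined by the normalized formal (perturbative Gaussian) fiber integral $$e^{W(\alpha)/\hbar}=\frac1N\int_{\mathcal L_K}e^{S(\iota(\alpha)+\omega'')/\hbar}\mu_{\mathcal L_K},\qquad N=\int_{\mathcal L_K}e^{\frac1{2\hbar}\pi(\omega'',d\omega'')}\mu_{\mathcal L_K},$$ with $\mu_{\mathcal L_K}$ the Lebesgue measure; i.e. $S(\iota(\alpha)+\omega'')$ is expanded around its free part $\tfrac12\pi(\omega'',d\omega'')$, and $\alpha$ is the canonical element for $\mathcal F'$. **Coordinates on $\mathcal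 F'$.** Let $e_{(0)}=[1]\in H^0(\mathcal C)$, $e_{(3)}\in H^3(\mathcal C)$ with $\pi'(e_{(0)},e_{(3)})=1$, $\{e_{(1)i}\}$ a basis of $H^1(\mathcal C)$ and $\{e_{(2)}^i\}$ the dual basis of $H^2(\mathcal C)$ ($\pi'(e_{(1)i},e_{(2)}^j)=\delta_i^j$). Then $$\alpha=e_{(0)}\alpha_{(0)}+\sum_ie_{(1)i}\alpha_{(1)}^i+\sum_ie_{(2)}^i\alpha_{(2)i}+e_{(3)}\alpha_{(3)}$$ with $\mathfrak g$-valued coordinates ($\alpha_{(1)}^i=\sum_aT_a\alpha_{(1)}^{ia}$, etc.) of ghost numbers $1,0,-1,-2$. Finally $$W_{\mathrm{prod}}(\alpha)=\tfrac16\pi(\iota(\alpha),l(\iota(\alpha),\iota(\alpha)))=\tfrac12\pi_{\mathfrak g}(\alpha_{(3)},[\alpha_{(0)},\alpha_{(0)}])-\sum_i\pi_{\mathfrak g}(\alpha_{(0)},[\alpha_{(1)}^i,\alpha_{(2)i}])+\tfrac16\sum_{i,j,k}\mu_{ijk}\pi_{\mathfrak g}(\alpha_{(1)}^i,[\alpha_{(1)}^j,\alpha_{(1)}^k]),$$ with $\mu_{ijk}=\pi(\iota(e_{(1)i}),m(\iota(e_{(1)j}),\iota(e_{(1)k})))$. *)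

theory Defs
  imports
    "HOL-Analysis.Analysis"
    "HOL-Library.Multiset"
    "HOL-Library.Countable"
    "HOL-Computational_Algebra.Formal_Power_Series"
begin

section \<open>Differential graded Frobenius algebras\<close>

record 'c dgfa =
  gr :: "nat \<Rightarrow> 'c set"
  diff :: "'c \<Rightarrow> 'c"
  mul :: "'c \<Rightarrow> 'c \<Rightarrow> 'c"
  unit :: 'c
  pair :: "'c \<Rightarrow> 'c \<Rightarrow> real"

definition finite_dimensional :: "'v::real_vector itself \<Rightarrow> bool" where
  "finite_dimensional _ \<longleftrightarrow> (\<exists>B :: 'v set. finite B \<and> span B = UNIV)"

definition basis_of :: "'v::real_vector set \<Rightarrow> nat \<Rightarrow> (nat \<Rightarrow> 'v) \<Rightarrow> bool" where
  "basis_of V n f \<longleftrightarrow> inj_on f {..<n} \<and> independent (f ` {..<n}) \<and> span (f ` {..<n}) = V"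

definition graded_0_to_3 :: "(nat \<Rightarrow> 'c::real_vector set) \<Rightarrow> bool" where
  "graded_0_to_3 C \<longleftrightarrow>
     (\<forall>k. subspace (C k)) \<and> (\<forall>k>3. C k = {0}) \<and>
     (\<forall>x. \<exists>!u. (\<forall>k. u k \<in> C k) \<and> x = (\<Sum>k\<le>3. u k))"

definition dg_frobenius_algebra :: "'c::real_vector dgfa \<Rightarrow> bool" where
  "dg_frobenius_algebra A \<longleftrightarrow>
     finite_dimensional TYPE('c) \<and> graded_0_to_3 (gr A) \<and>
     bilinear (mul A) \<and>
     (\<forall>i j. \<forall>a\<in>gr A i. \<forall>b\<in>gr A j.
        mul A a b \<in> gr A (i + j) \<and> mul A a b = (-1) ^ (i * j) *\<^sub>R mul A b a) \<and>
     (\<forall>a b c. mul A (mul A a b) c = mul A a (mul A b c)) \<and>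
     unit A \<in> gr A 0 \<and> (\<forall>a. mul A (unit A) a = a \<and> mul A a (unit A) = a) \<and>
     linear (diff A) \<and> (\<forall>k. \<forall>a\<in>gr A k. diff A a \<in> gr A (Suc k)) \<and>
     (\<forall>a. diff A (diff A a) = 0) \<and>
     (\<forall>k. \<forall>a\<in>gr A k. \<forall>b. diff A (mul A a b) = mul A (diff A a) b + (-1) ^ k *\<^sub>R mul A a (diff A b)) \<and>
     bilinear (pair A) \<and>
     (\<forall>i j. \<forall>a\<in>gr A i. \<forall>b\<in>gr A j.
        (pair A a b \<noteq> 0 \<longrightarrow> i + j = 3) \<and> pair A a b = (-1) ^ (i * j) * pair A b a) \<and>
     (\<forall>a. (\<forall>b. pair A a b = 0) \<longrightarrow> a = 0) \<and>
     (\<forall>k. \<forall>a\<in>gr A k. \<forall>b. pair A (diff A a) b + (-1) ^ k * pair A a (diff A b) = 0) \<and>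
     (\<forall>a b c. pair A a (mul A b c) = pair A (mul A a b) c)"

subsection \<open>Cohomology\<close>

text \<open>Cohomology classes are the cosets \<open>z + im d\<close> of cocycles \<open>z\<close>; \<open>cohomology A k\<close> is the degree
  \<open>k\<close> part of \<open>total_cohomology A\<close>.\<close>

definition coh_class :: "'c::real_vector dgfa \<Rightarrow> 'c \<Rightarrow> 'c set" where
  "coh_class A z = {z + diff A y | y. True}"

definition total_cohomology :: "'c::real_vector dgfa \<Rightarrow> 'c set set" where
  "total_cohomology A = coh_class A ` {z. diff A z = 0}"

definition cohomology :: "'c::real_vector dgfa \<Rightarrow> nat \<Rightarrow> 'c set set" where
  "cohomology A k = coh_class A ` {z \<in> gr A k. diff A z = 0}"

definition coh_add :: "'c::real_vector set \<Rightarrow> 'c set \<Rightarrow> 'c set" where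
  "coh_add g h = {x + y | x y. x \<in> g \<and> y \<in> h}"

text \<open>Adding \<open>im d\<close> makes \<open>0 \<cdot> h\<close> the zero class \<open>im d\<close> rather than \<open>{0}\<close>.\<close>

definition coh_scale :: "'c::real_vector dgfa \<Rightarrow> real \<Rightarrow> 'c set \<Rightarrow> 'c set" where
  "coh_scale A r h = {r *\<^sub>R x + diff A y | x y. x \<in> h}"

primrec coh_lincomb ::
    "'c::real_vector dgfa \<Rightarrow> nat \<Rightarrow> (nat \<Rightarrow> real) \<Rightarrow> (nat \<Rightarrow> 'c set) \<Rightarrow> 'c set" where
  "coh_lincomb A 0 c e = coh_class A 0"
| "coh_lincomb A (Suc n) c e = coh_add (coh_lincomb A n c e) (coh_scale A (c n) (e n))"

definition coh_basis :: "'c::real_vector dgfa \<Rightarrow> nat \<Rightarrow> nat \<Rightarrow> (nat \<Rightarrow> 'c set) \<Rightarrow> bool" where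
  "coh_basis A k n e \<longleftrightarrow>
     (\<forall>i<n. e i \<in> cohomology A k) \<and>
     (\<forall>h\<in>cohomology A k. \<exists>!c. (\<forall>i\<ge>n. c i = 0) \<and> h = coh_lincomb A n c e)"

definition coh_dim :: "'c::real_vector dgfa \<Rightarrow> nat \<Rightarrow> nat \<Rightarrow> bool" where
  "coh_dim A k n \<longleftrightarrow> (\<exists>e. coh_basis A k n e)"

subsection \<open>Induction data\<close>

definition coh_pair :: "'c::real_vector dgfa \<Rightarrow> ('c set \<Rightarrow> 'c) \<Rightarrow> 'c set \<Rightarrow> 'c set \<Rightarrow> real" where
  "coh_pair A \<iota> g h = pair A (\<iota> g) (\<iota> h)"

definition iota_transpose :: "'c::real_vector dgfa \<Rightarrow> ('c set \<Rightarrow> 'c) \<Rightarrow> 'c \<Rightarrow> 'c set" where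
  "iota_transpose A \<iota> a =
     (THE h. h \<in> total_cohomology A \<and>
        (\<forall>g\<in>total_cohomology A. coh_pair A \<iota> h g = pair A a (\<iota> g)))"

definition induction_data ::
    "'c::real_vector dgfa \<Rightarrow> ('c set \<Rightarrow> 'c) \<Rightarrow> ('c \<Rightarrow> 'c) \<Rightarrow> bool" where
  "induction_data A \<iota> K \<longleftrightarrow>
     (\<forall>h\<in>total_cohomology A. diff A (\<iota> h) = 0 \<and> coh_class A (\<iota> h) = h) \<and>
     (\<forall>k. \<forall>h\<in>cohomology A k. \<iota> h \<in> gr A k) \<and>
     (\<forall>g\<in>total_cohomology A. \<forall>h\<in>total_cohomology A. \<iota> (coh_add g h) = \<iota> g + \<iota> h) \<and>
     (\<forall>r. \<forall>h\<in>total_cohomology A. \<iota> (coh_scale A r h) = r *\<^sub>R \<iota> h) \<and>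
     linear K \<and> (\<forall>k. \<forall>a\<in>gr A (Suc k). K a \<in> gr A k) \<and> (\<forall>a\<in>gr A 0. K a = 0) \<and>
     (\<forall>a. diff A (K a) + K (diff A a) = a - \<iota> (iota_transpose A \<iota> a)) \<and>
     (\<forall>k. \<forall>a\<in>gr A k. \<forall>b. pair A (K a) b = (-1) ^ k * pair A a (K b)) \<and>
     (\<forall>h\<in>total_cohomology A. K (\<iota> h) = 0) \<and>
     (\<forall>a. K (K a) = 0)"


section \<open>Lie algebras with an invariant form\<close>

record 'g qlie =
  br :: "'g \<Rightarrow> 'g \<Rightarrow> 'g"
  form :: "'g \<Rightarrow> 'g \<Rightarrow> real"

definition quadratic_lie_algebra :: "'g::real_vector qlie \<Rightarrow> bool" where
  "quadratic_lie_algebra L \<longleftrightarrow>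
     finite_dimensional TYPE('g) \<and>
     bilinear (br L) \<and> (\<forall>x. br L x x = 0) \<and>
     (\<forall>x y z. br L x (br L y z) + br L y (br L z x) + br L z (br L x y) = 0) \<and>
     bilinear (form L) \<and> (\<forall>x y. form L x y = form L y x) \<and>
     (\<forall>x. (\<forall>y. form L x y = 0) \<longrightarrow> x = 0) \<and>
     (\<forall>x y z. form L (br L x y) z = form L x (br L y z))"

definition orthonormal_basis :: "'g::real_vector qlie \<Rightarrow> nat \<Rightarrow> (nat \<Rightarrow> 'g) \<Rightarrow> bool" where
  "orthonormal_basis L n T \<longleftrightarrow>
     basis_of UNIV n T \<and> (\<forall>a<n. \<forall>b<n. form L (T a) (T b) = (if a = b then 1 else 0))"


section \<open>Coordinates and graded commutative power series\<close>

text \<open>\<open>A0 a\<close>, \<open>A1 i a\<close>, \<open>A2 i a\<close>, \<open>A3 a\<close> are the components along \<open>T\<^sub>a\<close> of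
  \<open>\<alpha>\<^sub>(\<^sub>0\<^sub>)\<close>, \<open>\<alpha>\<^sub>(\<^sub>1\<^sub>)\<^sup>i\<close>, \<open>\<alpha>\<^sub>(\<^sub>2\<^sub>)\<^sub>i\<close>, \<open>\<alpha>\<^sub>(\<^sub>3\<^sub>)\<close>.  \<open>Fl k I a\<close> is the coordinate of the
  fluctuation \<open>\<omega>''\<close> along \<open>T\<^sub>a \<otimes> e\<close>, where \<open>e\<close> is the \<open>I\<close>-th basis vector in degree \<open>k\<close>.\<close>

datatype coord = A0 nat | A1 nat nat | A2 nat nat | A3 nat | Fl nat nat nat

fun ghost :: "coord \<Rightarrow> int" where
  "ghost (A0 a) = 1"
| "ghost (A1 i a) = 0"
| "ghost (A2 i a) = -1"
| "ghost (A3 a) = -2"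
| "ghost (Fl k I a) = 1 - int k"

instance coord :: countable by countable_datatype

text \<open>An arbitrary total order, used only to write monomials in a normal form.\<close>

instantiation coord :: linorder
begin
definition less_eq_coord :: "coord \<Rightarrow> coord \<Rightarrow> bool" where
  "less_eq_coord x y \<longleftrightarrow> to_nat x \<le> to_nat y"
definition less_coord :: "coord \<Rightarrow> coord \<Rightarrow> bool" where
  "less_coord x y \<longleftrightarrow> to_nat x < to_nat y"
instance by standard (auto simp: less_eq_coord_def less_coord_def)
end

text \<open>A multiset \<open>M\<close> of coordinates stands for the monomial \<open>z\<^sup>M\<close>, the product of its elements in
  increasing order; it vanishes if an odd coordinate is repeated.  In general
  \<open>z\<^sup>M z\<^sup>N = \<epsilon> M N \<cdot> z\<^sup>M\<^sup>+\<^sup>N\<close>.\<close>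

definition nonvanishing :: "coord multiset \<Rightarrow> bool" where
  "nonvanishing M \<longleftrightarrow> (\<forall>x. odd (ghost x) \<longrightarrow> count M x \<le> 1)"

definition inversions :: "coord multiset \<Rightarrow> coord multiset \<Rightarrow> nat" where
  "inversions M N = (\<Sum>x\<in>#M. \<Sum>y\<in>#N. if odd (ghost x) \<and> odd (ghost y) \<and> y < x then 1 else 0)"

definition mono_sign :: "coord multiset \<Rightarrow> coord multiset \<Rightarrow> real" ("\<epsilon>") where
  "\<epsilon> M N = (if nonvanishing (M + N) then (-1) ^ inversions M N else 0)"

definition splittings :: "coord multiset \<Rightarrow> (coord multiset \<times> coord multiset) set" where
  "splittings M = {(A, B). A + B = M}"

typedef superseries = "{f :: coord multiset \<Rightarrow> real. \<forall>M. \<not> nonvanishing M \<longrightarrow> f M = 0}"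
  morphisms coeff Abs_superseries
  by (rule exI[of _ "\<lambda>_. 0"]) simp

setup_lifting type_definition_superseries

lemma nonvanishing_mono: "nonvanishing (M + N) \<Longrightarrow> nonvanishing M"
  "nonvanishing (M + N) \<Longrightarrow> nonvanishing N"
  unfolding nonvanishing_def by (fastforce dest: add_leD1 add_leD2)+

lemma inversions_add:
  "inversions (M + M') N = inversions M N + inversions M' N"
  "inversions M (N + N') = inversions M N + inversions M N'"
  by (simp_all add: inversions_def sum_mset.distrib)

lemma mono_sign_empty [simp]:
  "nonvanishing M \<Longrightarrow> \<epsilon> {#} M = 1" "nonvanishing M \<Longrightarrow> \<epsilon> M {#} = 1"
  by (simp_all add: mono_sign_def inversions_def)

lemma mono_sign_assoc: "\<epsilon> A B * \<epsilon> (A + B) C = \<epsilon> A (B + C) * \<epsilon> B C"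
proof (cases "nonvanishing (A + B + C)")
  case True
  then have "nonvanishing (A + B)" "nonvanishing (B + C)"
    using nonvanishing_mono[of "A + B" C] nonvanishing_mono[of A "B + C"] by (auto simp: add.assoc)
  with True show ?thesis
    by (simp add: mono_sign_def inversions_add power_add add.assoc)
qed (simp add: mono_sign_def add.assoc)

lemma finite_splittings [simp]: "finite (splittings M)"
proof -
  let ?S = "\<Union>n\<le>size M. multisets_of_size (set_mset M) n"
  have "finite ?S"
    by (intro finite_UN_I finite_atMost finite_multisets_of_size finite_set_mset)
  moreover have "splittings M \<subseteq> ?S \<times> ?S"
    by (auto simp: splittings_def multisets_of_size_def)
  ultimately show ?thesis
    by (meson finite_SigmaI finite_subset)
qed

instantiation superseries :: ring_1
begin
lift_definition zero_superseries :: superseries is "\<lambda>_. 0" by simp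
lift_definition one_superseries :: superseries is "\<lambda>M. if M = {#} then 1 else 0"
  by (auto simp: nonvanishing_def)
lift_definition plus_superseries :: "superseries \<Rightarrow> superseries \<Rightarrow> superseries"
  is "\<lambda>f g M. f M + g M" by simp
lift_definition minus_superseries :: "superseries \<Rightarrow> superseries \<Rightarrow> superseries"
  is "\<lambda>f g M. f M - g M" by simp
lift_definition uminus_superseries :: "superseries \<Rightarrow> superseries"
  is "\<lambda>f M. - f M" by simp
lift_definition times_superseries :: "superseries \<Rightarrow> superseries \<Rightarrow> superseries"
  is "\<lambda>f g M. \<Sum>(A, B)\<in>splittings M. \<epsilon> A B * f A * g B"
  by (auto simp: splittings_def mono_sign_def intro!: sum.neutral)
instance
proof
  fix f g h :: superseries
  show "f * g * h = f * (g * h)"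
  proof (transfer, rule ext)
    fix f g h :: "coord multiset \<Rightarrow> real" and M
    have L: "(\<Sum>(A, B)\<in>splittings M. \<epsilon> A B * (\<Sum>(A', B')\<in>splittings A. \<epsilon> A' B' * f A' * g B') * h B)
      = (\<Sum>(p, q)\<in>Sigma (splittings M) (\<lambda>p. splittings (fst p)).
           \<epsilon> (fst p) (snd p) * \<epsilon> (fst q) (snd q) * f (fst q) * g (snd q) * h (snd p))"
      by (subst sum.Sigma[symmetric])
        (auto simp: sum_distrib_left sum_distrib_right case_prod_beta mult_ac intro!: sum.cong)
    have R: "(\<Sum>(A, B)\<in>splittings M. \<epsilon> A B * f A * (\<Sum>(A', B')\<in>splittings B. \<epsilon> A' B' * g A' * h B'))
      = (\<Sum>(p, q)\<in>Sigma (splittings M) (\<lambda>p. splittings (snd p)).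
           \<epsilon> (fst p) (snd p) * \<epsilon> (fst q) (snd q) * f (fst p) * g (fst q) * h (snd q))"
      by (subst sum.Sigma[symmetric])
        (auto simp: sum_distrib_left sum_distrib_right case_prod_beta mult_ac intro!: sum.cong)
    show "(\<Sum>(A, B)\<in>splittings M. \<epsilon> A B * (\<Sum>(A', B')\<in>splittings A. \<epsilon> A' B' * f A' * g B') * h B)
      = (\<Sum>(A, B)\<in>splittings M. \<epsilon> A B * f A * (\<Sum>(A', B')\<in>splittings B. \<epsilon> A' B' * g A' * h B'))"
      unfolding L R
    proof (rule sum.reindex_bij_witness[where
          i = "\<lambda>((a, bc), (b, c)). ((a + b, c), (a, b))" and
          j = "\<lambda>((ab, c), (a, b)). ((a, b + c), (b, c))"], goal_cases)
      case (5 x)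
      then obtain a b c where x: "x = ((a + b, c), (a, b))" by (auto simp: splittings_def)
      show ?case using mono_sign_assoc[of a b c] by (simp add: x mult_ac)
    qed (auto simp: splittings_def add.assoc)
  qed
next
  fix f :: superseries
  show "1 * f = f"
  proof (transfer, rule ext)
    fix f :: "coord multiset \<Rightarrow> real" and M
    assume f: "\<forall>M. \<not> nonvanishing M \<longrightarrow> f M = 0"
    have "(\<Sum>(A, B)\<in>splittings M. \<epsilon> A B * (if A = {#} then 1 else 0) * f B)
      = (\<Sum>(A, B)\<in>{({#}, M)}. \<epsilon> A B * (if A = {#} then 1 else 0) * f B)"
      by (rule sum.mono_neutral_right) (use finite_splittings in \<open>auto simp: splittings_def split: if_splits\<close>)
    also have "\<dots> = f M" using f by (cases "nonvanishing M") auto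
    finally show "(\<Sum>(A, B)\<in>splittings M. \<epsilon> A B * (if A = {#} then 1 else 0) * f B) = f M" .
  qed
  show "f * 1 = f"
  proof (transfer, rule ext)
    fix f :: "coord multiset \<Rightarrow> real" and M
    assume f: "\<forall>M. \<not> nonvanishing M \<longrightarrow> f M = 0"
    have "(\<Sum>(A, B)\<in>splittings M. \<epsilon> A B * f A * (if B = {#} then 1 else 0))
      = (\<Sum>(A, B)\<in>{(M, {#})}. \<epsilon> A B * f A * (if B = {#} then 1 else 0))"
      by (rule sum.mono_neutral_right) (use finite_splittings in \<open>auto simp: splittings_def split: if_splits\<close>)
    also have "\<dots> = f M" using f by (cases "nonvanishing M") auto
    finally show "(\<Sum>(A, B)\<in>splittings M. \<epsilon> A B * f A * (if B = {#} then 1 else 0)) = f M" .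
  qed
next
  show "(0 :: superseries) \<noteq> 1"
    by transfer (auto dest: fun_cong[of _ _ "{#}"])
qed (transfer; force simp: algebra_simps sum.distrib case_prod_beta)+
end

instantiation superseries :: real_algebra_1
begin
lift_definition scaleR_superseries :: "real \<Rightarrow> superseries \<Rightarrow> superseries"
  is "\<lambda>r f M. r * f M" by simp
instance
  by standard
    (transfer; force simp: algebra_simps sum_distrib_left case_prod_beta intro!: sum.cong)+
end

lift_definition var :: "coord \<Rightarrow> superseries" is "\<lambda>x M. if M = {#x#} then 1 else 0"
  by (fastforce simp: nonvanishing_def split: if_splits)

definition Fun :: "coord set \<Rightarrow> superseries set" where
  "Fun V = {f. \<forall>M. coeff f M \<noteq> 0 \<longrightarrow> set_mset M \<subseteq> V}"

text \<open>\<open>Fun(V)[[\<hbar>]]\<close>; the indeterminate of the formal power series is \<open>\<hbar>\<close>.\<close>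

definition Fun_hbar :: "coord set \<Rightarrow> superseries fps set" where
  "Fun_hbar V = {W. \<forall>k. fps_nth W k \<in> Fun V}"


section \<open>Formal fiber integrals\<close>

text \<open>The graded symmetric matrix \<open>Q\<close> with \<open>q = 1/2 \<Sum> Q\<^sub>x\<^sub>y z\<^sub>x z\<^sub>y\<close> for a quadratic even \<open>q\<close>.\<close>

definition hessian :: "superseries \<Rightarrow> coord \<Rightarrow> coord \<Rightarrow> real" where
  "hessian q x y =
     (if x = y then 2 * coeff q {#x, x#} else \<epsilon> {#x#} {#y#} * coeff q {#x, y#})"

text \<open>The normalized integral against \<open>exp (q / \<hbar>)\<close> has two-point function
  \<open>\<langle>z\<^sub>x z\<^sub>y\<rangle> = \<hbar> G x y\<close> with \<open>G Q = -1\<close>.  For odd coordinates this is the Berezin integral: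
  the weight \<open>exp (c \<theta>\<^sub>1 \<theta>\<^sub>2 / \<hbar>)\<close> gives \<open>\<langle>\<theta>\<^sub>1 \<theta>\<^sub>2\<rangle> = \<hbar> / c\<close>.\<close>

definition propagator :: "coord set \<Rightarrow> superseries \<Rightarrow> coord \<Rightarrow> coord \<Rightarrow> real" where
  "propagator \<Phi> q =
     (THE G. (\<forall>x y. x \<notin> \<Phi> \<or> y \<notin> \<Phi> \<longrightarrow> G x y = 0) \<and>
        (\<forall>x\<in>\<Phi>. \<forall>z\<in>\<Phi>. (\<Sum>y\<in>\<Phi>. G x y * hessian q y z) = (if x = z then -1 else 0)))"

text \<open>Wick's theorem: the first factor is contracted with each later factor, which is first moved
  next to it at the cost of the Koszul sign.\<close>

function wick :: "(coord \<Rightarrow> coord \<Rightarrow> real) \<Rightarrow> coord list \<Rightarrow> real" where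
  "wick G [] = 1"
| "wick G (x # xs) =
     (\<Sum>i<length xs.
        (if odd (ghost (xs ! i)) \<and> odd (\<Sum>y\<leftarrow>take i xs. ghost y) then -1 else 1) *
        G x (xs ! i) * wick G (take i xs @ drop (Suc i) xs))"
  by pat_completeness auto
termination
  by (relation "inv_image less_than (\<lambda>(G, xs). length xs)") auto

text \<open>\<open>formal_integral \<Phi> q f\<close> is the normalized perturbative integral of \<open>f\<close> over the
  coordinates in \<open>\<Phi>\<close> with weight \<open>exp (q / \<hbar>)\<close>: writing
  \<open>f = \<Sum> coeff f (M + N) \<cdot> \<epsilon> M N \<cdot> z\<^sup>M z\<^sup>N\<close> with \<open>N\<close> in \<open>\<Phi>\<close> and \<open>M\<close> outside \<open>\<Phi>\<close>, each \<open>z\<^sup>N\<close> is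
  replaced by its moment, which is of order \<open>j\<close> in \<open>\<hbar>\<close> when \<open>N\<close> has \<open>2 j\<close> elements.\<close>

lift_definition integral_coeff :: "coord set \<Rightarrow> superseries \<Rightarrow> superseries \<Rightarrow> nat \<Rightarrow> superseries" is
  "\<lambda>\<Phi> q f j M. if nonvanishing M \<and> set_mset M \<inter> \<Phi> = {}
     then \<Sum>N\<in>multisets_of_size \<Phi> (2 * j).
            \<epsilon> M N * f (M + N) * wick (propagator \<Phi> q) (sorted_list_of_multiset N)
     else 0"
  by simp

definition formal_integral :: "coord set \<Rightarrow> superseries \<Rightarrow> superseries \<Rightarrow> superseries fps" where
  "formal_integral \<Phi> q f = Abs_fps (integral_coeff \<Phi> q f)"

text \<open>The coefficient of \<open>\<hbar>\<^sup>k z\<^sup>M\<close>, with \<open>k\<close> possibly negative, in \<open>\<Sum>n. P n / (n! \<hbar>\<^sup>n)\<close>.\<close>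

definition exp_coeff :: "(nat \<Rightarrow> superseries fps) \<Rightarrow> int \<Rightarrow> coord multiset \<Rightarrow> real" where
  "exp_coeff P k M =
     (\<Sum>n. if k + int n < 0 then 0 else coeff (fps_nth (P n) (nat (k + int n))) M / fact n)"

text \<open>Give \<open>\<hbar>\<close> weight 2 and every coordinate weight 1.  If all terms of \<open>W\<close> have weight at least
  3, as the cubic interaction does, then \<open>W / \<hbar>\<close> has positive weight, and only
  finitely many powers of it contribute to a given coefficient of its exponential.\<close>

definition perturbative :: "superseries fps \<Rightarrow> bool" where
  "perturbative W \<longleftrightarrow> (\<forall>k M. coeff (fps_nth W k) M \<noteq> 0 \<longrightarrow> 3 \<le> 2 * k + size M)"


section \<open>The Chern-Simons action\<close>

text \<open>An element of \<open>\<gg> \<otimes> C \<otimes> Fun\<close> is written as a list of pure tensors, standing for their sum.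
  The tuple \<open>(X, a, k, f, p)\<close> is \<open>X \<otimes> a \<otimes> f\<close> with \<open>a\<close> of degree \<open>k\<close> and \<open>f\<close> of ghost number \<open>p\<close>.
  Operations extend to coefficients by the Koszul rule with coefficients written on the right:
  moving \<open>f\<close> past an element of degree \<open>l\<close> costs the sign \<open>koszul p l\<close>.\<close>

type_synonym ('g, 'c) tensor = "('g \<times> 'c \<times> nat \<times> superseries \<times> int) list"

definition koszul :: "int \<Rightarrow> nat \<Rightarrow> real" where
  "koszul p k = (if odd p \<and> odd k then -1 else 1)"

definition tdiff :: "'c dgfa \<Rightarrow> ('g, 'c) tensor \<Rightarrow> ('g, 'c) tensor" where
  "tdiff A u = [(X, diff A a, Suc k, f, p). (X, a, k, f, p) \<leftarrow> u]"

definition tbracket ::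
    "'c dgfa \<Rightarrow> 'g qlie \<Rightarrow> ('g, 'c) tensor \<Rightarrow> ('g, 'c) tensor \<Rightarrow> ('g, 'c) tensor" where
  "tbracket A L u v =
     [(br L X Y, mul A a b, k + l, koszul p l *\<^sub>R (f * g), p + q).
        (X, a, k, f, p) \<leftarrow> u, (Y, b, l, g, q) \<leftarrow> v]"

definition tpair :: "'c dgfa \<Rightarrow> 'g qlie \<Rightarrow> ('g, 'c) tensor \<Rightarrow> ('g, 'c) tensor \<Rightarrow> superseries" where
  "tpair A L u v =
     sum_list [(koszul p l * form L X Y * pair A a b) *\<^sub>R (f * g).
        (X, a, k, f, p) \<leftarrow> u, (Y, b, l, g, q) \<leftarrow> v]"

definition free_action :: "'c dgfa \<Rightarrow> 'g qlie \<Rightarrow> ('g, 'c) tensor \<Rightarrow> superseries" where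
  "free_action A L u = (1/2) *\<^sub>R tpair A L u (tdiff A u)"

definition cubic_action :: "'c dgfa \<Rightarrow> 'g qlie \<Rightarrow> ('g, 'c) tensor \<Rightarrow> superseries" where
  "cubic_action A L u = (1/6) *\<^sub>R tpair A L u (tbracket A L u u)"

definition cs_action :: "'c dgfa \<Rightarrow> 'g qlie \<Rightarrow> ('g, 'c) tensor \<Rightarrow> superseries" where
  "cs_action A L u = free_action A L u + cubic_action A L u"


section \<open>The effective action\<close>

text \<open>The choices entering the coordinates: an orthonormal basis \<open>lie_basis\<close> of \<open>\<gg>\<close>, bases
  \<open>coh1\<close>, \<open>coh2\<close>, \<open>coh3\<close> of the cohomology in degrees 1, 2, 3 (in degree 0 the basis is \<open>[1]\<close>),
  and bases \<open>kex k\<close> of the degree \<open>k\<close> parts of \<open>im K\<close>.\<close>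

record ('g, 'c) frame =
  lie_dim :: nat
  lie_basis :: "nat \<Rightarrow> 'g"
  betti1 :: nat
  coh1 :: "nat \<Rightarrow> 'c set"
  coh2 :: "nat \<Rightarrow> 'c set"
  coh3 :: "'c set"
  kex_dim :: "nat \<Rightarrow> nat"
  kex :: "nat \<Rightarrow> nat \<Rightarrow> 'c"

definition adapted_frame ::
    "'c::real_vector dgfa \<Rightarrow> 'g::real_vector qlie \<Rightarrow> ('c set \<Rightarrow> 'c) \<Rightarrow> ('c \<Rightarrow> 'c) \<Rightarrow>
     ('g, 'c) frame \<Rightarrow> bool" where
  "adapted_frame A L \<iota> K R \<longleftrightarrow>
     orthonormal_basis L (lie_dim R) (lie_basis R) \<and>
     coh_basis A 1 (betti1 R) (coh1 R) \<and>
     coh_basis A 2 (betti1 R) (coh2 R) \<and>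
     (\<forall>i<betti1 R. \<forall>j<betti1 R. coh_pair A \<iota> (coh1 R i) (coh2 R j) = (if i = j then 1 else 0)) \<and>
     coh3 R \<in> cohomology A 3 \<and> coh_pair A \<iota> (coh_class A (unit A)) (coh3 R) = 1 \<and>
     (\<forall>k\<le>3. basis_of (range K \<inter> gr A k) (kex_dim R k) (kex R k))"

text \<open>The canonical elements \<open>\<iota>(\<alpha>)\<close> of the base and \<open>\<omega>''\<close> of the fiber \<open>\<gg> \<otimes> im K [1]\<close>.\<close>

definition iota_alpha ::
    "'c::real_vector dgfa \<Rightarrow> ('c set \<Rightarrow> 'c) \<Rightarrow> ('g, 'c) frame \<Rightarrow> ('g, 'c) tensor" where
  "iota_alpha A \<iota> R =
     [(lie_basis R a, \<iota> (coh_class A (unit A)), 0, var (A0 a), ghost (A0 a)).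
        a \<leftarrow> [0..<lie_dim R]] @
     [(lie_basis R a, \<iota> (coh1 R i), 1, var (A1 i a), ghost (A1 i a)).
        i \<leftarrow> [0..<betti1 R], a \<leftarrow> [0..<lie_dim R]] @
     [(lie_basis R a, \<iota> (coh2 R i), 2, var (A2 i a), ghost (A2 i a)).
        i \<leftarrow> [0..<betti1 R], a \<leftarrow> [0..<lie_dim R]] @
     [(lie_basis R a, \<iota> (coh3 R), 3, var (A3 a), ghost (A3 a)).
        a \<leftarrow> [0..<lie_dim R]]"

definition omega_fiber :: "('g, 'c) frame \<Rightarrow> ('g, 'c) tensor" where
  "omega_fiber R =
     [(lie_basis R a, kex R k I, k, var (Fl k I a), ghost (Fl k I a)).
        k \<leftarrow> [0..<4], I \<leftarrow> [0..<kex_dim R k], a \<leftarrow> [0..<lie_dim R]]"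

definition base_coords :: "('g, 'c) frame \<Rightarrow> coord set" where
  "base_coords R =
     {A0 a | a. a < lie_dim R} \<union> {A1 i a | i a. i < betti1 R \<and> a < lie_dim R} \<union>
     {A2 i a | i a. i < betti1 R \<and> a < lie_dim R} \<union> {A3 a | a. a < lie_dim R}"

definition H1_coords :: "('g, 'c) frame \<Rightarrow> coord set" where
  "H1_coords R = {A1 i a | i a. i < betti1 R \<and> a < lie_dim R}"

definition fiber_coords :: "('g, 'c) frame \<Rightarrow> coord set" where
  "fiber_coords R = {Fl k I a | k I a. k < 4 \<and> I < kex_dim R k \<and> a < lie_dim R}"

definition interaction ::
    "'c::real_vector dgfa \<Rightarrow> 'g qlie \<Rightarrow> ('c set \<Rightarrow> 'c) \<Rightarrow> ('g, 'c) frame \<Rightarrow> superseries" where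
  "interaction A L \<iota> R =
     cs_action A L (iota_alpha A \<iota> R @ omega_fiber R) - free_action A L (omega_fiber R)"

text \<open>\<open>exp (W / \<hbar>)\<close> is the normalized fiber integral of \<open>exp (S (\<iota>(\<alpha>) + \<omega>'') / \<hbar>)\<close>.\<close>

definition is_effective_action ::
    "'c::real_vector dgfa \<Rightarrow> 'g qlie \<Rightarrow> ('c set \<Rightarrow> 'c) \<Rightarrow> ('g, 'c) frame \<Rightarrow>
     superseries fps \<Rightarrow> bool" where
  "is_effective_action A L \<iota> R W \<longleftrightarrow>
     W \<in> Fun_hbar (base_coords R) \<and> perturbative W \<and>
     exp_coeff (\<lambda>n. W ^ n) =
     exp_coeff (\<lambda>n. formal_integral (fiber_coords R) (free_action A L (omega_fiber R))
                      (interaction A L \<iota> R ^ n))"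

definition effective_action ::
    "'c::real_vector dgfa \<Rightarrow> 'g qlie \<Rightarrow> ('c set \<Rightarrow> 'c) \<Rightarrow> ('g, 'c) frame \<Rightarrow> superseries fps" where
  "effective_action A L \<iota> R = (THE W. is_effective_action A L \<iota> R W)"

definition W_prod ::
    "'c::real_vector dgfa \<Rightarrow> 'g qlie \<Rightarrow> ('c set \<Rightarrow> 'c) \<Rightarrow> ('g, 'c) frame \<Rightarrow> superseries" where
  "W_prod A L \<iota> R = cubic_action A L (iota_alpha A \<iota> R)"

subsection \<open>Invariant functions on \<open>\<gg>\<^sup>B\<close>\<close>

text \<open>Since the basis of \<open>\<gg>\<close> is orthonormal, \<open>A1 i a\<close> takes the value \<open>\<langle>T\<^sub>a, \<alpha>\<^sub>i\<rangle>\<close> at \<open>(\<alpha>\<^sub>i)\<^sub>i\<close>.\<close>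

fun coord_value :: "'g qlie \<Rightarrow> ('g, 'c) frame \<Rightarrow> (nat \<Rightarrow> 'g) \<Rightarrow> coord \<Rightarrow> real" where
  "coord_value L R \<alpha> (A1 i a) = form L (lie_basis R a) (\<alpha> i)"
| "coord_value L R \<alpha> _ = 0"

text \<open>The polynomial function on \<open>\<gg>\<^sup>B\<close> given by the homogeneous part of degree \<open>r\<close>.\<close>

definition eval_homogeneous ::
    "'g qlie \<Rightarrow> ('g, 'c) frame \<Rightarrow> superseries \<Rightarrow> nat \<Rightarrow> (nat \<Rightarrow> 'g) \<Rightarrow> real" where
  "eval_homogeneous L R f r \<alpha> =
     (\<Sum>M\<in>multisets_of_size (H1_coords R) r.
        coeff f M * (\<Prod>x\<in>#M. coord_value L R \<alpha> x))"

text \<open>\<open>F(\<alpha> + [X, \<alpha>]) = F(\<alpha>)\<close> at first order in \<open>X\<close>.  The adjoint action is linear in \<open>\<alpha>\<close>, so it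
  preserves each homogeneous part of the formal power series \<open>F\<close>.\<close>

definition ad_invariant ::
    "'g::real_vector qlie \<Rightarrow> ('g, 'c) frame \<Rightarrow> superseries fps \<Rightarrow> bool" where
  "ad_invariant L R F \<longleftrightarrow>
     (\<forall>k r \<alpha> X.
        ((\<lambda>s. eval_homogeneous L R (fps_nth F k) r (\<lambda>i. \<alpha> i + s *\<^sub>R br L X (\<alpha> i)))
           has_real_derivative 0) (at 0))"

end

theory Submission
  imports Defs
begin

text \<open>
  The fiber integral is \<open>exp (\<hbar> \<Delta>)\<close> followed by restriction to vanishing fiber coordinates, where
  \<open>\<Delta> = 1/2 \<Sum> G x y \<partial>\<^sub>y \<partial>\<^sub>x\<close> is the second-order operator built from the propagator \<open>G\<close>.  At \<open>\<hbar> = 1\<close>,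
  sort \<open>Z = exp \<Delta> (exp I)\<close> by the number \<open>n\<close> of vertices and write \<open>Z = exp V\<close>.  Comparing degrees
  in \<open>Z\<close> gives a Polchinski equation for \<open>V\<close>, and from it, by induction, the linked-cluster
  bound: \<open>V\<^sub>n\<close> has degree at most \<open>n + 2\<close>.  This bound says exactly that the logarithm of the
  integral is \<open>1 / \<hbar>\<close> times a series in nonnegative powers of \<open>\<hbar>\<close>, so the effective action exists; it is
  unique because the exponential is injective on series of positive weight.

  A derivation \<open>D\<close> that commutes with \<open>\<Delta>\<close> and maps \<open>I\<close> to a function \<open>b\<close> of the base coordinates maps
  \<open>V\<close> to \<open>b\<close>.  Taking for \<open>D\<close> the derivative along \<open>\<alpha>\<^sub>(\<^sub>0\<^sub>)\<close> shows that \<open>V - W\<^sub>p\<^sub>r\<^sub>o\<^sub>d\<close> does not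
  depend on \<open>\<alpha>\<^sub>(\<^sub>0\<^sub>)\<close>; taking the ghost number shows that it has ghost number zero, so that it depends
  on \<open>\<alpha>\<^sub>(\<^sub>1\<^sub>)\<close> only; taking the adjoint action shows that it is invariant.
\<close>

section \<open>The superalgebra of graded commutative power series\<close>

text \<open>The graph expansion is never carried out; it would need a count of connected graphs with
  automorphisms and Koszul signs. The degree does the counting instead. A vertex has three legs and
  a propagator uses up two, so the degree and the number \<open>n\<close> of vertices determine the
  number \<open>m\<close> of propagators, and the Euler derivation replaces differentiation in a
  flow parameter. As \<open>\<Delta>\<close> has second order, on \<open>exp V\<close> it yields
  \<open>\<Delta> V\<close> and a term quadratic in the first derivatives of \<open>V\<close>. This
  fixes the terms with \<open>m\<close> propagators by those with fewer, except at
  \<open>m = 0\<close>, where \<open>Z\<close> is just \<open>exp I\<close>.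

  A term with \<open>n\<close> vertices and \<open>m\<close> propagators carries
  \<open>\<hbar>\<close> to the power \<open>m - n\<close>, hence has weight
  \<open>2 (m - n) + (3 n - 2 m) = n\<close>: sorting by weight is sorting by vertices. In
  \<open>W\<close> a term of degree \<open>d\<close> from \<open>n\<close> vertices carries
  \<open>\<hbar>\<close> to the power \<open>(n + 2 - d) / 2\<close>, so besides the bound on
  \<open>d\<close> the parity of \<open>n + d\<close> has to be controlled.

  Restriction to the base is postponed, since \<open>\<Delta>\<close> differentiates in the fiber;
  as a ring homomorphism it commutes with the exponential.\<close>

lemma superseries_eqI: "(\<And>M. coeff f M = coeff g M) \<Longrightarrow> f = g"
  by (metis coeff_inject ext)

lemma coeff_zero [simp]: "coeff 0 M = 0"
  by (simp add: zero_superseries.rep_eq)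

lemma coeff_one: "coeff 1 M = (if M = {#} then 1 else 0)"
  by (simp add: one_superseries.rep_eq)

lemma coeff_add [simp]: "coeff (f + g) M = coeff f M + coeff g M"
  by (simp add: plus_superseries.rep_eq)

lemma coeff_diff [simp]: "coeff (f - g) M = coeff f M - coeff g M"
  by (simp add: minus_superseries.rep_eq)

lemma coeff_scaleR [simp]: "coeff (r *\<^sub>R f) M = r * coeff f M"
  by (simp add: scaleR_superseries.rep_eq)

lemma coeff_times:
  "coeff (f * g) M = (\<Sum>(A, B)\<in>splittings M. \<epsilon> A B * coeff f A * coeff g B)"
  by (simp add: times_superseries.rep_eq)

lemma coeff_var: "coeff (var x) M = (if M = {#x#} then 1 else 0)"
  by (simp add: var.rep_eq)

lemma coeff_sum [simp]: "coeff (\<Sum>i\<in>S. f i) M = (\<Sum>i\<in>S. coeff (f i) M)"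
  by (induction S rule: infinite_finite_induct) auto

lemma coeff_vanishing: "\<not> nonvanishing M \<Longrightarrow> coeff f M = 0"
  using coeff[of f] by blast

lemma coeff_times_nonzeroE:
  assumes "coeff (f * g) M \<noteq> 0"
  obtains A B where "A + B = M" "coeff f A \<noteq> 0" "coeff g B \<noteq> 0"
proof -
  have "\<exists>p\<in>splittings M. (case p of (A, B) \<Rightarrow> \<epsilon> A B * coeff f A * coeff g B) \<noteq> 0"
    using assms unfolding coeff_times by (rule sum.not_neutral_contains_not_neutral) blast
  then show thesis using that by (auto simp: splittings_def)
qed

section \<open>Signs of reordering and supercommutativity\<close>

definition oddness :: "coord multiset \<Rightarrow> nat" where
  "oddness M = size (filter_mset (\<lambda>x. odd (ghost x)) M)"

lemma oddness_simps [simp]: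
  "oddness {#} = 0" "oddness (M + N) = oddness M + oddness N"
  "oddness (add_mset x M) = (if odd (ghost x) then Suc (oddness M) else oddness M)"
  by (auto simp: oddness_def)

lemma inversions_singleton:
  "(odd (ghost x) \<Longrightarrow> x \<notin># N) \<Longrightarrow>
   inversions {#x#} N + inversions N {#x#} = (if odd (ghost x) then oddness N else 0)"
  by (induction N) (auto simp: inversions_def)

text \<open>An odd element of \<open>M\<close> and an odd element of \<open>N\<close> form an
  inversion in exactly one of the two orders; they are never equal, because the product does not
  vanish.\<close>

lemma inversions_swap:
  "nonvanishing (M + N) \<Longrightarrow> inversions M N + inversions N M = oddness M * oddness N"
proof (induction M)
  case empty
  then show ?case by (simp add: inversions_def)
next
  case (add x M)
  have nv: "nonvanishing (M + N)"
    using add.prems nonvanishing_mono(2)[of "{#x#}" "M + N"] by simp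
  have x: "x \<notin># N" if "odd (ghost x)"
  proof
    assume "x \<in># N"
    then have "count (add_mset x M + N) x \<ge> 2" by (simp add: Suc_le_eq)
    with add.prems that show False unfolding nonvanishing_def
      by (metis Suc_1 not_less_eq_eq)
  qed
  have a: "inversions (add_mset x M) N = inversions {#x#} N + inversions M N"
    using inversions_add(1)[of "{#x#}" M N] by simp
  have b: "inversions N (add_mset x M) = inversions N {#x#} + inversions N M"
    using inversions_add(2)[of N "{#x#}" M] by simp
  have "inversions (add_mset x M) N + inversions N (add_mset x M) =
      (inversions {#x#} N + inversions N {#x#}) + (inversions M N + inversions N M)"
    unfolding a b by simp
  also have "\<dots> = (if odd (ghost x) then oddness N else 0) + oddness M * oddness N"
    using inversions_singleton[OF x] add.IH[OF nv] by presburger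
  finally show ?case by auto
qed

lemma mono_sign_swap: "\<epsilon> A B = (-1) ^ (oddness A * oddness B) * \<epsilon> B A"
proof (cases "nonvanishing (A + B)")
  case True
  have "(-1::real) ^ (oddness A * oddness B) * (-1) ^ inversions B A
      = (-1) ^ inversions A B * ((-1) ^ inversions B A * (-1) ^ inversions B A)"
    using inversions_swap[OF True, symmetric] by (simp add: power_add)
  also have "\<dots> = (-1) ^ inversions A B" by (simp flip: power_add)
  finally show ?thesis using True by (simp add: mono_sign_def add.commute)
qed (simp add: mono_sign_def add.commute)

lemma mono_sign_square: "nonvanishing (A + B) \<Longrightarrow> \<epsilon> A B * \<epsilon> A B = 1"
  by (simp add: mono_sign_def flip: power_add)

text \<open>The grading involution, switched on by \<open>p\<close>: the sign picked up when
  something of parity \<open>p\<close> moves past \<open>f\<close>.\<close>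

lift_definition twist :: "bool \<Rightarrow> superseries \<Rightarrow> superseries" is
  "\<lambda>p f M. if p then (-1) ^ oddness M * f M else f M" by auto

lemma coeff_twist: "coeff (twist p f) M = (if p then (-1) ^ oddness M * coeff f M else coeff f M)"
  by (simp add: twist.rep_eq)

definition of_parity :: "bool \<Rightarrow> superseries \<Rightarrow> bool" where
  "of_parity p f \<longleftrightarrow> (\<forall>M. coeff f M \<noteq> 0 \<longrightarrow> odd (oddness M) = p)"

abbreviation even_series :: "superseries \<Rightarrow> bool" where
  "even_series \<equiv> of_parity False"

lemma twist_False [simp]: "twist False f = f"
  by (rule superseries_eqI) (simp add: coeff_twist)

lemma twist_even [simp]: "even_series f \<Longrightarrow> twist p f = f"
  by (rule superseries_eqI) (auto simp: coeff_twist of_parity_def)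

lemma twist_twist [simp]: "twist p (twist p f) = f"
  by (rule superseries_eqI) (auto simp: coeff_twist simp flip: power_add mult.assoc)

text \<open>The Koszul rule, with the sign put into \<open>twist\<close> so that only
  \<open>g\<close> has to be homogeneous.\<close>

lemma supercommute:
  assumes "of_parity p g"
  shows "g * twist p f = f * g"
proof (rule superseries_eqI)
  fix M
  have "coeff (g * twist p f) M = (\<Sum>(A, B)\<in>splittings M. \<epsilon> B A * coeff g B * coeff (twist p f) A)"
    unfolding coeff_times
    by (rule sum.reindex_bij_witness[of _ prod.swap prod.swap]) (auto simp: splittings_def add.commute)
  also have "\<dots> = coeff (f * g) M"
    unfolding coeff_times
  proof (rule sum.cong[OF refl], clarify)
    fix A B
    show "\<epsilon> B A * coeff g B * coeff (twist p f) A = \<epsilon> A B * coeff f A * coeff g B"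
    proof (cases "coeff g B = 0")
      case False
      then have "odd (oddness B) = p" using assms by (auto simp: of_parity_def)
      then have s: "(-1) ^ (oddness A * oddness B) = (if p then (-1) ^ oddness A else (1::real))"
        by (auto simp: minus_one_power_iff)
      show ?thesis using mono_sign_swap[of A B] unfolding s by (auto simp: coeff_twist)
    qed simp
  qed
  finally show "coeff (g * twist p f) M = coeff (f * g) M" .
qed

lemma even_series_commute: "even_series f \<Longrightarrow> f * g = g * f"
  using supercommute[of False f g] by simp

lemma of_parity_simps [simp, intro]:
  "of_parity p 0" "even_series 1" "of_parity (odd (ghost x)) (var x)"
  "of_parity p f \<Longrightarrow> of_parity p g \<Longrightarrow> of_parity p (f + g)"
  "of_parity p f \<Longrightarrow> of_parity p g \<Longrightarrow> of_parity p (f - g)"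
  "of_parity p f \<Longrightarrow> of_parity p (r *\<^sub>R f)"
  by (force simp: of_parity_def coeff_one coeff_var split: if_splits)+

lemma of_parity_times:
  "of_parity p f \<Longrightarrow> of_parity q g \<Longrightarrow> of_parity (p \<noteq> q) (f * g)"
  unfolding of_parity_def by (auto elim!: coeff_times_nonzeroE)

lemma even_series_times [intro]: "even_series f \<Longrightarrow> even_series g \<Longrightarrow> even_series (f * g)"
  using of_parity_times[of False f False g] by simp

lemma of_parity_sum [intro]: "(\<And>i. i \<in> S \<Longrightarrow> of_parity p (f i)) \<Longrightarrow> of_parity p (\<Sum>i\<in>S. f i)"
  by (induction S rule: infinite_finite_induct) auto

lemma even_series_power [intro]: "even_series f \<Longrightarrow> even_series (f ^ n)"
  by (induction n) auto

subsection \<open>Monomials\<close>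

lift_definition mon :: "coord multiset \<Rightarrow> superseries" is
  "\<lambda>M N. if N = M \<and> nonvanishing M then 1 else 0" by auto

lemma coeff_mon: "coeff (mon M) N = (if N = M \<and> nonvanishing M then 1 else 0)"
  by (simp add: mon.rep_eq)

lemma nonvanishing_singleton [simp]: "nonvanishing {#x#}"
  and nonvanishing_empty [simp]: "nonvanishing {#}"
  by (auto simp: nonvanishing_def)

lemma var_eq_mon: "var x = mon {#x#}"
  by (rule superseries_eqI) (simp add: coeff_var coeff_mon)

lemma mon_empty [simp]: "mon {#} = 1"
  by (rule superseries_eqI) (simp add: coeff_one coeff_mon)

lemma coeff_mon_times: "nonvanishing A \<Longrightarrow> coeff (mon A * f) (A + B) = \<epsilon> A B * coeff f B"
proof -
  assume "nonvanishing A"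
  have "coeff (mon A * f) (A + B) =
      (\<Sum>(C, D)\<in>{(A, B)}. \<epsilon> C D * coeff (mon A) C * coeff f D)"
    unfolding coeff_times
    by (rule sum.mono_neutral_right[OF finite_splittings])
      (auto simp: splittings_def coeff_mon split: if_splits)
  then show ?thesis using \<open>nonvanishing A\<close> by (simp add: coeff_mon)
qed

lemma mon_times: "mon A * mon B = \<epsilon> A B *\<^sub>R mon (A + B)"
proof (cases "nonvanishing A \<and> nonvanishing B")
  case True
  show ?thesis
  proof (rule superseries_eqI)
    fix M
    show "coeff (mon A * mon B) M = coeff (\<epsilon> A B *\<^sub>R mon (A + B)) M"
    proof (cases "M = A + B")
      case M: True
      then show ?thesis using True coeff_mon_times[of A "mon B" B]
        by (auto simp: coeff_mon mono_sign_def)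
    next
      case False
      then have "coeff (mon A * mon B) M = 0"
        by (metis coeff_times_nonzeroE coeff_mon)
      with False show ?thesis by (simp add: coeff_mon)
    qed
  qed
next
  case False
  then have "mon A = 0 \<or> mon B = 0"
    by (metis superseries_eqI coeff_mon coeff_zero)
  moreover have "\<epsilon> A B = 0" using False by (metis nonvanishing_mono mono_sign_def)
  ultimately show ?thesis by auto
qed

subsection \<open>Left derivatives\<close>

text \<open>The sign moves \<open>x\<close> to the front of the monomial before it is removed;
  \<open>count M x + 1\<close> is the exponent of \<open>x\<close> in
  \<open>add_mset x M\<close>.\<close>

lift_definition pd :: "coord \<Rightarrow> superseries \<Rightarrow> superseries" is
  "\<lambda>x f M. (real (count M x) + 1) * \<epsilon> {#x#} M * f (add_mset x M)"
  using nonvanishing_mono(2) by (metis add_mset_add_single add.commute mult_zero_right)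

lemma coeff_pd: "coeff (pd x f) M = (real (count M x) + 1) * \<epsilon> {#x#} M * coeff f (add_mset x M)"
  by (simp add: pd.rep_eq)

lemma coeff_pd_nonzero: "coeff (pd x f) M \<noteq> 0 \<Longrightarrow> coeff f (add_mset x M) \<noteq> 0"
  by (auto simp: coeff_pd)

lemma linear_pd: "linear (pd x)"
  by (rule linearI) (auto intro!: superseries_eqI simp: coeff_pd algebra_simps)

lemmas pd_simps = linear_0[OF linear_pd] linear_add[OF linear_pd] linear_diff[OF linear_pd]
  linear_scale[OF linear_pd] linear_sum[OF linear_pd]

lemma pd_var: "pd x (var y) = (if x = y then 1 else 0)"
  by (rule superseries_eqI) (auto simp: coeff_pd coeff_var coeff_one)

lemma pd_one [simp]: "pd x 1 = 0"
  by (rule superseries_eqI) (auto simp: coeff_pd coeff_one)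

lemma of_parity_pd: "of_parity p f \<Longrightarrow> of_parity (p \<noteq> odd (ghost x)) (pd x f)"
  unfolding of_parity_def by (metis coeff_pd_nonzero even_Suc oddness_simps(3))

text \<open>By \<open>mono_sign_assoc\<close>, moving \<open>x\<close> and \<open>y\<close> to the
  front in the two possible orders differs only by the exchange of \<open>x\<close> with
  \<open>y\<close>.\<close>

lemma pd_commute:
  "pd x (pd y f) = (if odd (ghost x) \<and> odd (ghost y) then -1 else 1) *\<^sub>R pd y (pd x f)"
proof (rule superseries_eqI, goal_cases)
  case (1 M)
  show ?case
  proof (cases "x = y")
    case True
    have "coeff f (add_mset x (add_mset x M)) = 0" if "odd (ghost x)"
      using that by (intro coeff_vanishing) (auto simp: nonvanishing_def intro!: exI[of _ x])
    with True show ?thesis by (simp add: coeff_pd)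
  next
    case False
    have a: "\<epsilon> {#y#} (add_mset x M) * \<epsilon> {#x#} M = \<epsilon> {#y#} {#x#} * \<epsilon> {#x, y#} M"
      using mono_sign_assoc[of "{#y#}" "{#x#}" M] by (simp add: add_mset_commute)
    have b: "\<epsilon> {#x#} (add_mset y M) * \<epsilon> {#y#} M = \<epsilon> {#x#} {#y#} * \<epsilon> {#x, y#} M"
      using mono_sign_assoc[of "{#x#}" "{#y#}" M] by (simp add: add_mset_commute)
    have s: "\<epsilon> {#y#} {#x#} = (if odd (ghost x) \<and> odd (ghost y) then -1 else 1) * \<epsilon> {#x#} {#y#}"
      using mono_sign_swap[of "{#y#}" "{#x#}"] by auto
    have "coeff (pd x (pd y f)) M = (\<epsilon> {#y#} (add_mset x M) * \<epsilon> {#x#} M) *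
        ((real (count M x) + 1) * (real (count M y) + 1) * coeff f (add_mset x (add_mset y M)))"
      using False by (simp add: coeff_pd mult_ac add_mset_commute)
    moreover have "coeff (pd y (pd x f)) M = (\<epsilon> {#x#} (add_mset y M) * \<epsilon> {#y#} M) *
        ((real (count M x) + 1) * (real (count M y) + 1) * coeff f (add_mset x (add_mset y M)))"
      using False by (simp add: coeff_pd mult_ac add_mset_commute)
    ultimately show ?thesis unfolding a b s by simp
  qed
qed

text \<open>The factor \<open>count A x\<close> kills the splittings without \<open>x\<close> on the
  left, and on the others one copy of \<open>x\<close> can be removed. Together with the mirror
  image this is the Leibniz rule for exponents.\<close>

lemma splittings_add_mset_left:
  "(\<Sum>(A, B)\<in>splittings (add_mset x M). real (count A x) * F A B) =
   (\<Sum>(A, B)\<in>splittings M. (real (count A x) + 1) * F (add_mset x A) B)"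
proof -
  have "(\<Sum>(A, B)\<in>splittings (add_mset x M). real (count A x) * F A B) =
     (\<Sum>(A, B)\<in>{(A, B) \<in> splittings (add_mset x M). x \<in># A}. real (count A x) * F A B)"
    by (rule sum.mono_neutral_right) (auto simp: not_in_iff)
  also have "\<dots> = (\<Sum>(A, B)\<in>splittings M. (real (count A x) + 1) * F (add_mset x A) B)"
  proof (rule sum.reindex_bij_witness[of _ "\<lambda>(A, B). (add_mset x A, B)" "\<lambda>(A, B). (A - {#x#}, B)"], goal_cases)
    case (1 p)
    then show ?case by (cases p) auto
  next
    case (2 p)
    then obtain A B where p: "p = (A, B)" "A + B = add_mset x M" "x \<in># A"
      by (auto simp: splittings_def)
    then obtain A' where "A = add_mset x A'" by (metis insert_DiffM)
    with p show ?case by (simp add: splittings_def)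
  next
    case (3 p)
    then show ?case by (cases p) auto
  next
    case (4 p)
    then show ?case by (cases p) (auto simp: splittings_def)
  next
    case (5 p)
    then obtain A B where p: "p = (A, B)" "x \<in># A" by auto
    then obtain A' where "A = add_mset x A'" by (metis insert_DiffM)
    with p show ?case by simp
  qed
  finally show ?thesis .
qed

lemma splittings_add_mset_right:
  "(\<Sum>(A, B)\<in>splittings (add_mset x M). real (count B x) * F A B) =
   (\<Sum>(A, B)\<in>splittings M. (real (count B x) + 1) * F A (add_mset x B))"
proof -
  have sw: "(\<Sum>(A, B)\<in>splittings M. H A B) = (\<Sum>(B, A)\<in>splittings M. H A B)" for M and H :: "_ \<Rightarrow> _ \<Rightarrow> real"
    by (rule sum.reindex_bij_witness[of _ prod.swap prod.swap]) (auto simp: splittings_def add.commute)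
  show ?thesis
    by (subst (1 2) sw) (rule splittings_add_mset_left)
qed

text \<open>The exponent of \<open>x\<close> in a product is the sum of its exponents in the
  factors. Where no monomial vanishes, what remains is an identity of signs, reduced to
  \<open>mono_sign_assoc\<close> by inserting squares of signs.\<close>

lemma pd_times: "pd x (f * g) = pd x f * g + twist (odd (ghost x)) f * pd x g"
proof (rule superseries_eqI, goal_cases)
  case (1 M)
  let ?s = "\<lambda>A. if odd (ghost x) then (-1) ^ oddness A else (1::real)"
  have R: "coeff (pd x f * g + twist (odd (ghost x)) f * pd x g) M =
     (\<Sum>(A, B)\<in>splittings M. (real (count A x) + 1) * (\<epsilon> {#x#} A * \<epsilon> A B * coeff f (add_mset x A) * coeff g B))
   + (\<Sum>(A, B)\<in>splittings M. (real (count B x) + 1) * (?s A * \<epsilon> A B * \<epsilon> {#x#} B * coeff f A * coeff g (add_mset x B)))"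
    unfolding coeff_add coeff_times
    by (intro arg_cong2[where f = "(+)"] sum.cong refl; clarsimp simp: coeff_pd coeff_twist)
  have sx: "\<epsilon> A {#x#} = ?s A * \<epsilon> {#x#} A" for A
    using mono_sign_swap[of A "{#x#}"] by auto
  consider (vanish) "\<not> nonvanishing M" | (good) "nonvanishing (add_mset x M)"
    | (bad) "odd (ghost x)" "x \<in># M" "nonvanishing M"
  proof -
    have "nonvanishing (add_mset x M)" if "nonvanishing M" "odd (ghost x) \<Longrightarrow> x \<notin># M"
      using that by (auto simp: nonvanishing_def not_in_iff)
    then show thesis using that by blast
  qed
  then show ?case
  proof cases
    case vanish
    then show ?thesis by (simp only: coeff_vanishing[OF vanish])
  next
    case good
    let ?e = "\<epsilon> {#x#} M"
    have "coeff (pd x (f * g)) M = (\<Sum>(A, B)\<in>splittings (add_mset x M).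
        (real (count M x) + 1) * (?e * \<epsilon> A B * coeff f A * coeff g B))"
      by (simp add: coeff_pd coeff_times sum_distrib_left mult_ac case_prod_beta)
    also have "\<dots> = (\<Sum>(A, B)\<in>splittings (add_mset x M). real (count A x) * (?e * \<epsilon> A B * coeff f A * coeff g B))
        + (\<Sum>(A, B)\<in>splittings (add_mset x M). real (count B x) * (?e * \<epsilon> A B * coeff f A * coeff g B))"
      unfolding sum.distrib[symmetric] case_prod_beta
    proof (rule sum.cong[OF refl], goal_cases)
      case (1 p)
      then have "fst p + snd p = add_mset x M" by (auto simp: splittings_def)
      then have "count (fst p) x + count (snd p) x = count M x + 1"
        by (metis Suc_eq_plus1 count_add_mset count_union)
      then have "real (count M x) + 1 = real (count (fst p) x) + real (count (snd p) x)"
        by linarith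
      then show ?case by (simp add: distrib_right)
    qed
    also have "\<dots> = (\<Sum>(A, B)\<in>splittings M. (real (count A x) + 1) * (?e * \<epsilon> (add_mset x A) B * coeff f (add_mset x A) * coeff g B))
        + (\<Sum>(A, B)\<in>splittings M. (real (count B x) + 1) * (?e * \<epsilon> A (add_mset x B) * coeff f A * coeff g (add_mset x B)))"
      by (subst splittings_add_mset_left, subst splittings_add_mset_right) simp
    also have "\<dots> = coeff (pd x f * g + twist (odd (ghost x)) f * pd x g) M"
      unfolding R
    proof (rule arg_cong2[where f = "(+)"]; intro sum.cong refl; clarify)
      fix A B assume "(A, B) \<in> splittings M"
      then have M: "M = A + B" by (simp add: splittings_def)
      have nv: "nonvanishing ({#x#} + A)" "nonvanishing ({#x#} + B)" "nonvanishing ({#x#} + (A + B))"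
        using good nonvanishing_mono[of "{#x#} + A" B] nonvanishing_mono(1)[of "{#x#} + B" A]
        unfolding M by (simp_all add: add_ac)
      have as: "\<epsilon> {#x#} A * \<epsilon> (add_mset x A) B = \<epsilon> {#x#} M * \<epsilon> A B"
        using mono_sign_assoc[of "{#x#}" A B] M by simp
      have "?e * \<epsilon> (add_mset x A) B = ?e * (\<epsilon> {#x#} A * \<epsilon> {#x#} A) * \<epsilon> (add_mset x A) B"
        using mono_sign_square[OF nv(1)] by simp
      also have "\<dots> = (?e * ?e) * \<epsilon> {#x#} A * \<epsilon> A B"
        using as by (simp add: mult_ac)
      also have "\<dots> = \<epsilon> {#x#} A * \<epsilon> A B"
        using mono_sign_square[OF nv(3)] M by simp
      finally have 1: "?e * \<epsilon> (add_mset x A) B = \<epsilon> {#x#} A * \<epsilon> A B" .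
      show "(real (count A x) + 1) * (?e * \<epsilon> (add_mset x A) B * coeff f (add_mset x A) * coeff g B) =
        (real (count A x) + 1) * (\<epsilon> {#x#} A * \<epsilon> A B * coeff f (add_mset x A) * coeff g B)"
        unfolding 1 ..
      have as2: "\<epsilon> A {#x#} * \<epsilon> (add_mset x A) B = \<epsilon> A (add_mset x B) * \<epsilon> {#x#} B"
        using mono_sign_assoc[of A "{#x#}" B] by simp
      have "?e * \<epsilon> A (add_mset x B) = ?e * \<epsilon> A (add_mset x B) * (\<epsilon> {#x#} B * \<epsilon> {#x#} B)"
        using mono_sign_square[OF nv(2)] by simp
      also have "\<dots> = ?e * \<epsilon> {#x#} B * ?s A * (\<epsilon> {#x#} A * \<epsilon> (add_mset x A) B)"
        using as2 sx[of A] by (simp add: mult_ac)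
      also have "\<dots> = (?e * ?e) * \<epsilon> {#x#} B * ?s A * \<epsilon> A B"
        unfolding as by (simp add: mult_ac)
      also have "\<dots> = ?s A * \<epsilon> A B * \<epsilon> {#x#} B"
        using mono_sign_square[OF nv(3)] M by simp
      finally have 2: "?e * \<epsilon> A (add_mset x B) = ?s A * \<epsilon> A B * \<epsilon> {#x#} B" .
      show "(real (count B x) + 1) * (?e * \<epsilon> A (add_mset x B) * coeff f A * coeff g (add_mset x B)) =
        (real (count B x) + 1) * (?s A * \<epsilon> A B * \<epsilon> {#x#} B * coeff f A * coeff g (add_mset x B))"
        unfolding 2 ..
    qed
    finally show ?thesis .
  next
    \<comment> \<open>An odd \<open>x\<close> already occurs in \<open>M\<close>, so the left side
      is zero. On the right, the splittings with this \<open>x\<close> in \<open>B\<close> in the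
      first sum cancel those with it in \<open>A\<close> in the second.\<close>
    case bad
    have nb: "\<not> nonvanishing (add_mset x M)"
      using bad(1,2) by (auto simp: nonvanishing_def intro!: exI[of _ x])
    have L: "coeff (pd x (f * g)) M = 0"
      by (simp only: coeff_pd coeff_vanishing[OF nb] mult_zero_right)
    let ?F = "\<lambda>A B. \<epsilon> {#x#} A * \<epsilon> A B * coeff f (add_mset x A) * coeff g B"
    let ?G = "\<lambda>A B. ?s A * \<epsilon> A B * \<epsilon> {#x#} B * coeff f A * coeff g (add_mset x B)"
    obtain M' where M': "M = add_mset x M'" using bad(2) by (auto dest: multi_member_split)
    have cM: "x \<notin># M'" using bad M' by (auto simp: nonvanishing_def not_in_iff)
    have f0: "coeff h (add_mset x A) = 0" if "x \<in># A" for h A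
      using that bad(1) by (intro coeff_vanishing) (auto simp: nonvanishing_def intro!: exI[of _ x])
    have A: "(\<Sum>(A, B)\<in>splittings M. (real (count A x) + 1) * ?F A B) =
        (\<Sum>(A, B)\<in>splittings M. real (count B x) * ?F A B)"
    proof (intro sum.cong refl, clarify)
      fix A B assume "(A, B) \<in> splittings M"
      then have "A + B = add_mset x M'" by (simp add: splittings_def M')
      then have "count A x + count B x = 1" using cM
        by (metis One_nat_def count_add_mset count_union not_in_iff)
      then show "(real (count A x) + 1) * ?F A B = real (count B x) * ?F A B"
        using f0[of A f] by (cases "x \<in># A") (auto simp: not_in_iff)
    qed
    have B: "(\<Sum>(A, B)\<in>splittings M. (real (count B x) + 1) * ?G A B) =
        (\<Sum>(A, B)\<in>splittings M. real (count A x) * ?G A B)"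
    proof (intro sum.cong refl, clarify)
      fix A B assume "(A, B) \<in> splittings M"
      then have "A + B = add_mset x M'" by (simp add: splittings_def M')
      then have "count A x + count B x = 1" using cM
        by (metis One_nat_def count_add_mset count_union not_in_iff)
      then show "(real (count B x) + 1) * ?G A B = real (count A x) * ?G A B"
        using f0[of B g] by (cases "x \<in># B") (auto simp: not_in_iff)
    qed
    have "(\<Sum>(A, B)\<in>splittings M. real (count B x) * ?F A B)
        + (\<Sum>(A, B)\<in>splittings M. real (count A x) * ?G A B) = 0"
      unfolding M' splittings_add_mset_left splittings_add_mset_right sum.distrib[symmetric] case_prod_beta
    proof (rule sum.neutral, clarify, simp only: fst_conv snd_conv)
      fix A B assume "(A, B) \<in> splittings M'"
      then have M: "M' = A + B" by (simp add: splittings_def)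
      have c: "count A x = 0" "count B x = 0" using cM by (auto simp: M not_in_iff)
      have nv: "nonvanishing ({#x#} + A)" "nonvanishing ({#x#} + B)"
        using bad(3) nonvanishing_mono(1)[of "{#x#} + A" B] nonvanishing_mono(1)[of "{#x#} + B" A]
        unfolding M M' by (simp_all add: add_ac)
      have as2: "\<epsilon> A {#x#} * \<epsilon> (add_mset x A) B = \<epsilon> A (add_mset x B) * \<epsilon> {#x#} B"
        using mono_sign_assoc[of A "{#x#}" B] by simp
      have "\<epsilon> {#x#} A * \<epsilon> A (add_mset x B) = \<epsilon> {#x#} A * (\<epsilon> A (add_mset x B) * \<epsilon> {#x#} B) * \<epsilon> {#x#} B"
        using mono_sign_square[OF nv(2)] by simp
      also have "\<dots> = (\<epsilon> {#x#} A * \<epsilon> {#x#} A) * ?s A * \<epsilon> (add_mset x A) B * \<epsilon> {#x#} B"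
        unfolding as2[symmetric] sx by (simp add: mult_ac)
      also have "\<dots> = - ?s (add_mset x A) * \<epsilon> (add_mset x A) B * \<epsilon> {#x#} B"
        using mono_sign_square[OF nv(1)] bad(1) by simp
      finally show "(real (count B x) + 1) * ?F A (add_mset x B) + (real (count A x) + 1) * ?G (add_mset x A) B = 0"
        using c by simp
    qed
    then show ?thesis unfolding L R A B by simp
  qed
qed

lemma pd_times_even: "even_series f \<Longrightarrow> pd x (f * g) = pd x f * g + f * pd x g"
  by (simp add: pd_times)


subsection \<open>Derivations of weight and linear vector fields\<close>

text \<open>The vector field \<open>\<Sum> w x * var x * pd x\<close>, diagonal on monomials. Weight
  1 gives the degree, and the weight \<open>ghost\<close> gives the ghost number.\<close>

lift_definition wt :: "(coord \<Rightarrow> real) \<Rightarrow> superseries \<Rightarrow> superseries" is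
  "\<lambda>w f M. (\<Sum>x\<in>#M. w x) * f M" by simp

lemma coeff_wt: "coeff (wt w f) M = (\<Sum>x\<in>#M. w x) * coeff f M"
  by (simp add: wt.rep_eq)

lemma linear_wt: "linear (wt w)"
  by (rule linearI) (auto intro!: superseries_eqI simp: coeff_wt algebra_simps)

lemma wt_times: "wt w (f * g) = wt w f * g + f * wt w g"
proof (rule superseries_eqI)
  fix M
  show "coeff (wt w (f * g)) M = coeff (wt w f * g + f * wt w g) M"
    unfolding coeff_wt coeff_add coeff_times sum.distrib[symmetric] sum_distrib_left
    by (rule sum.cong[OF refl]) (auto simp: splittings_def coeff_wt algebra_simps)
qed

lemma wt_pd: "wt w (pd x f) = pd x (wt w f) - w x *\<^sub>R pd x f"
  by (rule superseries_eqI) (simp add: coeff_wt coeff_pd algebra_simps)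

definition linear_field :: "coord set \<Rightarrow> (coord \<Rightarrow> coord \<Rightarrow> real) \<Rightarrow> superseries \<Rightarrow> superseries" where
  "linear_field S X f = (\<Sum>x\<in>S. \<Sum>z\<in>S. X x z *\<^sub>R (var z * pd x f))"

lemma linear_linear_field: "linear (linear_field S X)"
  by (rule linearI)
    (auto simp: linear_field_def pd_simps distrib_left scaleR_add_right sum.distrib
      scaleR_sum_right mult_ac)

definition even_field :: "coord set \<Rightarrow> (coord \<Rightarrow> coord \<Rightarrow> real) \<Rightarrow> bool" where
  "even_field S X \<longleftrightarrow> (\<forall>x\<in>S. \<forall>z\<in>S. X x z \<noteq> 0 \<longrightarrow> odd (ghost x) = odd (ghost z))"

text \<open>Since \<open>z\<close> has the parity of \<open>x\<close>, moving \<open>var z\<close>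
  past \<open>f\<close> undoes the sign that \<open>pd x\<close> acquires there.\<close>

lemma linear_field_times:
  assumes "even_field S X"
  shows "linear_field S X (f * g) = linear_field S X f * g + f * linear_field S X g"
  unfolding linear_field_def sum_distrib_left sum_distrib_right sum.distrib[symmetric]
proof (intro sum.cong refl)
  fix x z assume xz: "x \<in> S" "z \<in> S"
  show "X x z *\<^sub>R (var z * pd x (f * g)) =
    X x z *\<^sub>R (var z * pd x f) * g + f * (X x z *\<^sub>R (var z * pd x g))"
  proof (cases "X x z = 0")
    case False
    then have p: "odd (ghost x) = odd (ghost z)" using assms xz by (auto simp: even_field_def)
    have "var z * twist (odd (ghost x)) f = f * var z"
      unfolding p by (rule supercommute) auto
    then have "var z * pd x (f * g) = var z * pd x f * g + f * (var z * pd x g)"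
      by (metis pd_times distrib_left mult.assoc)
    then show ?thesis by (simp add: scaleR_add_right)
  qed simp
qed

lemma linear_field_var:
  assumes "finite S" "y \<in> S"
  shows "linear_field S X (var y) = (\<Sum>z\<in>S. X y z *\<^sub>R var z)"
proof -
  have "linear_field S X (var y) = (\<Sum>x\<in>S. if x = y then (\<Sum>z\<in>S. X y z *\<^sub>R var z) else 0)"
    unfolding linear_field_def by (rule sum.cong) (auto simp: pd_var)
  then show ?thesis using assms by simp
qed

text \<open>The commutator comes from \<open>pd y\<close> hitting the linear coefficient
  \<open>var z\<close>; the remaining signs cancel because the field is even.\<close>

lemma pd_linear_field:
  assumes "even_field S X" "finite S" "y \<in> S"
  shows "pd y (linear_field S X f) = linear_field S X (pd y f) + (\<Sum>x\<in>S. X x y *\<^sub>R pd x f)"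
proof -
  have *: "X x z *\<^sub>R pd y (var z * pd x f) =
      X x z *\<^sub>R (var z * pd x (pd y f)) + (if z = y then X x z *\<^sub>R pd x f else 0)"
    if xz: "x \<in> S" "z \<in> S" for x z
  proof (cases "X x z = 0")
    case False
    then have p: "odd (ghost x) = odd (ghost z)" using assms xz by (auto simp: even_field_def)
    have t: "twist (odd (ghost y)) (var z) = (if odd (ghost y) \<and> odd (ghost z) then -1 else 1) *\<^sub>R var z"
      by (rule superseries_eqI) (auto simp: coeff_twist coeff_var)
    show ?thesis
      unfolding pd_times t pd_commute[of x y] p pd_var
      by (auto simp: scaleR_add_right)
  qed auto
  show ?thesis
    unfolding linear_field_def pd_simps
    using assms(2,3) by (simp add: * sum.distrib cong: sum.cong)
qed

subsection \<open>Exponential and logarithm\<close>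

text \<open>The variable of the power series counts vertices. When \<open>V\<close> has no constant
  term, \<open>V ^ r\<close> starts in order \<open>r\<close>, so stopping at \<open>r = n\<close>
  loses nothing and every coefficient is a finite sum.\<close>

definition fexp :: "superseries fps \<Rightarrow> superseries fps" where
  "fexp V = Abs_fps (\<lambda>n. \<Sum>r\<le>n. (1 / fact r) *\<^sub>R fps_nth (V ^ r) n)"

lemma fexp_nth: "fps_nth (fexp V) n = (\<Sum>r\<le>n. (1 / fact r) *\<^sub>R fps_nth (V ^ r) n)"
  by (simp add: fexp_def)

lemma fps_power_nth_below:
  fixes V :: "'a::ring_1 fps"
  assumes "fps_nth V 0 = 0" "n < r"
  shows "fps_nth (V ^ r) n = 0"
  using assms(2)
proof (induction r arbitrary: n)
  case (Suc r)
  have "fps_nth V i * fps_nth (V ^ r) (n - i) = 0" if "i \<in> {0..n}" for i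
    using that Suc assms(1) by (cases "i = 0") auto
  then show ?case by (simp add: fps_mult_nth)
qed simp

lemma fexp_nth_upto:
  assumes "fps_nth V 0 = 0" "n \<le> m"
  shows "fps_nth (fexp V) n = (\<Sum>r\<le>m. (1 / fact r) *\<^sub>R fps_nth (V ^ r) n)"
  unfolding fexp_nth
  by (rule sum.mono_neutral_left) (use assms(2) in \<open>auto simp: fps_power_nth_below[OF assms(1)]\<close>)

definition even_fps :: "superseries fps \<Rightarrow> bool" where
  "even_fps V \<longleftrightarrow> (\<forall>n. even_series (fps_nth V n))"

lemma even_fps_times: "even_fps f \<Longrightarrow> even_fps g \<Longrightarrow> even_fps (f * g)"
  by (auto simp: even_fps_def fps_mult_nth)

lemma even_fps_commute:
  assumes "even_fps f"
  shows "f * g = g * f"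
proof (rule fps_ext)
  fix n
  have "fps_nth (f * g) n = (\<Sum>i=0..n. fps_nth g (n - i) * fps_nth f i)"
    unfolding fps_mult_nth using assms even_series_commute by (auto simp: even_fps_def intro!: sum.cong)
  also have "\<dots> = fps_nth (g * f) n"
    unfolding fps_mult_nth
    by (rule sum.reindex_bij_witness[of _ "\<lambda>i. n - i" "\<lambda>i. n - i"]) auto
  finally show "fps_nth (f * g) n = fps_nth (g * f) n" .
qed

text \<open>The derivation may depend on the order. This covers a fixed derivation of the
  coefficients, multiplication by the order \<open>n\<close>, and the combination of the latter with
  the Euler derivation.\<close>

lemma fexp_derivation:
  assumes lin: "\<And>n. linear (d n)"
    and leib: "\<And>i j a b. even_series a \<Longrightarrow> d (i + j) (a * b) = d i a * b + a * d j b"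
    and V: "fps_nth V 0 = 0" "even_fps V"
  shows "d n (fps_nth (fexp V) n) = (\<Sum>i=0..n. d i (fps_nth V i) * fps_nth (fexp V) (n - i))"
proof -
  define D where "D f = Abs_fps (\<lambda>n. d n (fps_nth f n))" for f
  have D_nth: "fps_nth (D f) n = d n (fps_nth f n)" for f n by (simp add: D_def)
  note d_simps = linear_0[OF lin] linear_add[OF lin] linear_scale[OF lin] linear_sum[OF lin]
  have D_times: "D (f * g) = D f * g + f * D g" if "even_fps f" for f g
  proof (rule fps_ext)
    fix n
    have "d n (\<Sum>i=0..n. fps_nth f i * fps_nth g (n - i)) =
        (\<Sum>i=0..n. d i (fps_nth f i) * fps_nth g (n - i) + fps_nth f i * d (n - i) (fps_nth g (n - i)))"
      unfolding d_simps
    proof (rule sum.cong[OF refl])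
      fix i assume "i \<in> {0..n}"
      then show "d n (fps_nth f i * fps_nth g (n - i)) =
          d i (fps_nth f i) * fps_nth g (n - i) + fps_nth f i * d (n - i) (fps_nth g (n - i))"
        using leib[of "fps_nth f i" i "n - i" "fps_nth g (n - i)"] that by (simp add: even_fps_def)
    qed
    then show "fps_nth (D (f * g)) n = fps_nth (D f * g + f * D g) n"
      by (simp add: D_nth fps_mult_nth sum.distrib)
  qed
  have d1: "d 0 1 = 0" using leib[of 1 0 0 1] by simp
  have D_power: "fps_nth (D (V ^ Suc r)) n = (1 + real r) *\<^sub>R fps_nth (D V * V ^ r) n" for r n
  proof (induction r arbitrary: n)
    case (Suc r)
    have "V * (D V * V ^ r) = D V * V ^ Suc r"
      using even_fps_commute[OF V(2), of "D V"] by (metis mult.assoc power_Suc)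
    then have c: "(\<Sum>i=0..n. fps_nth V i * fps_nth (D V * V ^ r) (n - i)) = fps_nth (D V * V ^ Suc r) n"
      by (metis fps_mult_nth)
    have "fps_nth (D (V ^ Suc (Suc r))) n =
        fps_nth (D V * V ^ Suc r) n + fps_nth (V * D (V ^ Suc r)) n"
      using D_times[OF V(2), of "V ^ Suc r"] by simp
    also have "fps_nth (V * D (V ^ Suc r)) n =
        (\<Sum>i=0..n. fps_nth V i * ((1 + real r) *\<^sub>R fps_nth (D V * V ^ r) (n - i)))"
      unfolding fps_mult_nth[of V] Suc.IH ..
    also have "\<dots> = (1 + real r) *\<^sub>R fps_nth (D V * V ^ Suc r) n"
      unfolding c[symmetric] by (simp add: scaleR_sum_right)
    finally have "fps_nth (D (V ^ Suc (Suc r))) n =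
        1 *\<^sub>R fps_nth (D V * V ^ Suc r) n + (1 + real r) *\<^sub>R fps_nth (D V * V ^ Suc r) n"
      by simp
    then show ?case unfolding scaleR_left_distrib[symmetric] by simp
  qed simp
  have V0: "fps_nth (D V) 0 = 0" by (simp add: D_nth V(1) d_simps)
  have "d n (fps_nth (fexp V) n) = (\<Sum>r\<le>n. (1 / fact r) *\<^sub>R fps_nth (D (V ^ r)) n)"
    by (simp add: fexp_nth d_simps D_nth)
  also have "\<dots> = (\<Sum>r\<le>Suc n. (1 / fact r) *\<^sub>R fps_nth (D (V ^ r)) n)"
  proof -
    have "fps_nth (D (V ^ Suc n)) n = 0"
      using V fps_power_nth_below[of V n "Suc n"] by (simp add: D_nth d_simps del: power_Suc)
    then show ?thesis by (simp del: power_Suc)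
  qed
  also have "\<dots> = (\<Sum>r\<le>n. (1 / fact (Suc r)) *\<^sub>R fps_nth (D (V ^ Suc r)) n)"
  proof -
    have "fps_nth (D (V ^ 0)) n = 0" using d1 d_simps(1) by (cases n) (auto simp: D_nth)
    then show ?thesis by (subst sum.atMost_Suc_shift) simp
  qed
  also have "\<dots> = (\<Sum>r\<le>n. (1 / fact r) *\<^sub>R fps_nth (D V * V ^ r) n)"
  proof (rule sum.cong[OF refl])
    fix r
    have "1 / fact (Suc r) * (1 + real r) = 1 / fact r"
      by (simp add: field_simps add_nonneg_eq_0_iff)
    then show "(1 / fact (Suc r)) *\<^sub>R fps_nth (D (V ^ Suc r)) n = (1 / fact r) *\<^sub>R fps_nth (D V * V ^ r) n"
      unfolding D_power by (simp only: scaleR_scaleR)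
  qed
  also have "\<dots> = (\<Sum>i=0..n. fps_nth (D V) i * (\<Sum>r\<le>n. (1 / fact r) *\<^sub>R fps_nth (V ^ r) (n - i)))"
    unfolding fps_mult_nth scaleR_sum_right sum_distrib_left
    by (subst sum.swap) simp
  also have "\<dots> = (\<Sum>i=0..n. d i (fps_nth V i) * fps_nth (fexp V) (n - i))"
    by (rule sum.cong) (auto simp: fexp_nth_upto[OF V(1), of _ n] D_nth)
  finally show ?thesis .
qed

lemma fps_mult_right_cancel_unipotent:
  fixes f g Z :: "'a::ring_1 fps"
  assumes "f * Z = g * Z" "fps_nth Z 0 = 1"
  shows "f = g"
proof (rule fps_ext)
  fix n
  have z: "(\<Sum>i=0..n. (fps_nth f i - fps_nth g i) * fps_nth Z (n - i)) = 0" for n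
    using arg_cong[OF assms(1), of "\<lambda>h. fps_nth h n"]
    by (simp add: fps_mult_nth left_diff_distrib sum_subtractf)
  show "fps_nth f n = fps_nth g n"
  proof (induction n rule: less_induct)
    case (less n)
    have "(\<Sum>i=0..n. (fps_nth f i - fps_nth g i) * fps_nth Z (n - i)) =
        (\<Sum>i\<in>{n}. (fps_nth f i - fps_nth g i) * fps_nth Z (n - i))"
      by (rule sum.mono_neutral_right) (use less in auto)
    then show ?case using z[of n] assms(2) by simp
  qed
qed

text \<open>Differentiating \<open>Z = exp V\<close> in the counting variable gives
  \<open>n Z n = \<Sum> a V a Z (n - a)\<close>; the recursion solves this for the term
  \<open>a = n\<close>, where \<open>Z 0 = 1\<close>.\<close>

fun log_coeff :: "(nat \<Rightarrow> superseries) \<Rightarrow> nat \<Rightarrow> superseries" where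
  "log_coeff Z n = (if n = 0 then 0 else
     Z n - (1 / real n) *\<^sub>R (\<Sum>a\<in>{1..<n}. real a *\<^sub>R (log_coeff Z a * Z (n - a))))"

declare log_coeff.simps [simp del]

lemma log_coeff_0 [simp]: "log_coeff Z 0 = 0"
  by (simp add: log_coeff.simps)

lemma log_coeff_recursion:
  assumes "Z 0 = 1"
  shows "real n *\<^sub>R Z n = (\<Sum>a=0..n. real a *\<^sub>R (log_coeff Z a * Z (n - a)))"
proof (cases "n = 0")
  case False
  then have "{0..n} = insert 0 (insert n {1..<n})" by auto
  then have "(\<Sum>a=0..n. real a *\<^sub>R (log_coeff Z a * Z (n - a))) =
      real n *\<^sub>R log_coeff Z n + (\<Sum>a\<in>{1..<n}. real a *\<^sub>R (log_coeff Z a * Z (n - a)))"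
    using False assms by simp
  then show ?thesis using False by (subst (asm) (2) log_coeff.simps) (simp add: algebra_simps)
qed simp

lemma log_coeff_even:
  assumes "\<And>n. even_series (Z n)"
  shows "even_series (log_coeff Z n)"
proof (induction n rule: less_induct)
  case (less n)
  have "even_series (\<Sum>a\<in>{1..<n}. real a *\<^sub>R (log_coeff Z a * Z (n - a)))"
    using less assms by (intro of_parity_sum of_parity_simps even_series_times) auto
  then show ?case by (subst log_coeff.simps) (auto intro: assms)
qed

lemma fexp_log:
  assumes "Z 0 = 1" "\<And>n. even_series (Z n)"
  shows "fps_nth (fexp (Abs_fps (log_coeff Z))) n = Z n"
proof (induction n rule: less_induct)
  case (less n)
  let ?V = "Abs_fps (log_coeff Z)"
  show ?case
  proof (cases "n = 0")
    case True
    then show ?thesis using assms(1) by (simp add: fexp_nth)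
  next
    case False
    have "real n *\<^sub>R fps_nth (fexp ?V) n =
        (\<Sum>i=0..n. (real i *\<^sub>R fps_nth ?V i) * fps_nth (fexp ?V) (n - i))"
      by (rule fexp_derivation)
        (auto intro!: linearI simp: algebra_simps even_fps_def log_coeff_even assms(2))
    also have "\<dots> = (\<Sum>i=0..n. real i *\<^sub>R (log_coeff Z i * Z (n - i)))"
    proof (rule sum.cong[OF refl])
      fix i assume "i \<in> {0..n}"
      then show "(real i *\<^sub>R fps_nth ?V i) * fps_nth (fexp ?V) (n - i) = real i *\<^sub>R (log_coeff Z i * Z (n - i))"
        using less[of "n - i"] False by (cases "i = 0") auto
    qed
    also have "\<dots> = real n *\<^sub>R Z n" using log_coeff_recursion[of Z, OF assms(1)] by simp
    finally show ?thesis using False by simp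
  qed
qed

text \<open>With at least two factors of positive order, none of them can reach order
  \<open>n\<close>. So only \<open>r = 1\<close> sees the coefficient \<open>n\<close> itself, which
  makes the exponential injective order by order.\<close>

lemma fps_power_nth_cong:
  fixes V V' :: "'a::ring_1 fps"
  assumes "fps_nth V 0 = 0" "fps_nth V' 0 = 0" "\<And>i. i < n \<Longrightarrow> fps_nth V i = fps_nth V' i"
    and "r \<noteq> 1"
  shows "fps_nth (V ^ r) n = fps_nth (V' ^ r) n"
proof -
  have below: "fps_nth (V ^ r) i = fps_nth (V' ^ r) i" if "i < n" for r i
    using that
  proof (induction r arbitrary: i)
    case (Suc r)
    then show ?case using assms(3) by (auto simp: fps_mult_nth intro!: sum.cong)
  qed simp
  show ?thesis
  proof (cases r)
    case (Suc s)
    have "fps_nth V i * fps_nth (V ^ s) (n - i) = fps_nth V' i * fps_nth (V' ^ s) (n - i)"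
      if i: "i \<in> {0..n}" for i
    proof -
      consider "i = 0" | "i = n" "n > 0" | "0 < i" "i < n" using i by fastforce
      then show ?thesis
      proof cases
        case 2
        then have "s > 0" using assms(4) Suc by simp
        then have "fps_nth (V ^ s) 0 = 0" "fps_nth (V' ^ s) 0 = 0"
          using assms(1,2) by (auto intro: fps_power_nth_below)
        then show ?thesis using 2 by simp
      qed (use assms below in auto)
    qed
    then show ?thesis by (simp add: Suc fps_mult_nth)
  qed simp
qed

lemma fexp_inject:
  assumes "fps_nth V 0 = 0" "fps_nth V' 0 = 0" "fexp V = fexp V'"
  shows "V = V'"
proof (rule fps_ext)
  fix n
  show "fps_nth V n = fps_nth V' n"
  proof (induction n rule: less_induct)
    case (less n)
    show ?case
    proof (cases "n = 0")
      case False
      let ?f = "\<lambda>V r. (1 / fact r) *\<^sub>R fps_nth (V ^ r :: superseries fps) n"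
      have split: "fps_nth (fexp V) n = fps_nth V n + (\<Sum>r\<in>{..n} - {1}. ?f V r)" for V
        unfolding fexp_nth using False by (subst sum.remove[of _ 1]) auto
      have "(\<Sum>r\<in>{..n} - {1}. ?f V r) = (\<Sum>r\<in>{..n} - {1}. ?f V' r)"
        using fps_power_nth_cong[OF assms(1,2) less] by (intro sum.cong) auto
      then show ?thesis using split[of V] split[of V'] assms(3) by simp
    qed (simp add: assms)
  qed
qed

section \<open>Gaussian integration as the exponential of a Laplacian\<close>

definition fmap :: "(superseries \<Rightarrow> superseries) \<Rightarrow> superseries fps \<Rightarrow> superseries fps" where
  "fmap \<phi> f = Abs_fps (\<lambda>n. \<phi> (fps_nth f n))"

lemma fmap_nth [simp]: "fps_nth (fmap \<phi> f) n = \<phi> (fps_nth f n)"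
  by (simp add: fmap_def)

lemma fmap_pd_times:
  assumes "even_fps f"
  shows "fmap (pd x) (f * g) = fmap (pd x) f * g + f * fmap (pd x) g"
  using assms
  by (auto simp: fps_eq_iff fps_mult_nth pd_simps pd_times_even even_fps_def sum.distrib)

lemma fexp_derivation_const:
  assumes "linear D" "\<And>a b. even_series a \<Longrightarrow> D (a * b) = D a * b + a * D b"
    and "fps_nth V 0 = 0" "even_fps V"
  shows "fmap D (fexp V) = fmap D V * fexp V"
  using fexp_derivation[of "\<lambda>_. D", OF assms(1) _ assms(3,4)] assms(2)
  by (simp add: fps_eq_iff fps_mult_nth)

lemma pd_twist_eq_0: "pd x f = 0 \<Longrightarrow> pd x (twist p f) = 0"
proof (rule superseries_eqI)
  fix M assume "pd x f = 0"
  then have "coeff (pd x f) M = 0" by simp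
  then show "coeff (pd x (twist p f)) M = coeff 0 M"
    by (auto simp: coeff_pd coeff_twist)
qed

abbreviation euler :: "superseries \<Rightarrow> superseries" where
  "euler \<equiv> wt (\<lambda>_. 1)"

lemma coeff_euler: "coeff (euler f) M = real (size M) * coeff f M"
  by (simp add: coeff_wt)

text \<open>\<open>G_sym\<close> matches the commutation rule of the derivatives, so the two
  orderings of a pair of coordinates add up in the Laplacian instead of cancelling.
  \<open>G_ghost\<close> makes the Laplacian even and of ghost number zero.\<close>

locale gaussian =
  fixes \<Phi> :: "coord set" and G :: "coord \<Rightarrow> coord \<Rightarrow> real"
  assumes finite_\<Phi>: "finite \<Phi>"
    and G_support: "G x y \<noteq> 0 \<Longrightarrow> x \<in> \<Phi> \<and> y \<in> \<Phi>"
    and G_ghost: "G x y \<noteq> 0 \<Longrightarrow> ghost x + ghost y = 0"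
    and G_sym: "G y x = (if odd (ghost x) \<and> odd (ghost y) then -1 else 1) * G x y"
begin

lemma G_parity: "G x y \<noteq> 0 \<Longrightarrow> odd (ghost x) = odd (ghost y)"
  using G_ghost[of x y] by presburger

section \<open>The Laplacian and the operators that commute with it\<close>

definition lap :: "superseries \<Rightarrow> superseries" where
  "lap f = (\<Sum>p\<in>\<Phi> \<times> \<Phi>. (G (fst p) (snd p) / 2) *\<^sub>R pd (snd p) (pd (fst p) f))"

lemma lap_alt: "lap f = (\<Sum>x\<in>\<Phi>. \<Sum>y\<in>\<Phi>. (G x y / 2) *\<^sub>R pd y (pd x f))"
  by (simp add: lap_def sum.cartesian_product')

lemma linear_lap: "linear lap"
  by (rule linearI)
    (auto simp: lap_def pd_simps scaleR_add_right sum.distrib scaleR_sum_right mult_ac)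

lemmas lap_simps = linear_0[OF linear_lap] linear_add[OF linear_lap] linear_diff[OF linear_lap]
  linear_scale[OF linear_lap] linear_sum[OF linear_lap]

text \<open>Functions of the base are constants for \<open>lap\<close>: the two derivatives have
  equal parity wherever \<open>G\<close> is nonzero, so their signs on \<open>b\<close>
  cancel.\<close>

lemma lap_base:
  assumes "\<And>y. y \<in> \<Phi> \<Longrightarrow> pd y b = 0"
  shows "lap (b * f) = b * lap f"
  unfolding lap_def sum_distrib_left
proof (rule sum.cong[OF refl], clarify, simp only: fst_conv snd_conv)
  fix x y assume xy: "x \<in> \<Phi>" "y \<in> \<Phi>"
  show "(G x y / 2) *\<^sub>R pd y (pd x (b * f)) = b * (G x y / 2) *\<^sub>R pd y (pd x f)"
  proof (cases "G x y = 0")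
    case False
    then show ?thesis
      using G_parity[OF False] assms[OF xy(1)] pd_twist_eq_0[OF assms[OF xy(2)]]
      by (simp add: pd_times)
  qed simp
qed

lemma lap_funpow_base:
  assumes "\<And>y. y \<in> \<Phi> \<Longrightarrow> pd y b = 0"
  shows "(lap ^^ m) (b * f) = b * (lap ^^ m) f"
  by (induction m) (auto simp: lap_base[OF assms])

lemma lap_funpow_scale: "(lap ^^ m) (c *\<^sub>R f) = c *\<^sub>R (lap ^^ m) f"
  by (induction m) (auto simp: lap_simps)

lemma lap_funpow_diff: "(lap ^^ m) (f - g) = (lap ^^ m) f - (lap ^^ m) g"
  by (induction m) (auto simp: lap_simps)

lemma lap_funpow_zero: "(lap ^^ m) 0 = 0"
  by (induction m) (auto simp: lap_simps)

lemma lap_funpow_sum: "(lap ^^ m) (\<Sum>i\<in>S. h i) = (\<Sum>i\<in>S. (lap ^^ m) (h i))"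
  by (induction m) (auto simp: lap_simps)

lemma lap_even: "even_series f \<Longrightarrow> even_series (lap f)"
  unfolding lap_def
proof (intro of_parity_sum, clarify, simp only: fst_conv snd_conv)
  fix x y assume "even_series f"
  then have "of_parity ((False \<noteq> odd (ghost x)) \<noteq> odd (ghost y)) (pd y (pd x f))"
    by (intro of_parity_pd)
  then show "even_series ((G x y / 2) *\<^sub>R pd y (pd x f))"
    using G_parity[of x y] by (cases "G x y = 0") auto
qed

lemma lap_funpow_even: "even_series f \<Longrightarrow> even_series ((lap ^^ m) f)"
  by (induction m) (auto intro: lap_even)

lemma lap_pd: "lap (pd z f) = pd z (lap f)"
  unfolding lap_def pd_simps
proof (rule sum.cong[OF refl], clarify, simp only: fst_conv snd_conv)
  fix x y
  have "pd z (pd y (pd x f)) = pd y (pd x (pd z f))" if "G x y \<noteq> 0"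
    using G_parity[OF that] pd_commute[of z y "pd x f"] pd_commute[of z x f]
    by (auto simp: pd_simps)
  then show "(G x y / 2) *\<^sub>R pd y (pd x (pd z f)) = (G x y / 2) *\<^sub>R pd z (pd y (pd x f))"
    by (cases "G x y = 0") auto
qed

text \<open>Every contraction removes two coordinates of total weight \<open>c\<close>, which is 2
  for the degree and 0 for the ghost number.\<close>

lemma wt_lap:
  assumes "\<And>x y. G x y \<noteq> 0 \<Longrightarrow> w x + w y = c"
  shows "wt w (lap f) = lap (wt w f) - c *\<^sub>R lap f"
  unfolding lap_def linear_sum[OF linear_wt] linear_scale[OF linear_wt]
    scaleR_sum_right sum_subtractf[symmetric]
proof (rule sum.cong[OF refl], clarify, simp only: fst_conv snd_conv)
  fix x y
  show "(G x y / 2) *\<^sub>R wt w (pd y (pd x f)) =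
    (G x y / 2) *\<^sub>R pd y (pd x (wt w f)) - c *\<^sub>R (G x y / 2) *\<^sub>R pd y (pd x f)"
  proof (cases "G x y = 0")
    case False
    have "wt w (pd y (pd x f)) = pd y (pd x (wt w f)) - c *\<^sub>R pd y (pd x f)"
      unfolding assms[OF False, symmetric] by (simp add: wt_pd pd_simps algebra_simps)
    then show ?thesis by (simp add: scaleR_diff_right mult_ac)
  qed simp
qed

text \<open>The commutator is a second-order operator whose coefficients are half the sums in
  \<open>inv\<close>, which thus says that \<open>G\<close> is invariant. By \<open>inv'\<close> the
  image of a coordinate outside \<open>\<Phi>\<close> contains none from \<open>\<Phi>\<close>,
  which keeps the correction terms inside \<open>\<Phi>\<close>.\<close>

lemma lap_linear_field:
  assumes S: "finite S" "\<Phi> \<subseteq> S" "even_field S X"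
    and inv: "\<And>x w. x \<in> \<Phi> \<Longrightarrow> w \<in> S \<Longrightarrow> (\<Sum>y\<in>\<Phi>. G x y * X w y) + (\<Sum>y\<in>\<Phi>. G y w * X x y) = 0"
    and inv': "\<And>x w. x \<in> S - \<Phi> \<Longrightarrow> w \<in> \<Phi> \<Longrightarrow> X x w = 0"
  shows "lap (linear_field S X f) = linear_field S X (lap f)"
proof -
  let ?D = "linear_field S X"
  have fX: "(\<Sum>w\<in>S. X w x *\<^sub>R h w) = (\<Sum>w\<in>\<Phi>. X w x *\<^sub>R h w)" if "x \<in> \<Phi>" for x and h :: "coord \<Rightarrow> superseries"
    by (rule sum.mono_neutral_right) (use S that inv' in auto)
  have pp: "pd y (pd x (?D f)) = ?D (pd y (pd x f)) + (\<Sum>w\<in>\<Phi>. X w y *\<^sub>R pd w (pd x f))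
      + (\<Sum>w\<in>\<Phi>. X w x *\<^sub>R pd y (pd w f))" if "x \<in> \<Phi>" "y \<in> \<Phi>" for x y
    using that S
    by (simp add: pd_linear_field[OF S(3,1)] subset_iff pd_simps fX add.assoc)
  have "lap (?D f) = ?D (lap f)
      + (\<Sum>x\<in>\<Phi>. \<Sum>y\<in>\<Phi>. (G x y / 2) *\<^sub>R (\<Sum>w\<in>\<Phi>. X w y *\<^sub>R pd w (pd x f)))
      + (\<Sum>x\<in>\<Phi>. \<Sum>y\<in>\<Phi>. (G x y / 2) *\<^sub>R (\<Sum>w\<in>\<Phi>. X w x *\<^sub>R pd y (pd w f)))"
    unfolding lap_alt linear_sum[OF linear_linear_field] linear_scale[OF linear_linear_field]
      sum.distrib[symmetric] scaleR_add_right[symmetric]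
    by (intro sum.cong refl) (simp add: pp)
  also have "(\<Sum>x\<in>\<Phi>. \<Sum>y\<in>\<Phi>. (G x y / 2) *\<^sub>R (\<Sum>w\<in>\<Phi>. X w y *\<^sub>R pd w (pd x f))) =
      (\<Sum>x\<in>\<Phi>. \<Sum>w\<in>\<Phi>. ((\<Sum>y\<in>\<Phi>. G x y * X w y) / 2) *\<^sub>R pd w (pd x f))"
    unfolding scaleR_sum_right sum_divide_distrib scaleR_sum_left
    by (rule sum.cong[OF refl], subst sum.swap) (simp add: mult_ac)
  also have "(\<Sum>x\<in>\<Phi>. \<Sum>y\<in>\<Phi>. (G x y / 2) *\<^sub>R (\<Sum>w\<in>\<Phi>. X w x *\<^sub>R pd y (pd w f))) =
      (\<Sum>y\<in>\<Phi>. \<Sum>w\<in>\<Phi>. ((\<Sum>x\<in>\<Phi>. G x y * X w x) / 2) *\<^sub>R pd y (pd w f))"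
    unfolding scaleR_sum_right sum_divide_distrib scaleR_sum_left
    by (subst sum.swap, rule sum.cong[OF refl], subst sum.swap) (simp add: mult_ac)
  also have "\<dots> = (\<Sum>x\<in>\<Phi>. \<Sum>w\<in>\<Phi>. ((\<Sum>y\<in>\<Phi>. G y w * X x y) / 2) *\<^sub>R pd w (pd x f))"
    by (rule sum.swap)
  finally have "lap (?D f) = ?D (lap f) + (\<Sum>x\<in>\<Phi>. \<Sum>w\<in>\<Phi>.
      (((\<Sum>y\<in>\<Phi>. G x y * X w y) + (\<Sum>y\<in>\<Phi>. G y w * X x y)) / 2) *\<^sub>R pd w (pd x f))"
    by (simp add: sum.distrib[symmetric] scaleR_add_left[symmetric] add_divide_distrib[symmetric])
  then show ?thesis using inv S(2) by (simp add: subset_iff)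
qed

subsection \<open>Wick's theorem\<close>

definition contract :: "coord \<Rightarrow> superseries \<Rightarrow> superseries" where
  "contract x f = (\<Sum>y\<in>\<Phi>. G x y *\<^sub>R pd y f)"

lemma twist_var:
  "twist (odd (ghost y)) (var x) = (if odd (ghost y) \<and> odd (ghost x) then -1 else 1) *\<^sub>R var x"
  by (rule superseries_eqI) (auto simp: coeff_twist coeff_var)

text \<open>Either of the two derivatives may hit \<open>var x\<close>; the two contributions agree
  by \<open>G_sym\<close> and use up the factor 1/2.\<close>

lemma lap_var_times: "lap (var x * f) = var x * lap f + contract x f"
proof -
  have *: "(G x' y / 2) *\<^sub>R pd y (pd x' (var x * f)) = var x * (G x' y / 2) *\<^sub>R pd y (pd x' f)
      + (if x' = x then (G x y / 2) *\<^sub>R pd y f else 0)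
      + (if y = x then (G x x' / 2) *\<^sub>R pd x' f else 0)" for x' y
  proof (cases "G x' y = 0")
    case True
    then show ?thesis using G_sym[of x x'] by auto
  next
    case False
    let ?s = "(if odd (ghost x') \<and> odd (ghost x) then -1 else 1) :: real"
    have "pd y (pd x' (var x * f)) = (if x' = x then pd y f else 0) + ?s *\<^sub>R (if y = x then pd x' f else 0)
        + var x * pd y (pd x' f)"
      using G_parity[OF False] by (simp add: pd_times pd_var twist_var pd_simps)
    then show ?thesis using G_sym[of x x'] by (auto simp: scaleR_add_right)
  qed
  have d: "(\<Sum>z\<in>\<Phi>. (if z = x then h z else 0)) = (if x \<in> \<Phi> then h x else 0)" for h :: "coord \<Rightarrow> superseries"
    using finite_\<Phi> by simp
  have half: "(\<Sum>y\<in>\<Phi>. (G x y / 2) *\<^sub>R pd y f) + (\<Sum>y\<in>\<Phi>. (G x y / 2) *\<^sub>R pd y f) = contract x f"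
    by (simp add: contract_def flip: sum.distrib scaleR_add_left)
  have z: "contract x f = 0" if "x \<notin> \<Phi>"
  proof -
    have "G x y = 0" for y using that G_support[of x y] by blast
    then show ?thesis by (simp add: contract_def)
  qed
  have "lap (var x * f) = var x * lap f
      + (\<Sum>x'\<in>\<Phi>. \<Sum>y\<in>\<Phi>. if x' = x then (G x y / 2) *\<^sub>R pd y f else 0)
      + (\<Sum>x'\<in>\<Phi>. \<Sum>y\<in>\<Phi>. if y = x then (G x x' / 2) *\<^sub>R pd x' f else 0)"
    unfolding lap_alt * sum.distrib sum_distrib_left by simp
  also have "(\<Sum>x'\<in>\<Phi>. \<Sum>y\<in>\<Phi>. if x' = x then (G x y / 2) *\<^sub>R pd y f else 0) =
      (if x \<in> \<Phi> then \<Sum>y\<in>\<Phi>. (G x y / 2) *\<^sub>R pd y f else 0)"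
    by (subst sum.swap) (simp add: d)
  also have "(\<Sum>x'\<in>\<Phi>. \<Sum>y\<in>\<Phi>. if y = x then (G x x' / 2) *\<^sub>R pd x' f else 0) =
      (if x \<in> \<Phi> then \<Sum>y\<in>\<Phi>. (G x y / 2) *\<^sub>R pd y f else 0)"
    by (simp add: d)
  finally show ?thesis using half z by (auto simp: add.assoc)
qed

lemma lap_contract: "(lap ^^ m) (contract x f) = contract x ((lap ^^ m) f)"
proof (induction m)
  case (Suc m)
  then show ?case by (simp add: contract_def lap_simps lap_pd)
qed simp

text \<open>\<open>contract x\<close> commutes with \<open>lap\<close>, so the commutator with the
  power consists of \<open>m\<close> equal terms.\<close>

lemma lap_funpow_var_times:
  "(lap ^^ m) (var x * f) = var x * (lap ^^ m) f + real m *\<^sub>R (lap ^^ (m - 1)) (contract x f)"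
proof (induction m)
  case (Suc m)
  \<comment> \<open>At \<open>m = 0\<close> the exponent \<open>m - 1\<close> is truncated, but the
    factor \<open>real m\<close> is then zero.\<close>
  have "real m *\<^sub>R lap ((lap ^^ (m - 1)) (contract x f)) = real m *\<^sub>R (lap ^^ m) (contract x f)"
    by (cases m) auto
  then have "(lap ^^ Suc m) (var x * f) = var x * (lap ^^ Suc m) f + (lap ^^ m) (contract x f)
      + real m *\<^sub>R (lap ^^ m) (contract x f)"
    by (simp add: Suc lap_simps lap_var_times lap_contract)
  then show ?case by (simp add: scaleR_add_left add.assoc)
qed simp

lemma pd_prod_list:
  "pd y (prod_list (map var xs)) = (\<Sum>i<length xs. (if xs ! i = y
     then (if odd (ghost y) \<and> odd (\<Sum>z\<leftarrow>take i xs. ghost z) then -1 else 1) else 0)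
       *\<^sub>R prod_list (map var (take i xs @ drop (Suc i) xs)))"
proof (induction xs)
  case (Cons x xs)
  let ?T = "\<lambda>zs i. (if zs ! i = y
     then (if odd (ghost y) \<and> odd (\<Sum>z\<leftarrow>take i zs. ghost z) then -1 else 1) else 0)
       *\<^sub>R prod_list (map var (take i zs @ drop (Suc i) zs))"
  let ?s = "(if odd (ghost y) \<and> odd (ghost x) then -1 else 1) :: real"
  have "?s *\<^sub>R (var x * pd y (prod_list (map var xs))) = (\<Sum>i<length xs. ?T (x # xs) (Suc i))"
    unfolding Cons sum_distrib_left scaleR_sum_right by (rule sum.cong[OF refl]) auto
  moreover have "pd y (prod_list (map var (x # xs))) =
      ?T (x # xs) 0 + ?s *\<^sub>R (var x * pd y (prod_list (map var xs)))"
    by (auto simp: pd_times pd_var twist_var)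
  moreover have "(\<Sum>i<length (x # xs). ?T (x # xs) i) =
      ?T (x # xs) 0 + (\<Sum>i<length xs. ?T (x # xs) (Suc i))"
    unfolding length_Cons by (rule sum.lessThan_Suc_shift)
  ultimately show ?case by (simp only:)
qed simp

lemma contract_prod_list:
  "contract x (prod_list (map var xs)) = (\<Sum>i<length xs.
     ((if odd (ghost (xs ! i)) \<and> odd (\<Sum>y\<leftarrow>take i xs. ghost y) then -1 else 1) * G x (xs ! i))
       *\<^sub>R prod_list (map var (take i xs @ drop (Suc i) xs)))"
proof -
  let ?P = "\<lambda>i. prod_list (map var (take i xs @ drop (Suc i) xs))"
  let ?s = "\<lambda>i y. (if odd (ghost y) \<and> odd (\<Sum>z\<leftarrow>take i xs. ghost z) then -1 else 1) :: real"
  have "contract x (prod_list (map var xs)) =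
      (\<Sum>i<length xs. \<Sum>y\<in>\<Phi>. if xs ! i = y then (?s i (xs ! i) * G x (xs ! i)) *\<^sub>R ?P i else 0)"
    unfolding contract_def pd_prod_list scaleR_sum_right
    by (subst sum.swap) (intro sum.cong refl, auto)
  also have "\<dots> = (\<Sum>i<length xs. (?s i (xs ! i) * G x (xs ! i)) *\<^sub>R ?P i)"
  proof (rule sum.cong[OF refl])
    fix i
    show "(\<Sum>y\<in>\<Phi>. if xs ! i = y then (?s i (xs ! i) * G x (xs ! i)) *\<^sub>R ?P i else 0) =
      (?s i (xs ! i) * G x (xs ! i)) *\<^sub>R ?P i"
      using G_support[of x "xs ! i"] finite_\<Phi> by (cases "G x (xs ! i) = 0") auto
  qed
  finally show ?thesis .
qed

lemma coeff_var_times_empty: "coeff (var x * f) {#} = 0"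
  by (auto simp: coeff_times splittings_def coeff_var)

text \<open>A multiple of \<open>var x\<close> has no constant term, so only the commutator
  survives. It contracts the first coordinate with each later one exactly as \<open>wick\<close>
  does, and its factors accumulate to \<open>fact j\<close>.\<close>

lemma wick_lap:
  "length xs = 2 * j \<Longrightarrow> coeff ((lap ^^ j) (prod_list (map var xs))) {#} = fact j * wick G xs"
proof (induction j arbitrary: xs)
  case 0
  then show ?case by (simp add: coeff_one)
next
  case (Suc j)
  then obtain x ys where xs: "xs = x # ys" by (cases xs) auto
  have len: "length (take i ys @ drop (Suc i) ys) = 2 * j" if "i < length ys" for i
    using Suc.prems xs that by simp
  have "coeff ((lap ^^ Suc j) (prod_list (map var xs))) {#} =
      real (Suc j) * coeff ((lap ^^ j) (contract x (prod_list (map var ys)))) {#}"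
    unfolding xs list.map prod_list.Cons lap_funpow_var_times by (simp add: coeff_var_times_empty)
  also have "\<dots> = real (Suc j) * (\<Sum>i<length ys.
      ((if odd (ghost (ys ! i)) \<and> odd (\<Sum>y\<leftarrow>take i ys. ghost y) then -1 else 1) * G x (ys ! i))
       * coeff ((lap ^^ j) (prod_list (map var (take i ys @ drop (Suc i) ys)))) {#})"
    unfolding contract_prod_list lap_funpow_sum lap_funpow_scale coeff_sum coeff_scaleR ..
  also have "\<dots> = fact (Suc j) * wick G xs"
    unfolding xs wick.simps sum_distrib_left
    using Suc.IH[OF len] by (intro sum.cong refl) (simp add: mult_ac)
  finally show ?case .
qed

end

lemma prod_list_sorted:
  "sorted xs \<Longrightarrow> prod_list (map var xs) = mon (mset xs)"
proof (induction xs)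
  case (Cons x xs)
  have "inversions {#x#} (mset xs) = 0"
    using Cons.prems by (force simp: inversions_def intro!: sum_mset.neutral)
  then have "\<epsilon> {#x#} (mset xs) *\<^sub>R mon ({#x#} + mset xs) = mon ({#x#} + mset xs)"
    by (auto simp: mono_sign_def intro!: superseries_eqI simp: coeff_mon)
  then show ?case using Cons by (simp add: var_eq_mon mon_times)
qed simp

lemma pd_mon: "x \<notin># M \<Longrightarrow> pd x (mon M) = 0"
  by (rule superseries_eqI) (auto simp: coeff_pd coeff_mon)

context gaussian
begin

text \<open>Each \<open>lap\<close> removes two coordinates of \<open>\<Phi>\<close>. This locality
  permits replacing a power series by finitely many of its monomials.\<close>

lemma coeff_lap_local:
  assumes "\<And>N. N \<in> multisets_of_size \<Phi> (2 * j) \<Longrightarrow> coeff f (M + N) = 0"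
  shows "coeff ((lap ^^ j) f) M = 0"
  using assms
proof (induction j arbitrary: f)
  case (Suc j)
  have "coeff ((lap ^^ j) (lap f)) M = 0"
  proof (rule Suc.IH)
    fix N assume N: "N \<in> multisets_of_size \<Phi> (2 * j)"
    have "coeff (pd y (pd x f)) (M + N) = 0" if "x \<in> \<Phi>" "y \<in> \<Phi>" for x y
    proof -
      have "add_mset x (add_mset y N) \<in> multisets_of_size \<Phi> (2 * Suc j)"
        using N that by (auto simp: multisets_of_size_def)
      from Suc.prems[OF this] show ?thesis by (simp add: coeff_pd)
    qed
    then show "coeff (lap f) (M + N) = 0" by (simp add: lap_alt)
  qed
  then show ?case by (simp add: funpow_swap1)
qed (simp add: multisets_of_size_def)

lemma coeff_lap_mon:
  assumes "set_mset M \<inter> \<Phi> = {}" "size N = 2 * j"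
  shows "coeff ((lap ^^ j) (mon (M + N))) M = \<epsilon> M N * fact j * wick G (sorted_list_of_multiset N)"
proof (cases "nonvanishing (M + N)")
  case True
  then have M: "nonvanishing M" using nonvanishing_mono by blast
  have "mon (M + N) = \<epsilon> M N *\<^sub>R (mon M * mon N)"
    using mono_sign_square[OF True] by (simp add: mon_times)
  moreover have "pd y (mon M) = 0" if "y \<in> \<Phi>" for y
    using that assms(1) by (intro pd_mon) auto
  ultimately have "coeff ((lap ^^ j) (mon (M + N))) M = \<epsilon> M N * coeff (mon M * (lap ^^ j) (mon N)) (M + {#})"
    by (simp add: lap_funpow_scale lap_funpow_base)
  also have "\<dots> = \<epsilon> M N * coeff ((lap ^^ j) (mon N)) {#}"
    unfolding coeff_mon_times[OF M] using M by simp
  also have "mon N = prod_list (map var (sorted_list_of_multiset N))"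
    by (simp add: prod_list_sorted)
  also have "coeff ((lap ^^ j) \<dots>) {#} = fact j * wick G (sorted_list_of_multiset N)"
    using assms(2) by (intro wick_lap) (metis mset_sorted_list_of_multiset size_mset)
  finally show ?thesis by simp
next
  case False
  then have "mon (M + N) = 0" by (intro superseries_eqI) (simp add: coeff_mon)
  with False show ?thesis by (simp add: lap_funpow_zero mono_sign_def)
qed

lemma coeff_lap_eq_wick:
  assumes "set_mset M \<inter> \<Phi> = {}"
  shows "coeff ((lap ^^ j) f) M = fact j * (\<Sum>N\<in>multisets_of_size \<Phi> (2 * j).
    \<epsilon> M N * coeff f (M + N) * wick G (sorted_list_of_multiset N))"
proof -
  let ?S = "multisets_of_size \<Phi> (2 * j)"
  \<comment> \<open>Linearity of \<open>lap\<close> reaches finite sums only, so \<open>f\<close> is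
    cut down to the monomials that can contribute at \<open>M\<close>.\<close>
  define f' where "f' = (\<Sum>N\<in>?S. coeff f (M + N) *\<^sub>R mon (M + N))"
  have fin: "finite ?S" using finite_\<Phi> by (rule finite_multisets_of_size)
  have "coeff ((lap ^^ j) (f - f')) M = 0"
  proof (rule coeff_lap_local)
    fix N assume N: "N \<in> ?S"
    have "coeff f' (M + N) = (\<Sum>N'\<in>{N}. coeff f (M + N') * coeff (mon (M + N')) (M + N))"
      unfolding f'_def coeff_sum coeff_scaleR
      by (rule sum.mono_neutral_right[OF fin]) (use N in \<open>auto simp: coeff_mon\<close>)
    then show "coeff (f - f') (M + N) = 0"
      using coeff_vanishing[of "M + N" f] by (simp add: coeff_mon)
  qed
  then have "coeff ((lap ^^ j) f) M = coeff ((lap ^^ j) f') M"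
    by (simp add: lap_funpow_diff)
  also have "\<dots> = (\<Sum>N\<in>?S. coeff f (M + N) * (\<epsilon> M N * fact j * wick G (sorted_list_of_multiset N)))"
    unfolding f'_def lap_funpow_sum lap_funpow_scale coeff_sum coeff_scaleR
    by (intro sum.cong refl arg_cong2[where f = "(*)"] coeff_lap_mon assms)
      (simp add: multisets_of_size_def)
  finally show ?thesis by (simp add: sum_distrib_left mult_ac)
qed

lemma coeff_integral:
  assumes "propagator \<Phi> q = G"
  shows "coeff (integral_coeff \<Phi> q f j) M =
    (if set_mset M \<inter> \<Phi> = {} then coeff ((lap ^^ j) f) M / fact j else 0)"
  using coeff_vanishing[of M "(lap ^^ j) f"]
  by (auto simp: integral_coeff.rep_eq assms coeff_lap_eq_wick)

end

subsection \<open>The connected part of a cubic interaction\<close>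

locale cubic_interaction = gaussian +
  fixes I :: superseries
  assumes even_I: "even_series I" and cubic_I: "euler I = 3 *\<^sub>R I"
begin

lemma euler_lap_power: "euler ((lap ^^ m) (I ^ n)) = (3 * real n - 2 * real m) *\<^sub>R (lap ^^ m) (I ^ n)"
proof -
  have 0: "euler (I ^ n) = (3 * real n) *\<^sub>R I ^ n"
  proof (induction n)
    case 0
    show ?case by (rule superseries_eqI) (simp add: coeff_wt coeff_one)
  next
    case (Suc n)
    then show ?case by (simp add: wt_times cubic_I algebra_simps flip: scaleR_add_left)
  qed
  show ?thesis
  proof (induction m)
    case (Suc m)
    have "euler (lap ((lap ^^ m) (I ^ n))) = lap (euler ((lap ^^ m) (I ^ n))) - 2 *\<^sub>R lap ((lap ^^ m) (I ^ n))"
      by (rule wt_lap) simp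
    then show ?case unfolding Suc lap_simps by (simp add: algebra_simps)
  qed (simp add: 0)
qed

text \<open>Three legs per vertex, two of which are used up by each propagator.\<close>

lemma coeff_lap_power:
  "coeff ((lap ^^ m) (I ^ n)) M \<noteq> 0 \<Longrightarrow> size M + 2 * m = 3 * n"
proof -
  assume "coeff ((lap ^^ m) (I ^ n)) M \<noteq> 0"
  moreover have "real (size M) * coeff ((lap ^^ m) (I ^ n)) M = (3 * real n - 2 * real m) * coeff ((lap ^^ m) (I ^ n)) M"
    using euler_lap_power[of m n] by (metis coeff_euler coeff_scaleR)
  ultimately have "real (size M) = 3 * real n - 2 * real m" by simp
  then show ?thesis by linarith
qed

lemma lap_power_eq_0: "3 * n < 2 * m \<Longrightarrow> (lap ^^ m) (I ^ n) = 0"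
  using coeff_lap_power[of m n] by (intro superseries_eqI) force

text \<open>The terms with \<open>n\<close> vertices in the integral of \<open>exp (I / \<hbar>)\<close>, at \<open>\<hbar> = 1\<close>; the number \<open>m\<close>
  of propagators, and with it the power of \<open>\<hbar>\<close>, is determined by the degree.\<close>

definition Z :: "nat \<Rightarrow> superseries" where
  "Z n = (\<Sum>m\<le>2 * n. (1 / (fact m * fact n)) *\<^sub>R (lap ^^ m) (I ^ n))"

text \<open>For \<open>m > 2 * n\<close> there are too few legs for \<open>m\<close> propagators.
  The free upper bound lets sums with different \<open>n\<close> be compared term by term.\<close>

lemma Z_upto: "2 * n \<le> b \<Longrightarrow> Z n = (\<Sum>m\<le>b. (1 / (fact m * fact n)) *\<^sub>R (lap ^^ m) (I ^ n))"
  unfolding Z_def by (rule sum.mono_neutral_left) (auto simp: lap_power_eq_0)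

lemma Z_0: "Z 0 = 1"
  by (simp add: Z_def)

lemma even_Z: "even_series (Z n)"
  unfolding Z_def by (intro of_parity_sum of_parity_simps lap_funpow_even even_series_power even_I)

lemma coeff_Z:
  assumes "size M + 2 * m = 3 * n"
  shows "coeff (Z n) M = coeff ((lap ^^ m) (I ^ n)) M / (fact m * fact n)"
proof -
  have "coeff (Z n) M = (\<Sum>i\<in>{m}. coeff ((lap ^^ i) (I ^ n)) M / (fact i * fact n))"
    unfolding Z_def coeff_sum coeff_scaleR
    by (rule sum.mono_neutral_cong_right) (use assms coeff_lap_power in \<open>force+\<close>)
  then show ?thesis by simp
qed

lemma coeff_Z_nonzero: "coeff (Z n) M \<noteq> 0 \<Longrightarrow> \<exists>m. size M + 2 * m = 3 * n"
  unfolding Z_def coeff_sum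
  by (drule sum.not_neutral_contains_not_neutral) (auto dest: coeff_lap_power)

text \<open>On the terms with \<open>m\<close> propagators the left side multiplies by
  \<open>2 m\<close>, and \<open>m / fact m\<close> turns the exponential series of
  \<open>lap\<close> into itself with one more \<open>lap\<close> in front: a heat equation with the
  degree in place of time.\<close>

lemma euler_Z: "(3 * real n) *\<^sub>R Z n - euler (Z n) = 2 *\<^sub>R lap (Z n)"
proof -
  define t where "t m = (1 / (fact m * fact n)) *\<^sub>R (lap ^^ m) (I ^ n)" for m
  have Z: "Z n = (\<Sum>m\<le>b. t m)" if "2 * n \<le> b" for b
    unfolding t_def by (rule Z_upto[OF that])
  \<comment> \<open>One extra, vanishing term makes room for the index shift below.\<close>
  have Z': "Z n = (\<Sum>m\<le>Suc (2 * n). t m)" by (rule Z) simp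
  have e: "euler (t m) = (3 * real n - 2 * real m) *\<^sub>R t m" for m
    by (simp add: t_def linear_scale[OF linear_wt] euler_lap_power mult.commute)
  have "(3 * real n) *\<^sub>R Z n - euler (Z n) = (\<Sum>m\<le>Suc (2 * n). (2 * real m) *\<^sub>R t m)"
    unfolding Z' linear_sum[OF linear_wt] scaleR_sum_right sum_subtractf[symmetric]
    by (rule sum.cong[OF refl]) (simp only: e scaleR_diff_left[symmetric], simp)
  also have "\<dots> = (\<Sum>m\<le>2 * n. (2 * real (Suc m)) *\<^sub>R t (Suc m))"
    by (subst sum.atMost_Suc_shift) simp
  also have "\<dots> = (\<Sum>m\<le>2 * n. 2 *\<^sub>R lap (t m))"
  proof (rule sum.cong[OF refl])
    fix m
    have "(2 * real (Suc m)) * (1 / (fact (Suc m) * fact n)) = 2 * (1 / (fact m * fact n))"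
      by (simp add: field_simps add_nonneg_eq_0_iff)
    then show "(2 * real (Suc m)) *\<^sub>R t (Suc m) = 2 *\<^sub>R lap (t m)"
      unfolding t_def lap_simps by (simp only: scaleR_scaleR funpow.simps o_apply)
  qed
  also have "\<dots> = 2 *\<^sub>R lap (Z n)"
    unfolding Z[OF le_refl] lap_simps scaleR_sum_right ..
  finally show ?thesis .
qed

definition V :: "superseries fps" where
  "V = Abs_fps (log_coeff Z)"

lemma V_0 [simp]: "fps_nth V 0 = 0"
  by (simp add: V_def)

lemma even_V: "even_fps V"
  by (simp add: V_def even_fps_def log_coeff_even even_Z)

lemma fexp_V: "fexp V = Abs_fps Z"
  by (simp add: fps_eq_iff V_def fexp_log Z_0 even_Z)

text \<open>\<open>D\<close> passes through \<open>lap\<close>, differentiates one of the vertices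
  into \<open>b\<close>, and \<open>b\<close> is constant for \<open>lap\<close>; so
  \<open>D Z\<close> is \<open>b Z\<close> shifted by one vertex. But \<open>D Z\<close> is also
  \<open>D V\<close> times \<open>Z\<close>, and \<open>Z\<close> can be cancelled.\<close>

lemma derivation_V:
  assumes D: "linear D" "\<And>a b. even_series a \<Longrightarrow> D (a * b) = D a * b + a * D b"
    and "\<And>f. lap (D f) = D (lap f)" "D I = b" "\<And>y. y \<in> \<Phi> \<Longrightarrow> pd y b = 0"
  shows "D (fps_nth V n) = (if n = 1 then b else 0)"
proof -
  have lapD: "D ((lap ^^ m) f) = (lap ^^ m) (D f)" for m f
    by (induction m) (auto simp: assms(3)[symmetric])
  have D1: "D 1 = 0" using D(2)[of 1 1] by simp
  have DI: "D (I ^ Suc n) = (1 + real n) *\<^sub>R (b * I ^ n)" for n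
  proof (induction n)
    case 0
    then show ?case using assms(4) by simp
  next
    case (Suc n)
    have "D (I ^ Suc (Suc n)) = b * I ^ Suc n + (1 + real n) *\<^sub>R (I * b * I ^ n)"
      using D(2)[OF even_I, of "I ^ Suc n"] Suc assms(4) by (simp add: mult.assoc)
    also have "I * b = b * I" by (rule even_series_commute[OF even_I])
    also have "b * I ^ Suc n + (1 + real n) *\<^sub>R (b * I * I ^ n) = (1 + real (Suc n)) *\<^sub>R (b * I ^ Suc n)"
      by (simp add: mult.assoc scaleR_add_left scaleR_2)
    finally show ?case .
  qed
  have DZ: "D (Z (Suc n)) = b * Z n" for n
  proof -
    have Z': "Z n = (\<Sum>m\<le>2 * Suc n. (1 / (fact m * fact n)) *\<^sub>R (lap ^^ m) (I ^ n))"
      by (rule Z_upto) simp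
    have "D (Z (Suc n)) = (\<Sum>m\<le>2 * Suc n. (1 / (fact m * fact (Suc n))) *\<^sub>R (1 + real n) *\<^sub>R (b * (lap ^^ m) (I ^ n)))"
      unfolding Z_def linear_sum[OF D(1)] linear_scale[OF D(1)] lapD DI
      by (simp add: lap_funpow_scale lap_funpow_base[OF assms(5)])
    also have "\<dots> = b * Z n"
      unfolding Z' sum_distrib_left
    proof (rule sum.cong[OF refl])
      fix m
      have "1 / (fact m * fact (Suc n)) * (1 + real n) = 1 / (fact m * fact n)"
        by (simp add: field_simps add_nonneg_eq_0_iff)
      then show "(1 / (fact m * fact (Suc n))) *\<^sub>R (1 + real n) *\<^sub>R (b * (lap ^^ m) (I ^ n)) =
        b * ((1 / (fact m * fact n)) *\<^sub>R (lap ^^ m) (I ^ n))"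
        by (simp only: scaleR_scaleR mult_scaleR_right)
    qed
    finally show ?thesis .
  qed
  have "fmap D V * Abs_fps Z = Abs_fps (\<lambda>n. if n = 1 then b else 0) * Abs_fps Z"
  proof (rule fps_ext)
    fix n
    have "fps_nth (fmap D V * Abs_fps Z) n = D (Z n)"
      using fexp_derivation_const[OF D V_0 even_V] by (simp add: fexp_V fps_eq_iff)
    also have "\<dots> = fps_nth (Abs_fps (\<lambda>n. if n = 1 then b else 0) * Abs_fps Z) n"
    proof (cases n)
      case 0
      then show ?thesis by (simp add: Z_0 D1)
    next
      case (Suc k)
      have "(\<Sum>i=0..n. (if i = 1 then b else 0) * Z (n - i)) =
          (\<Sum>i\<in>{1}. (if i = 1 then b else 0) * Z (n - i))"
        by (rule sum.mono_neutral_right) (use Suc in auto)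
      then show ?thesis by (simp add: fps_mult_nth Suc DZ)
    qed
    finally show "fps_nth (fmap D V * Abs_fps Z) n =
        fps_nth (Abs_fps (\<lambda>n. if n = 1 then b else 0) * Abs_fps Z) n" .
  qed
  then have "fmap D V = Abs_fps (\<lambda>n. if n = 1 then b else 0)"
    by (rule fps_mult_right_cancel_unipotent) (simp add: Z_0)
  from arg_cong[OF this, of "\<lambda>f. fps_nth f n"] show ?thesis by simp
qed

section \<open>The flow equation of the connected part\<close>

lemma pd_pd_Z:
  "fmap (pd y) (fmap (pd x) (Abs_fps Z)) =
    (fmap (pd y) V * fmap (pd x) V + fmap (pd y) (fmap (pd x) V)) * Abs_fps Z"
proof -
  have Z: "even_fps (Abs_fps Z)" by (simp add: even_fps_def even_Z)
  have pdZ: "fmap (pd x) (Abs_fps Z) = Abs_fps Z * fmap (pd x) V" for x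
    using fexp_derivation_const[OF linear_pd pd_times_even V_0 even_V, of x]
    unfolding fexp_V by (simp only: even_fps_commute[OF Z, of "fmap (pd x) V"])
  have "fmap (pd y) (fmap (pd x) (Abs_fps Z)) =
      Abs_fps Z * (fmap (pd y) V * fmap (pd x) V + fmap (pd y) (fmap (pd x) V))"
    unfolding pdZ[of x] fmap_pd_times[OF Z] by (simp only: pdZ mult.assoc distrib_left)
  then show ?thesis by (simp only: even_fps_commute[OF Z])
qed

text \<open>The contribution in which a propagator joins two connected pieces; a propagator with
  both ends on one piece gives \<open>lap\<close> of \<open>V\<close> instead.\<close>

definition loop_term :: "nat \<Rightarrow> superseries" where
  "loop_term n = (\<Sum>p\<in>\<Phi> \<times> \<Phi>. (G (fst p) (snd p) / 2) *\<^sub>R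
     fps_nth (fmap (pd (snd p)) V * fmap (pd (fst p)) V) n)"

lemma lap_Z: "lap (Z n) = (\<Sum>i=0..n. (lap (fps_nth V i) + loop_term i) * Z (n - i))"
proof -
  let ?Q = "\<lambda>p. fmap (pd (snd p)) V * fmap (pd (fst p)) V + fmap (pd (snd p)) (fmap (pd (fst p)) V)"
  have e: "(\<Sum>p\<in>\<Phi> \<times> \<Phi>. (G (fst p) (snd p) / 2) *\<^sub>R fps_nth (?Q p) i) = lap (fps_nth V i) + loop_term i" for i
    by (simp add: lap_def loop_term_def scaleR_add_right sum.distrib)
  have "lap (Z n) = (\<Sum>p\<in>\<Phi> \<times> \<Phi>. (G (fst p) (snd p) / 2) *\<^sub>R fps_nth (?Q p * Abs_fps Z) n)"
    unfolding lap_def pd_pd_Z[symmetric] by simp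
  also have "\<dots> = (\<Sum>i=0..n. (\<Sum>p\<in>\<Phi> \<times> \<Phi>. (G (fst p) (snd p) / 2) *\<^sub>R fps_nth (?Q p) i) * Z (n - i))"
    unfolding fps_mult_nth[of _ "Abs_fps Z"] scaleR_sum_right sum_distrib_right
    by (subst sum.swap) simp
  finally show ?thesis unfolding e .
qed

text \<open>The Polchinski equation: it expresses the terms with \<open>n\<close> vertices and \<open>m\<close> propagators,
  hence of degree \<open>3 n - 2 m\<close>, by those with fewer propagators.\<close>

lemma flow_equation:
  "(3 * real n) *\<^sub>R fps_nth V n - euler (fps_nth V n) = 2 *\<^sub>R lap (fps_nth V n) + 2 *\<^sub>R loop_term n"
proof -
  \<comment> \<open>Twice the number of propagators, written through the order and the degree. It is
    additive on products, so \<open>fexp_derivation\<close> applies with an order-dependent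
    derivation.\<close>
  let ?d = "\<lambda>n f. (3 * real n) *\<^sub>R f - euler f"
  have "?d n (fps_nth (fexp V) n) = (\<Sum>i=0..n. ?d i (fps_nth V i) * fps_nth (fexp V) (n - i))" for n
    by (rule fexp_derivation[OF _ _ V_0 even_V])
      (auto intro!: linearI simp: linear_add[OF linear_wt] linear_scale[OF linear_wt] wt_times algebra_simps)
  then have "Abs_fps (\<lambda>n. ?d n (fps_nth V n)) * Abs_fps Z =
      Abs_fps (\<lambda>n. 2 *\<^sub>R (lap (fps_nth V n) + loop_term n)) * Abs_fps Z"
    by (simp add: fps_eq_iff fps_mult_nth fexp_V euler_Z lap_Z scaleR_sum_right)
  then have "Abs_fps (\<lambda>n. ?d n (fps_nth V n)) = Abs_fps (\<lambda>n. 2 *\<^sub>R (lap (fps_nth V n) + loop_term n))"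
    by (rule fps_mult_right_cancel_unipotent) (simp add: Z_0)
  from arg_cong[OF this, of "\<lambda>f. fps_nth f n"] show ?thesis by (simp add: scaleR_add_right)
qed

section \<open>Bounds on the number of external legs\<close>

lemma size_Z: "coeff (Z n) M \<noteq> 0 \<Longrightarrow> size M \<le> 3 * n"
  by (auto dest: coeff_Z_nonzero)

lemma size_V: "coeff (fps_nth V n) M \<noteq> 0 \<Longrightarrow> size M \<le> 3 * n"
proof (induction n arbitrary: M rule: less_induct)
  case (less n)
  show ?case
  proof (rule ccontr)
    assume big: "\<not> size M \<le> 3 * n"
    have "coeff (fps_nth V a * Z (n - a)) M = 0" if "a \<in> {1..<n}" for a
    proof (rule ccontr)
      assume "coeff (fps_nth V a * Z (n - a)) M \<noteq> 0"
      then obtain A B where "A + B = M" "coeff (fps_nth V a) A \<noteq> 0" "coeff (Z (n - a)) B \<noteq> 0"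
        by (rule coeff_times_nonzeroE)
      then have "size M \<le> 3 * a + 3 * (n - a)"
        using less.IH[of a A] size_Z[of "n - a" B] that by auto
      with big that show False by auto
    qed
    moreover have "coeff (Z n) M = 0" using big size_Z by blast
    ultimately have "coeff (fps_nth V n) M = 0"
      by (simp add: V_def log_coeff.simps[of Z n])
    with less.prems show False by simp
  qed
qed

lemma V_1: "fps_nth V 1 = Z 1"
  by (simp add: V_def) (simp add: log_coeff.simps[of Z "Suc 0"])

text \<open>Degree \<open>3 n\<close> means no propagator, where \<open>Z\<close> is
  \<open>exp I\<close> and its logarithm \<open>I\<close> has one vertex only. The flow equation
  carries the factor \<open>3 n - size M\<close> and says nothing about \<open>V\<close> in this
  degree, so a separate argument is needed.\<close>

lemma V_top:
  assumes "n \<ge> 2" "size M = 3 * n"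
  shows "coeff (fps_nth V n) M = 0"
  using assms
proof (induction n arbitrary: M rule: less_induct)
  case (less n)
  have mid: "coeff (fps_nth V a * Z (n - a)) M = 0" if "2 \<le> a" "a < n" for a
  proof (rule ccontr)
    assume "coeff (fps_nth V a * Z (n - a)) M \<noteq> 0"
    then obtain A B where AB: "A + B = M" "coeff (fps_nth V a) A \<noteq> 0" "coeff (Z (n - a)) B \<noteq> 0"
      by (rule coeff_times_nonzeroE)
    have "size A + size B = 3 * n" using AB(1) less.prems by auto
    then have "size A = 3 * a" using size_V[OF AB(2)] size_Z[OF AB(3)] that by linarith
    with less.IH[of a A] that AB(2) show False by simp
  qed
  have top: "coeff (Z k) A = coeff (I ^ k) A / fact k" if "size A = 3 * k" for k A
    using coeff_Z[of A 0 k] that by simp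
  have low: "coeff (I ^ k) A = 0" if "size A \<noteq> 3 * k" for k A
    using coeff_lap_power[of 0 k A] that by auto
  \<comment> \<open>Only splittings with both factors of top degree contribute, and there
    \<open>Z k\<close> agrees with \<open>I ^ k / fact k\<close>.\<close>
  have "coeff (Z 1 * Z (n - 1)) M = (\<Sum>(A, B)\<in>splittings M. \<epsilon> A B * coeff I A * coeff (I ^ (n - 1)) B / fact (n - 1))"
    unfolding coeff_times
  proof (rule sum.cong[OF refl], clarify)
    fix A B assume "(A, B) \<in> splittings M"
    then have sz: "size A + size B = 3 * n"
      using less.prems by (auto simp: splittings_def)
    then have "size A = 3 \<and> size B = 3 * (n - 1) \<or> size A > 3 \<or> size B > 3 * (n - 1)"
      using less.prems(1) by arith
    then consider "size A = 3" "size B = 3 * (n - 1)" | "size A > 3" | "size B > 3 * (n - 1)"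
      by blast
    then show "\<epsilon> A B * coeff (Z 1) A * coeff (Z (n - 1)) B =
      \<epsilon> A B * coeff I A * coeff (I ^ (n - 1)) B / fact (n - 1)"
    proof cases
      case 1
      then show ?thesis using top[of A 1] top[of B "n - 1"] by simp
    next
      case 2
      then show ?thesis using size_Z[of 1 A] low[of A 1] by (cases "coeff (Z 1) A = 0") auto
    next
      case 3
      then show ?thesis using size_Z[of "n - 1" B] low[of B "n - 1"]
        by (cases "coeff (Z (n - 1)) B = 0") auto
    qed
  qed
  also have "\<dots> = coeff (I * I ^ (n - 1)) M / fact (n - 1)"
    by (simp add: coeff_times sum_divide_distrib case_prod_beta)
  also have "I * I ^ (n - 1) = I ^ n" using less.prems by (simp flip: power_Suc)
  also have "coeff (I ^ n) M / fact (n - 1) = real n * coeff (Z n) M"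
    using less.prems top[of M n] by (simp add: fact_reduce[of n])
  finally have one: "coeff (Z 1 * Z (n - 1)) M = real n * coeff (Z n) M" .
  have "{0..n} = insert 0 (insert 1 (insert n {2..<n}))" using less.prems by auto
  then have "real n * coeff (Z n) M = coeff (fps_nth V 1 * Z (n - 1)) M + real n * coeff (fps_nth V n) M
      + (\<Sum>a\<in>{2..<n}. real a * coeff (fps_nth V a * Z (n - a)) M)"
    using arg_cong[OF log_coeff_recursion[of Z n, OF Z_0], of "\<lambda>f. coeff f M"] less.prems
    by (simp add: V_def Z_0)
  then show ?case using one mid less.prems unfolding V_1 by simp
qed

text \<open>Connected graphs with \<open>n\<close> vertices and \<open>m\<close> edges have \<open>m \<ge> n - 1\<close>, hence at most \<open>n + 2\<close>
  external legs.\<close>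

lemma linked_cluster:
  "coeff (fps_nth V n) M \<noteq> 0 \<Longrightarrow> size M \<le> n + 2 \<and> even (n + size M)"
proof (induction n arbitrary: M rule: less_induct)
  case (less n)
  \<comment> \<open>Two pieces with \<open>i\<close> and \<open>n - i\<close> vertices lose one leg
    each to the propagator, which leaves at most
    \<open>(i + 2 - 1) + (n - i + 2 - 1) = n + 2\<close> legs. Since \<open>V\<close> has no term
    without vertices, both pieces have fewer than \<open>n\<close>.\<close>
  have loop: "coeff (loop_term n) M = 0" if "\<not> (size M \<le> n + 2 \<and> even (n + size M))" for M
  proof -
    have "coeff (fps_nth (fmap (pd y) V * fmap (pd x) V) n) M = 0" for x y
    proof (rule ccontr)
      assume "coeff (fps_nth (fmap (pd y) V * fmap (pd x) V) n) M \<noteq> 0"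
      then have "\<exists>i\<in>{0..n}. coeff (pd y (fps_nth V i) * pd x (fps_nth V (n - i))) M \<noteq> 0"
        by (simp add: fps_mult_nth) (meson atLeastAtMost_iff le0 sum.not_neutral_contains_not_neutral)
      then obtain i where i: "i \<le> n" "coeff (pd y (fps_nth V i) * pd x (fps_nth V (n - i))) M \<noteq> 0"
        by auto
      from i(2) obtain A B where AB: "A + B = M" "coeff (pd y (fps_nth V i)) A \<noteq> 0"
          "coeff (pd x (fps_nth V (n - i))) B \<noteq> 0"
        by (rule coeff_times_nonzeroE)
      have nz: "i \<noteq> 0" "n - i \<noteq> 0" using AB(2,3) pd_simps(1) V_0 by (metis coeff_zero)+
      have a: "size (add_mset y A) \<le> i + 2 \<and> even (i + size (add_mset y A))"
        using nz coeff_pd_nonzero[OF AB(2)] by (intro less.IH) auto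
      have b: "size (add_mset x B) \<le> n - i + 2 \<and> even (n - i + size (add_mset x B))"
        using nz coeff_pd_nonzero[OF AB(3)] by (intro less.IH) auto
      have "size M = size A + size B" using AB(1) by auto
      with a b i(1) that show False by simp presburger
    qed
    then show ?thesis by (simp add: loop_term_def)
  qed
  show ?case
  proof (rule ccontr)
    assume bad: "\<not> (size M \<le> n + 2 \<and> even (n + size M))"
    \<comment> \<open>Descending induction on the degree: \<open>lap\<close> at \<open>M\<close>
      sees only monomials with two more legs, which violate the bound or the parity as well.\<close>
    have "coeff (fps_nth V n) M = 0" if "\<not> (size M \<le> n + 2 \<and> even (n + size M))" for M
      using that
    proof (induction "3 * n - size M" arbitrary: M rule: less_induct)
      case (less M)
      consider "size M > 3 * n" | "size M = 3 * n" | "size M < 3 * n" by linarith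
      then show ?case
      proof cases
        case 1
        then show ?thesis using size_V by fastforce
      next
        case 2
        then have "n \<ge> 2" using less.prems by (cases "n = 0"; cases "n = 1") auto
        then show ?thesis using 2 by (rule V_top)
      next
        case 3
        have "coeff (fps_nth V n) (add_mset x (add_mset y M)) = 0" for x y
          using less.hyps[of "add_mset x (add_mset y M)"] 3 less.prems by auto
        then have "coeff (lap (fps_nth V n)) M = 0" by (simp add: lap_alt coeff_pd)
        then have "(3 * real n - real (size M)) * coeff (fps_nth V n) M = 0"
          using arg_cong[OF flow_equation[of n], of "\<lambda>f. coeff f M"] loop[OF less.prems]
          by (simp add: coeff_euler algebra_simps)
        then show ?thesis using 3 by simp
      qed
    qed
    with bad less.prems show False by blast
  qed
qed

end

section \<open>The effective action as the logarithm of the fiber integral\<close>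

subsection \<open>From powers of \<open>\<hbar>\<close> to numbers of vertices\<close>

text \<open>With \<open>\<hbar>\<close> of weight 2 and every coordinate of weight 1, nothing is lost by setting \<open>\<hbar> = 1\<close>
  within a fixed weight.\<close>

lift_definition weight_part :: "superseries fps \<Rightarrow> nat \<Rightarrow> superseries" is
  "\<lambda>W w M. if size M \<le> w \<and> even (w - size M) then coeff (fps_nth W ((w - size M) div 2)) M else 0"
  by (auto simp: coeff_vanishing)

lemma coeff_weight_part: "coeff (weight_part W w) M =
    (if size M \<le> w \<and> even (w - size M) then coeff (fps_nth W ((w - size M) div 2)) M else 0)"
  by (simp add: weight_part.rep_eq)

definition regrade :: "superseries fps \<Rightarrow> superseries fps" where
  "regrade W = Abs_fps (weight_part W)"

lemma coeff_regrade: "coeff (fps_nth (regrade W) w) M =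
    (if size M \<le> w \<and> even (w - size M) then coeff (fps_nth W ((w - size M) div 2)) M else 0)"
  by (simp add: regrade_def coeff_weight_part)

lemma coeff_regrade': "coeff (fps_nth (regrade W) (2 * k + size M)) M = coeff (fps_nth W k) M"
  by (simp add: coeff_regrade)

lemma regrade_one: "regrade 1 = 1"
  by (rule fps_ext, rule superseries_eqI) (auto simp: coeff_regrade coeff_one elim!: evenE)

text \<open>The weight is additive under multiplication; the rest matches the powers of
  \<open>\<hbar>\<close> in the two factors with the weights that they occupy.\<close>

lemma regrade_times: "regrade (W * W') = regrade W * regrade W'"
proof (rule fps_ext, rule superseries_eqI)
  fix w M
  let ?c = "\<lambda>W w A. coeff (fps_nth (regrade W) w) A"
  have *: "(\<Sum>i=0..w. ?c W i A * ?c W' (w - i) B) =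
      (if size M \<le> w \<and> even (w - size M)
       then \<Sum>j=0..(w - size M) div 2. coeff (fps_nth W j) A * coeff (fps_nth W' ((w - size M) div 2 - j)) B else 0)"
    if M: "M = A + B" for A B
  proof (cases "size M \<le> w \<and> even (w - size M)")
    case True
    then obtain n where n: "w = size A + size B + 2 * n"
      unfolding M by (metis evenE le_add_diff_inverse size_union)
    \<comment> \<open>In the first factor the monomial \<open>A\<close> occurs only in the weights
      \<open>size A + 2 * j\<close>, where \<open>j\<close> is the power of
      \<open>\<hbar>\<close>.\<close>
    have "(\<Sum>i=0..w. ?c W i A * ?c W' (w - i) B) =
        (\<Sum>i\<in>(\<lambda>j. size A + 2 * j) ` {0..n}. ?c W i A * ?c W' (w - i) B)"
    proof (rule sum.mono_neutral_right)
      show "\<forall>i\<in>{0..w} - (\<lambda>j. size A + 2 * j) ` {0..n}. ?c W i A * ?c W' (w - i) B = 0"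
      proof (intro ballI, rule ccontr)
        fix i assume i: "i \<in> {0..w} - (\<lambda>j. size A + 2 * j) ` {0..n}" and "?c W i A * ?c W' (w - i) B \<noteq> 0"
        then have *: "size A \<le> i" "even (i - size A)" "size B \<le> w - i"
          by (auto simp: coeff_regrade split: if_splits)
        then obtain j where j: "i = size A + 2 * j" by (metis evenE le_add_diff_inverse)
        then have "j \<le> n" using * n i by auto
        with i j show False by auto
      qed
    qed (auto simp: n)
    also have "\<dots> = (\<Sum>j=0..n. ?c W (size A + 2 * j) A * ?c W' (w - (size A + 2 * j)) B)"
      by (subst sum.reindex) (auto simp: inj_on_def)
    also have "\<dots> = (\<Sum>j=0..n. coeff (fps_nth W j) A * coeff (fps_nth W' (n - j)) B)"
    proof (rule sum.cong[OF refl])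
      fix j assume "j \<in> {0..n}"
      then have "w - (size A + 2 * j) = 2 * (n - j) + size B" by (auto simp: n)
      then have "?c W' (w - (size A + 2 * j)) B = coeff (fps_nth W' (n - j)) B"
        by (metis coeff_regrade')
      moreover have "?c W (size A + 2 * j) A = coeff (fps_nth W j) A"
        by (metis add.commute coeff_regrade')
      ultimately show "?c W (size A + 2 * j) A * ?c W' (w - (size A + 2 * j)) B =
          coeff (fps_nth W j) A * coeff (fps_nth W' (n - j)) B"
        by (simp only:)
    qed
    finally show ?thesis by (simp add: M n)
  next
    case False
    have "?c W i A * ?c W' (w - i) B = 0" if "i \<in> {0..w}" for i
    proof (rule ccontr)
      assume "?c W i A * ?c W' (w - i) B \<noteq> 0"
      then have "size A \<le> i" "even (i - size A)" "size B \<le> w - i" "even (w - i - size B)"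
        by (auto simp: coeff_regrade split: if_splits)
      moreover from this have "w - size M = (i - size A) + (w - i - size B)" using that by (auto simp: M)
      ultimately have "size M \<le> w \<and> even (w - size M)" using that by (auto simp: M)
      with False show False by blast
    qed
    then show ?thesis using False by (auto simp: sum.neutral)
  qed
  have "coeff (fps_nth (regrade W * regrade W') w) M =
      (\<Sum>(A, B)\<in>splittings M. \<epsilon> A B * (\<Sum>i=0..w. ?c W i A * ?c W' (w - i) B))"
    unfolding fps_mult_nth coeff_sum coeff_times sum_distrib_left case_prod_beta
    by (subst sum.swap) (simp add: mult.assoc)
  also have "\<dots> = (\<Sum>(A, B)\<in>splittings M. if size M \<le> w \<and> even (w - size M)
       then \<epsilon> A B * (\<Sum>j=0..(w - size M) div 2. coeff (fps_nth W j) A * coeff (fps_nth W' ((w - size M) div 2 - j)) B) else 0)"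
    by (intro sum.cong refl, clarify, subst *) (auto simp: splittings_def)
  also have "\<dots> = coeff (fps_nth (regrade (W * W')) w) M"
  proof (cases "size M \<le> w \<and> even (w - size M)")
    case True
    show ?thesis
      unfolding coeff_regrade if_P[OF True] fps_mult_nth coeff_sum coeff_times sum_distrib_left case_prod_beta
      by (subst sum.swap) (simp add: mult.assoc)
  next
    case False
    show ?thesis unfolding coeff_regrade if_not_P[OF False] by simp
  qed
  finally show "coeff (fps_nth (regrade (W * W')) w) M = coeff (fps_nth (regrade W * regrade W') w) M" ..
qed

text \<open>This is \<open>W / \<hbar>\<close> sorted by weight, as division by
  \<open>\<hbar>\<close> lowers the weight by 2. For the logarithm of the integral the weight is the
  number of vertices.\<close>

definition vertex_series :: "superseries fps \<Rightarrow> superseries fps" where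
  "vertex_series W = fps_shift 2 (regrade W)"

lemma perturbative_regrade_below:
  assumes "perturbative W" "w < 3"
  shows "fps_nth (regrade W) w = 0"
proof (rule superseries_eqI, rule ccontr)
  fix M
  assume "coeff (fps_nth (regrade W) w) M \<noteq> coeff 0 M"
  then have M: "size M \<le> w" "even (w - size M)" "coeff (fps_nth W ((w - size M) div 2)) M \<noteq> 0"
    by (auto simp: coeff_regrade split: if_splits)
  then have "3 \<le> 2 * ((w - size M) div 2) + size M"
    using assms(1) unfolding perturbative_def by blast
  with M(1,2) assms(2) show False by simp
qed

lemma vertex_series_0: "perturbative W \<Longrightarrow> fps_nth (vertex_series W) 0 = 0"
  using perturbative_regrade_below[of W 2] by (simp add: vertex_series_def numeral_2_eq_2)

lemma regrade_eq_shift: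
  assumes "perturbative W"
  shows "regrade W = fps_X ^ 2 * vertex_series W"
proof (rule fps_ext)
  fix n
  show "fps_nth (regrade W) n = fps_nth (fps_X ^ 2 * vertex_series W) n"
  proof (cases "n < 2")
    case False
    then obtain m where "n = m + 2" by (metis add.commute le_Suc_ex not_less)
    then show ?thesis by (simp add: fps_X_power_mult_nth vertex_series_def)
  qed (simp add: fps_X_power_mult_nth perturbative_regrade_below[OF assms])
qed

lemma regrade_power_shift:
  assumes "perturbative W"
  shows "regrade (W ^ n) = fps_X ^ (2 * n) * vertex_series W ^ n"
proof (induction n)
  case (Suc n)
  let ?U = "vertex_series W"
  have "regrade (W ^ Suc n) = fps_X ^ 2 * ?U * (fps_X ^ (2 * n) * ?U ^ n)"
    using Suc regrade_eq_shift[OF assms] by (simp add: regrade_times)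
  also have "\<dots> = fps_X ^ 2 * (?U * fps_X ^ (2 * n)) * ?U ^ n" by (simp only: mult.assoc)
  also have "\<dots> = fps_X ^ 2 * (fps_X ^ (2 * n) * ?U) * ?U ^ n"
    by (simp only: fps_mult_fps_X_power_commute)
  also have "\<dots> = (fps_X ^ 2 * fps_X ^ (2 * n)) * (?U * ?U ^ n)" by (simp only: mult.assoc)
  finally show ?case by (simp flip: power_add)
qed (simp add: regrade_one)

lemma coeff_vertex_power:
  assumes "perturbative W"
  shows "coeff (fps_nth (vertex_series W ^ n) w) M = coeff (fps_nth (regrade (W ^ n)) (w + 2 * n)) M"
  by (simp add: regrade_power_shift[OF assms] fps_X_power_mult_nth)

text \<open>The powers of \<open>W / \<hbar>\<close> start at weight \<open>n\<close>, so at the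
  fixed weight \<open>2 * k + size M\<close> the infinite sum is finite and is that of
  \<open>fexp\<close>; nothing has negative weight.\<close>

lemma exp_coeff_perturbative:
  assumes "perturbative W"
  shows "exp_coeff (\<lambda>n. W ^ n) k M = (if 2 * k + int (size M) \<ge> 0
    then coeff (fps_nth (fexp (vertex_series W)) (nat (2 * k + int (size M)))) M else 0)"
proof -
  let ?U = "vertex_series W" and ?t = "\<lambda>n. if k + int n < 0 then 0 else coeff (fps_nth (W ^ n) (nat (k + int n))) M / fact n"
  show ?thesis
  proof (cases "2 * k + int (size M) \<ge> 0")
    case True
    define w where "w = nat (2 * k + int (size M))"
    have w: "int w = 2 * k + int (size M)" using True by (simp add: w_def)
    have t: "?t n = coeff (fps_nth (?U ^ n) w) M / fact n" for n
    proof (cases "k + int n < 0")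
      case True
      then have "w + 2 * n < size M" using w by linarith
      then show ?thesis using True by (simp add: coeff_vertex_power[OF assms] coeff_regrade)
    next
      case False
      then have "w + 2 * n = 2 * nat (k + int n) + size M" using w by linarith
      then show ?thesis using False by (simp add: coeff_vertex_power[OF assms] coeff_regrade')
    qed
    have "exp_coeff (\<lambda>n. W ^ n) k M = (\<Sum>n\<le>w. coeff (fps_nth (?U ^ n) w) M / fact n)"
      unfolding exp_coeff_def t
      by (rule suminf_finite)
        (auto simp: fps_power_nth_below[OF vertex_series_0[OF assms]])
    then show ?thesis using True by (simp add: fexp_nth w_def)
  next
    case False
    have t: "?t n = 0" for n
    proof (cases "k + int n < 0")
      case nn: False
      define i where "i = 2 * nat (k + int n) + size M"
      have "i < 2 * n" using False nn by (auto simp: i_def)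
      then have "fps_nth (regrade (W ^ n)) i = 0"
        by (simp add: regrade_power_shift[OF assms] fps_X_power_mult_nth)
      then show ?thesis using coeff_regrade'[of "W ^ n" "nat (k + int n)" M] by (simp add: i_def)
    qed simp
    show ?thesis unfolding exp_coeff_def t using False by simp
  qed
qed

lemma vertex_series_inject:
  assumes W: "perturbative W" "perturbative W'" and "vertex_series W = vertex_series W'"
  shows "W = W'"
proof (rule fps_ext, rule superseries_eqI)
  fix k M
  have "regrade W = regrade W'" using assms by (simp add: regrade_eq_shift)
  then show "coeff (fps_nth W k) M = coeff (fps_nth W' k) M"
    using coeff_regrade'[of W k M] coeff_regrade'[of W' k M] by simp
qed

lemma perturbative_exp_inject:
  assumes W: "perturbative W" "perturbative W'"
    and eq: "exp_coeff (\<lambda>n. W ^ n) = exp_coeff (\<lambda>n. W' ^ n)"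
  shows "W = W'"
proof -
  \<comment> \<open>\<open>exp_coeff\<close> sees only those pairs of weight and degree whose sum is
    even; at all others the exponential vanishes.\<close>
  have odd0: "coeff (fps_nth (fexp (vertex_series W)) w) M = 0"
    if "perturbative W" "odd (w + size M)" for W w M
  proof -
    have "coeff (fps_nth (vertex_series W ^ n) w) M = 0" for n
      using that(2) by (auto simp: coeff_vertex_power[OF that(1)] coeff_regrade)
    then show ?thesis by (simp add: fexp_nth)
  qed
  have "fexp (vertex_series W) = fexp (vertex_series W')"
  proof (rule fps_ext, rule superseries_eqI)
    fix w M
    show "coeff (fps_nth (fexp (vertex_series W)) w) M = coeff (fps_nth (fexp (vertex_series W')) w) M"
    proof (cases "even (w + size M)")
      case True
      define k where "k = (int w - int (size M)) div 2"
      have k: "2 * k + int (size M) = int w"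
        using True by (auto simp: k_def)
      have "exp_coeff (\<lambda>n. W ^ n) k M = exp_coeff (\<lambda>n. W' ^ n) k M" using eq by simp
      then show ?thesis unfolding exp_coeff_perturbative[OF W(1)] exp_coeff_perturbative[OF W(2)] k
        by simp
    next
      case False
      then show ?thesis by (simp add: odd0 W)
    qed
  qed
  then have "vertex_series W = vertex_series W'"
    by (rule fexp_inject[OF vertex_series_0[OF W(1)] vertex_series_0[OF W(2)]])
  with W show ?thesis by (rule vertex_series_inject)
qed

subsection \<open>Restriction to vanishing fiber coordinates\<close>

lift_definition restrict_base :: "coord set \<Rightarrow> superseries \<Rightarrow> superseries" is
  "\<lambda>\<Phi> f M. if set_mset M \<inter> \<Phi> = {} then f M else 0" by auto

lemma coeff_restrict: "coeff (restrict_base \<Phi> f) M = (if set_mset M \<inter> \<Phi> = {} then coeff f M else 0)"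
  by (simp add: restrict_base.rep_eq)

lemma restrict_one [simp]: "restrict_base \<Phi> 1 = 1"
  by (rule superseries_eqI) (auto simp: coeff_restrict coeff_one)

lemma linear_restrict: "linear (restrict_base \<Phi>)"
  by (rule linearI; rule superseries_eqI) (auto simp: coeff_restrict)

lemma restrict_times: "restrict_base \<Phi> (f * g) = restrict_base \<Phi> f * restrict_base \<Phi> g"
proof (rule superseries_eqI)
  fix M
  show "coeff (restrict_base \<Phi> (f * g)) M = coeff (restrict_base \<Phi> f * restrict_base \<Phi> g) M"
  proof (cases "set_mset M \<inter> \<Phi> = {}")
    case True
    then show ?thesis
      unfolding coeff_restrict coeff_times by (auto simp: splittings_def intro!: sum.cong)
  next
    case False
    have "coeff (restrict_base \<Phi> f * restrict_base \<Phi> g) M = 0"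
    proof (rule ccontr)
      assume "coeff (restrict_base \<Phi> f * restrict_base \<Phi> g) M \<noteq> 0"
      then obtain A B where "A + B = M" "coeff (restrict_base \<Phi> f) A \<noteq> 0" "coeff (restrict_base \<Phi> g) B \<noteq> 0"
        by (rule coeff_times_nonzeroE)
      with False show False by (auto simp: coeff_restrict split: if_splits)
    qed
    with False show ?thesis by (simp add: coeff_restrict)
  qed
qed

lemma restrict_power: "fmap (restrict_base \<Phi>) (V ^ n) = fmap (restrict_base \<Phi>) V ^ n"
proof (induction n)
  case 0
  show ?case by (rule fps_ext) (simp add: fps_one_nth linear_0[OF linear_restrict])
next
  case (Suc n)
  then show ?case
    by (auto simp: fps_eq_iff fps_mult_nth linear_sum[OF linear_restrict] restrict_times)
qed

text \<open>Restriction is a ring homomorphism, so the logarithm may be taken first, while the fiber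
  coordinates on which \<open>lap\<close> acts are still present.\<close>

lemma fexp_restrict: "fexp (fmap (restrict_base \<Phi>) V) = fmap (restrict_base \<Phi>) (fexp V)"
  by (rule fps_ext)
    (simp add: fexp_nth linear_sum[OF linear_restrict] linear_scale[OF linear_restrict]
      flip: restrict_power)

text \<open>Undoes \<open>vertex_series\<close>: in \<open>W\<close> the term
  \<open>\<hbar>^k\<close> times a monomial \<open>M\<close> belongs to
  \<open>2 * k + size M - 2\<close> vertices. The guard excludes truncated subtraction.\<close>

lift_definition ungrade_part :: "superseries fps \<Rightarrow> nat \<Rightarrow> superseries" is
  "\<lambda>V k M. if 2 \<le> 2 * k + size M then coeff (fps_nth V (2 * k + size M - 2)) M else 0"
  by (auto simp: coeff_vanishing)

lemma coeff_ungrade: "coeff (ungrade_part V k) M =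
    (if 2 \<le> 2 * k + size M then coeff (fps_nth V (2 * k + size M - 2)) M else 0)"
  by (simp add: ungrade_part.rep_eq)

lemma pd_eq_0_coeff:
  assumes "pd x f = 0" "x \<in># M"
  shows "coeff f M = 0"
proof (cases "nonvanishing M")
  case True
  obtain M' where M: "M = add_mset x M'" using assms(2) by (metis insert_DiffM)
  have "coeff (pd x f) M' = 0" using assms(1) by simp
  moreover have "\<epsilon> {#x#} M' \<noteq> 0" using True mono_sign_square[of "{#x#}" M'] by (auto simp: M)
  moreover have "real (count M' x) + 1 \<noteq> 0" by linarith
  ultimately show ?thesis by (simp add: coeff_pd M)
qed (simp add: coeff_vanishing)

context cubic_interaction
begin

definition connected :: "superseries fps" where
  "connected = Abs_fps (ungrade_part (fmap (restrict_base \<Phi>) V))"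

lemma coeff_connected: "coeff (fps_nth connected k) M =
    (if set_mset M \<inter> \<Phi> = {} \<and> 2 \<le> 2 * k + size M then coeff (fps_nth V (2 * k + size M - 2)) M else 0)"
  by (simp add: connected_def coeff_ungrade coeff_restrict)

lemma perturbative_connected: "perturbative connected"
  unfolding perturbative_def
proof (intro allI impI)
  fix k M
  assume "coeff (fps_nth connected k) M \<noteq> 0"
  then have "2 \<le> 2 * k + size M" "coeff (fps_nth V (2 * k + size M - 2)) M \<noteq> 0"
    by (auto simp: coeff_connected split: if_splits)
  moreover from this have "2 * k + size M - 2 \<noteq> 0" using V_0 by (metis coeff_zero)
  ultimately show "3 \<le> 2 * k + size M" by linarith
qed

text \<open>Where \<open>size M > w + 2\<close> or the parity is wrong, no power of
  \<open>\<hbar>\<close> with natural exponent could carry the coefficient;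
  \<open>linked_cluster\<close> says that it vanishes there.\<close>

lemma vertex_series_connected: "vertex_series connected = fmap (restrict_base \<Phi>) V"
proof (rule fps_ext, rule superseries_eqI)
  fix w M
  show "coeff (fps_nth (vertex_series connected) w) M = coeff (fps_nth (fmap (restrict_base \<Phi>) V) w) M"
  proof (cases "size M \<le> w + 2 \<and> even (w + size M)")
    case True
    then have "even (w + 2 - size M)" by auto
    then have "2 * ((w + 2 - size M) div 2) + size M = w + 2" using True by auto
    with True show ?thesis
      by (simp add: vertex_series_def coeff_regrade coeff_connected coeff_restrict)
  next
    case False
    then have "coeff (fps_nth V w) M = 0" using linked_cluster by blast
    moreover have "\<not> (size M \<le> w + 2 \<and> even (w + 2 - size M))" using False by auto
    ultimately show ?thesis
      by (auto simp: vertex_series_def coeff_regrade coeff_restrict)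
  qed
qed

text \<open>The order in \<open>\<hbar>\<close> of the integral of \<open>I ^ n\<close> is the
  number of propagators, so \<open>k\<close> and the degree of \<open>M\<close> leave a single
  \<open>n\<close>: the series over \<open>n\<close> collapses to one term of
  \<open>Z\<close>.\<close>

lemma exp_coeff_integral:
  assumes "propagator \<Phi> q = G"
  shows "exp_coeff (\<lambda>n. formal_integral \<Phi> q (I ^ n)) k M = exp_coeff (\<lambda>n. connected ^ n) k M"
proof -
  let ?t = "\<lambda>n. if k + int n < 0 then 0
    else coeff (fps_nth (formal_integral \<Phi> q (I ^ n)) (nat (k + int n))) M / fact n"
  have t: "?t n = (if 2 * k + int (size M) = int n then coeff (restrict_base \<Phi> (Z n)) M else 0)" for n
  proof (cases "k + int n < 0")
    case True
    have "coeff (Z n) M = 0" if "2 * k + int (size M) = int n"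
    proof (rule ccontr)
      assume "coeff (Z n) M \<noteq> 0"
      then obtain m where "size M + 2 * m = 3 * n" using coeff_Z_nonzero by blast
      with that True show False by linarith
    qed
    with True show ?thesis by (simp add: coeff_restrict)
  next
    case False
    define j where "j = nat (k + int n)"
    have j: "int j = k + int n" using False by (simp add: j_def)
    have "2 * k + int (size M) = int n \<longleftrightarrow> size M + 2 * j = 3 * n" using j by linarith
    then show ?thesis
      using False coeff_Z[of M j n] coeff_lap_power[of j n M]
      by (auto simp: formal_integral_def coeff_integral[OF assms] coeff_restrict j_def)
  qed
  have "exp_coeff (\<lambda>n. formal_integral \<Phi> q (I ^ n)) k M =
      (if 2 * k + int (size M) \<ge> 0 then coeff (restrict_base \<Phi> (Z (nat (2 * k + int (size M))))) M else 0)"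
  proof (cases "2 * k + int (size M) \<ge> 0")
    case True
    then show ?thesis
      unfolding exp_coeff_def t
      by (subst suminf_finite[of "{nat (2 * k + int (size M))}"]) auto
  qed (auto simp: exp_coeff_def t)
  then show ?thesis
    by (simp add: exp_coeff_perturbative[OF perturbative_connected] vertex_series_connected
      fexp_restrict fexp_V)
qed

lemma effective_unique:
  assumes "propagator \<Phi> q = G" "connected \<in> Fun_hbar \<B>"
  shows "(W \<in> Fun_hbar \<B> \<and> perturbative W \<and>
    exp_coeff (\<lambda>n. W ^ n) = exp_coeff (\<lambda>n. formal_integral \<Phi> q (I ^ n))) \<longleftrightarrow> W = connected"
proof -
  have e: "exp_coeff (\<lambda>n. formal_integral \<Phi> q (I ^ n)) = exp_coeff (\<lambda>n. connected ^ n)"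
    by (intro ext) (rule exp_coeff_integral[OF assms(1)])
  show ?thesis unfolding e
    using perturbative_exp_inject perturbative_connected assms(2) by blast
qed

end

section \<open>Linear algebra of the induction data\<close>

lemma conjunct_drop4: "A \<and> B \<and> C \<and> D \<and> P \<Longrightarrow> P"
  by blast

locale dgfa_data =
  fixes A :: "'c::real_vector dgfa"
  assumes frobenius: "dg_frobenius_algebra A"
begin

lemmas frobenius_axioms = frobenius[unfolded dg_frobenius_algebra_def]

lemma graded: "graded_0_to_3 (gr A)"
  using frobenius_axioms[THEN conjunct2, THEN conjunct1] by blast

lemma mul_gr: "a \<in> gr A i \<Longrightarrow> b \<in> gr A j \<Longrightarrow> mul A a b \<in> gr A (i + j)"
  using frobenius_axioms[THEN conjunct2, THEN conjunct2, THEN conjunct2, THEN conjunct1] by blast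

lemma unit_gr: "unit A \<in> gr A 0"
  using frobenius_axioms[THEN conjunct_drop4, THEN conjunct2, THEN conjunct1] by blast

lemma unit_mul: "mul A (unit A) a = a" "mul A a (unit A) = a"
  using frobenius_axioms[THEN conjunct_drop4, THEN conjunct2, THEN conjunct2, THEN conjunct1] by blast+

lemma diff_linear: "linear (diff A)"
  using frobenius_axioms[THEN conjunct_drop4, THEN conjunct2, THEN conjunct2, THEN conjunct2, THEN conjunct1] by blast

lemma diff_gr: "a \<in> gr A k \<Longrightarrow> diff A a \<in> gr A (Suc k)"
  using frobenius_axioms[THEN conjunct_drop4, THEN conjunct_drop4, THEN conjunct1] by blast

lemma diff_diff [simp]: "diff A (diff A a) = 0"
  using frobenius_axioms[THEN conjunct_drop4, THEN conjunct_drop4, THEN conjunct2, THEN conjunct1] by blast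

lemma diff_mul: "a \<in> gr A k \<Longrightarrow> diff A (mul A a b) = mul A (diff A a) b + (-1) ^ k *\<^sub>R mul A a (diff A b)"
  using frobenius_axioms[THEN conjunct_drop4, THEN conjunct_drop4, THEN conjunct2, THEN conjunct2, THEN conjunct1] by blast

lemma bilinear_pair: "bilinear (pair A)"
  using frobenius_axioms[THEN conjunct_drop4, THEN conjunct_drop4, THEN conjunct2, THEN conjunct2, THEN conjunct2, THEN conjunct1] by blast

lemma pair_degree: "a \<in> gr A i \<Longrightarrow> b \<in> gr A j \<Longrightarrow> pair A a b \<noteq> 0 \<Longrightarrow> i + j = 3"
  using frobenius_axioms[THEN conjunct_drop4, THEN conjunct_drop4, THEN conjunct_drop4, THEN conjunct1] by blast

lemma pair_swap: "a \<in> gr A i \<Longrightarrow> b \<in> gr A j \<Longrightarrow> pair A a b = (-1) ^ (i * j) * pair A b a"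
  using frobenius_axioms[THEN conjunct_drop4, THEN conjunct_drop4, THEN conjunct_drop4, THEN conjunct1] by blast

lemma pair_nondegenerate: "(\<And>b. pair A a b = 0) \<Longrightarrow> a = 0"
  using frobenius_axioms[THEN conjunct_drop4, THEN conjunct_drop4, THEN conjunct_drop4, THEN conjunct2, THEN conjunct1] by blast

lemma pair_diff: "a \<in> gr A k \<Longrightarrow> pair A (diff A a) b + (-1) ^ k * pair A a (diff A b) = 0"
  using frobenius_axioms[THEN conjunct_drop4, THEN conjunct_drop4, THEN conjunct_drop4, THEN conjunct2, THEN conjunct2, THEN conjunct1] by blast

lemma pair_mul: "pair A a (mul A b c) = pair A (mul A a b) c"
  using frobenius_axioms[THEN conjunct_drop4, THEN conjunct_drop4, THEN conjunct_drop4, THEN conjunct2, THEN conjunct2, THEN conjunct2] by blast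

lemma diff_unit: "diff A (unit A) = 0"
  using diff_mul[OF unit_gr, of "unit A"] by (simp add: unit_mul)

lemma pair_eq_0: "a \<in> gr A i \<Longrightarrow> b \<in> gr A j \<Longrightarrow> i + j \<noteq> 3 \<Longrightarrow> pair A a b = 0"
  using pair_degree by blast

lemma linear_pair: "linear (\<lambda>a. pair A a b)" "linear (pair A a)"
  using bilinear_pair by (auto simp: bilinear_def)

lemmas pair_left = linear_0[OF linear_pair(1)] linear_add[OF linear_pair(1)]
  linear_diff[OF linear_pair(1)] linear_scale[OF linear_pair(1)] linear_sum[OF linear_pair(1)]
lemmas pair_right = linear_0[OF linear_pair(2)] linear_add[OF linear_pair(2)]
  linear_diff[OF linear_pair(2)] linear_scale[OF linear_pair(2)] linear_sum[OF linear_pair(2)]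
lemmas diff_simps = linear_0[OF diff_linear] linear_add[OF diff_linear]
  linear_diff[OF diff_linear] linear_scale[OF diff_linear] linear_sum[OF diff_linear]

lemmas graded_axioms = graded[unfolded graded_0_to_3_def]

lemma subspace_gr: "subspace (gr A k)"
  using graded_axioms by blast

lemma gr_large: "k > 3 \<Longrightarrow> gr A k = {0}"
  using graded_axioms by blast

lemma gr_unique:
  assumes "\<And>k. u k \<in> gr A k" "\<And>k. v k \<in> gr A k" "(\<Sum>k\<le>3. u k) = (\<Sum>k\<le>3. v k)"
  shows "u = v"
proof -
  have "\<exists>!w. (\<forall>k. w k \<in> gr A k) \<and> (\<Sum>k\<le>3. u k) = (\<Sum>k\<le>3. w k)"
    by (rule graded_axioms[THEN conjunct2, THEN conjunct2, THEN spec])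
  then obtain w where w: "\<forall>y. (\<forall>k. y k \<in> gr A k) \<and> (\<Sum>k\<le>3. u k) = (\<Sum>k\<le>3. y k) \<longrightarrow> y = w"
    unfolding Ex1_def by (elim exE conjE)
  show ?thesis using spec[OF w, of u] spec[OF w, of v] assms by simp
qed

lemma gr_decompose: "\<exists>u. (\<forall>k. u k \<in> gr A k) \<and> x = (\<Sum>k\<le>3. u k)"
  by (rule ex1_implies_ex[OF graded_axioms[THEN conjunct2, THEN conjunct2, THEN spec]])

lemma gr_0: "0 \<in> gr A k"
  using subspace_gr by (rule subspace_0)

lemma gr_sum_eq_0:
  assumes "\<And>k. u k \<in> gr A k" "(\<Sum>k\<le>3. u k) = 0"
  shows "u k = 0"
  using gr_unique[of u "\<lambda>_. 0"] assms gr_0 by (auto simp: fun_eq_iff)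

lemma diff_components:
  assumes "\<And>k. u k \<in> gr A k"
  defines "v \<equiv> \<lambda>k. if k = 0 then 0 else diff A (u (k - 1))"
  shows "v k \<in> gr A k" "diff A (\<Sum>k\<le>3. u k) = (\<Sum>k\<le>3. v k)"
proof -
  show v: "v k \<in> gr A k" for k
    using diff_gr[OF assms(1), of "k - 1"] gr_0 by (auto simp: v_def)
  have "diff A (u 3) = 0" using v[of 4] gr_large[of 4] by (simp add: v_def)
  then show "diff A (\<Sum>k\<le>3. u k) = (\<Sum>k\<le>3. v k)"
    by (simp add: diff_simps v_def numeral_3_eq_3 numeral_2_eq_2)
qed

lemma cocycle_components:
  assumes "\<And>k. u k \<in> gr A k" "diff A (\<Sum>k\<le>3. u k) = 0"
  shows "diff A (u k) = 0"
proof -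
  let ?v = "\<lambda>k. if k = 0 then 0 else diff A (u (k - 1))"
  have "?v (Suc k) = 0"
    by (rule gr_sum_eq_0) (use diff_components[of u] assms in auto)
  then show ?thesis by simp
qed

lemma exact_degree_0:
  assumes "x \<in> gr A 0" "x = diff A y"
  shows "x = 0"
proof -
  obtain u where u: "\<And>k. u k \<in> gr A k" "y = (\<Sum>k\<le>3. u k)" using gr_decompose[of "y"] by blast
  let ?v = "\<lambda>k. if k = 0 then 0 else diff A (u (k - 1))"
  let ?x = "\<lambda>k::nat. if k = 0 then x else 0"
  have "?x = ?v"
  proof (rule gr_unique)
    show "(\<Sum>k\<le>3. ?x k) = (\<Sum>k\<le>3. ?v k)"
      using diff_components(2)[of u, OF u(1)] assms(2) u(2)
      by (simp add: numeral_3_eq_3)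
  qed (use diff_components(1)[of u, OF u(1)] assms(1) gr_0 in auto)
  from fun_cong[OF this, of 0] show ?thesis by simp
qed

subsection \<open>Classes\<close>

lemma mem_coh_class: "x \<in> coh_class A z \<longleftrightarrow> (\<exists>y. x = z + diff A y)"
  by (auto simp: coh_class_def)

lemma coh_class_self: "z \<in> coh_class A z"
  unfolding mem_coh_class by (rule exI[of _ 0]) (simp add: diff_simps)

lemma coh_add_class: "coh_add (coh_class A z) (coh_class A z') = coh_class A (z + z')"
proof (intro subset_antisym subsetI)
  fix x assume "x \<in> coh_add (coh_class A z) (coh_class A z')"
  then obtain y y' where "x = (z + diff A y) + (z' + diff A y')"
    by (auto simp: coh_add_def coh_class_def)
  then have "x = z + z' + diff A (y + y')" by (simp add: diff_simps)
  then show "x \<in> coh_class A (z + z')" by (auto simp: coh_class_def)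
next
  fix x assume "x \<in> coh_class A (z + z')"
  then obtain y where "x = (z + diff A y) + z'" by (auto simp: coh_class_def add_ac)
  moreover have "z + diff A y \<in> coh_class A z" by (auto simp: coh_class_def)
  ultimately show "x \<in> coh_add (coh_class A z) (coh_class A z')"
    using coh_class_self[of z'] unfolding coh_add_def by blast
qed

lemma coh_scale_class: "coh_scale A r (coh_class A z) = coh_class A (r *\<^sub>R z)"
proof (intro subset_antisym subsetI)
  fix x assume "x \<in> coh_scale A r (coh_class A z)"
  then obtain y y' where "x = r *\<^sub>R (z + diff A y) + diff A y'"
    by (auto simp: coh_scale_def coh_class_def)
  then have "x = r *\<^sub>R z + diff A (r *\<^sub>R y + y')" by (simp add: diff_simps scaleR_add_right)
  then show "x \<in> coh_class A (r *\<^sub>R z)" by (auto simp: coh_class_def)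
next
  fix x assume "x \<in> coh_class A (r *\<^sub>R z)"
  then obtain y where "x = r *\<^sub>R z + diff A y" by (auto simp: coh_class_def)
  then show "x \<in> coh_scale A r (coh_class A z)"
    using coh_class_self[of z] unfolding coh_scale_def by blast
qed

lemma cohomology_total: "h \<in> cohomology A k \<Longrightarrow> h \<in> total_cohomology A"
  by (auto simp: cohomology_def total_cohomology_def)

end

section \<open>Consequences of the induction data\<close>

locale induction_setting = dgfa_data A for A :: "'c::real_vector dgfa" +
  fixes \<iota> :: "'c set \<Rightarrow> 'c" and K :: "'c \<Rightarrow> 'c"
  assumes ind: "induction_data A \<iota> K"
begin

lemmas ind_axioms = ind[unfolded induction_data_def]

lemma diff_iota: "h \<in> total_cohomology A \<Longrightarrow> diff A (\<iota> h) = 0"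
  using ind_axioms[THEN conjunct1] by blast

lemma class_iota: "h \<in> total_cohomology A \<Longrightarrow> coh_class A (\<iota> h) = h"
  using ind_axioms[THEN conjunct1] by blast

lemma iota_gr: "h \<in> cohomology A k \<Longrightarrow> \<iota> h \<in> gr A k"
  using ind_axioms[THEN conjunct2, THEN conjunct1] by blast

lemma iota_add: "g \<in> total_cohomology A \<Longrightarrow> h \<in> total_cohomology A \<Longrightarrow> \<iota> (coh_add g h) = \<iota> g + \<iota> h"
  using ind_axioms[THEN conjunct2, THEN conjunct2, THEN conjunct1] by blast

lemma iota_scale: "h \<in> total_cohomology A \<Longrightarrow> \<iota> (coh_scale A r h) = r *\<^sub>R \<iota> h"
  using ind_axioms[THEN conjunct2, THEN conjunct2, THEN conjunct2, THEN conjunct1] by blast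

lemma linear_K: "linear K"
  using ind_axioms[THEN conjunct_drop4, THEN conjunct1] by blast

lemma K_gr: "a \<in> gr A (Suc k) \<Longrightarrow> K a \<in> gr A k"
  using ind_axioms[THEN conjunct_drop4, THEN conjunct2, THEN conjunct1] by blast

lemma K_gr0: "a \<in> gr A 0 \<Longrightarrow> K a = 0"
  using ind_axioms[THEN conjunct_drop4, THEN conjunct2, THEN conjunct2, THEN conjunct1] by blast

lemma homotopy: "diff A (K a) + K (diff A a) = a - \<iota> (iota_transpose A \<iota> a)"
  using ind_axioms[THEN conjunct_drop4, THEN conjunct2, THEN conjunct2, THEN conjunct2, THEN conjunct1] by blast

lemma pair_K: "a \<in> gr A k \<Longrightarrow> pair A (K a) b = (-1) ^ k * pair A a (K b)"
  using ind_axioms[THEN conjunct_drop4, THEN conjunct_drop4, THEN conjunct1] by blast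

lemma K_iota: "h \<in> total_cohomology A \<Longrightarrow> K (\<iota> h) = 0"
  using ind_axioms[THEN conjunct_drop4, THEN conjunct_drop4, THEN conjunct2, THEN conjunct1] by blast

lemma K_K [simp]: "K (K a) = 0"
  using ind_axioms[THEN conjunct_drop4, THEN conjunct_drop4, THEN conjunct2, THEN conjunct2] by blast

text \<open>\<open>K\<close> is self-adjoint up to a sign in each degree, so \<open>im K\<close> is
  orthogonal to \<open>ker K\<close>, which contains \<open>im K\<close> and
  \<open>im \<iota>\<close>.\<close>

lemma pair_K_eq_0:
  assumes "K b = 0"
  shows "pair A (K a) b = 0"
proof -
  obtain u where u: "\<And>k. u k \<in> gr A k" "a = (\<Sum>k\<le>3. u k)" using gr_decompose[of "a"] by blast
  have "pair A (K (u k)) b = 0" for k using pair_K[OF u(1)] assms by (simp add: pair_right)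
  then show ?thesis by (simp add: u(2) linear_sum[OF linear_K] pair_left)
qed

lemma total_class: "diff A z = 0 \<Longrightarrow> coh_class A z \<in> total_cohomology A"
  by (auto simp: total_cohomology_def)

lemma iota_class_add:
  "diff A z = 0 \<Longrightarrow> diff A z' = 0 \<Longrightarrow> \<iota> (coh_class A (z + z')) = \<iota> (coh_class A z) + \<iota> (coh_class A z')"
  unfolding coh_add_class[symmetric] by (intro iota_add total_class)

lemma iota_class_scale: "diff A z = 0 \<Longrightarrow> \<iota> (coh_class A (r *\<^sub>R z)) = r *\<^sub>R \<iota> (coh_class A z)"
  unfolding coh_scale_class[symmetric] by (intro iota_scale total_class)

lemma iota_class_0: "\<iota> (coh_class A 0) = 0"
  using iota_class_scale[of 0 0] by (simp add: diff_simps)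

lemma iota_class_sum:
  "finite S \<Longrightarrow> (\<And>i. i \<in> S \<Longrightarrow> diff A (z i) = 0) \<Longrightarrow>
   \<iota> (coh_class A (\<Sum>i\<in>S. z i)) = (\<Sum>i\<in>S. \<iota> (coh_class A (z i)))"
  by (induction S rule: finite_induct) (auto simp: iota_class_0 iota_class_add diff_simps)

lemma iota_class_iota: "h \<in> total_cohomology A \<Longrightarrow> \<iota> (coh_class A (\<iota> h)) = \<iota> h"
  by (simp add: class_iota)

lemma iota_lincomb:
  assumes "\<And>i. i < n \<Longrightarrow> e i \<in> total_cohomology A"
  shows "coh_lincomb A n c e \<in> total_cohomology A \<and> \<iota> (coh_lincomb A n c e) = (\<Sum>i<n. c i *\<^sub>R \<iota> (e i))"
  using assms
proof (induction n)
  case 0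
  then show ?case by (auto simp: iota_class_0 diff_simps intro: total_class)
next
  case (Suc n)
  then have IH: "coh_lincomb A n c e \<in> total_cohomology A"
      "\<iota> (coh_lincomb A n c e) = (\<Sum>i<n. c i *\<^sub>R \<iota> (e i))" and e: "e n \<in> total_cohomology A"
    by auto
  obtain z z' where z: "coh_lincomb A n c e = coh_class A z" "e n = coh_class A z'"
      "diff A z = 0" "diff A z' = 0"
    using IH(1) e by (auto simp: total_cohomology_def)
  have "coh_scale A (c n) (e n) \<in> total_cohomology A"
    unfolding z coh_scale_class using z by (intro total_class) (simp add: diff_simps)
  moreover have "coh_add (coh_lincomb A n c e) (coh_scale A (c n) (e n)) \<in> total_cohomology A"
    unfolding z coh_scale_class coh_add_class using z by (intro total_class) (simp add: diff_simps)
  ultimately show ?case using IH e by (simp add: iota_add iota_scale)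
qed

lemma coh_basis_span:
  assumes "coh_basis A k n e" "z \<in> gr A k" "diff A z = 0"
  obtains c where "\<iota> (coh_class A z) = (\<Sum>i<n. c i *\<^sub>R \<iota> (e i))"
proof -
  have "coh_class A z \<in> cohomology A k" using assms(2,3) by (auto simp: cohomology_def)
  then obtain c where c: "coh_class A z = coh_lincomb A n c e"
    using assms(1) unfolding coh_basis_def by blast
  have "\<iota> (coh_lincomb A n c e) = (\<Sum>i<n. c i *\<^sub>R \<iota> (e i))"
    using iota_lincomb[of n e c] assms(1) cohomology_total unfolding coh_basis_def by blast
  with that[of c] c show thesis by simp
qed

lemma coh_dim_1_span:
  assumes "coh_dim A k 1" "h \<in> cohomology A k" "\<iota> h \<noteq> 0" "z \<in> gr A k" "diff A z = 0"
  obtains c where "\<iota> (coh_class A z) = c *\<^sub>R \<iota> h"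
proof -
  obtain e where e: "coh_basis A k 1 e" using assms(1) by (auto simp: coh_dim_def)
  obtain c where c: "\<iota> (coh_class A z) = c *\<^sub>R \<iota> (e 0)"
    using coh_basis_span[OF e assms(4,5)] by (metis (no_types, lifting) lessThan_0 lessThan_Suc One_nat_def sum.empty sum.insert finite.emptyI empty_iff add.right_neutral)
  obtain z' where z': "h = coh_class A z'" "z' \<in> gr A k" "diff A z' = 0"
    using assms(2) by (auto simp: cohomology_def)
  obtain c' where c': "\<iota> h = c' *\<^sub>R \<iota> (e 0)"
    using coh_basis_span[OF e z'(2,3)] unfolding z'(1)[symmetric] by (metis (no_types, lifting) lessThan_0 lessThan_Suc One_nat_def sum.empty sum.insert finite.emptyI empty_iff add.right_neutral)
  have "c' \<noteq> 0" using assms(3) c' by auto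
  then have "\<iota> (coh_class A z) = (c / c') *\<^sub>R \<iota> h" by (simp add: c c')
  then show thesis by (rule that)
qed

text \<open>Both sides represent the same class, and an exact element of degree 0 is zero, as
  \<open>d\<close> raises the degree.\<close>

lemma iota_unit: "\<iota> (coh_class A (unit A)) = unit A" if "diff A (unit A) = 0"
proof -
  let ?h = "coh_class A (unit A)"
  have h: "?h \<in> cohomology A 0" using that unit_gr by (auto simp: cohomology_def)
  then have "coh_class A (\<iota> ?h) = ?h" by (intro class_iota cohomology_total)
  then obtain y where y: "\<iota> ?h = unit A + diff A y"
    using coh_class_self[of "\<iota> ?h"] by (auto simp: mem_coh_class)
  have "diff A y \<in> gr A 0" using iota_gr[OF h] unit_gr subspace_diff[OF subspace_gr] y
    by (metis add_diff_cancel_left')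
  then have "diff A y = 0" by (rule exact_degree_0) simp
  with y show ?thesis by simp
qed

lemma range_K_decompose:
  assumes "x \<in> range K"
  obtains u where "\<And>k. u k \<in> range K \<inter> gr A k" "x = (\<Sum>k\<le>3. u k)"
proof -
  obtain a where a: "x = K a" using assms by auto
  obtain u where u: "\<And>k. u k \<in> gr A k" "a = (\<Sum>k\<le>3. u k)" using gr_decompose[of "a"] by blast
  have "K (u (Suc k)) \<in> range K \<inter> gr A k" for k using K_gr[OF u(1)] by auto
  moreover have "x = (\<Sum>k\<le>3. K (u (Suc k)))"
  proof -
    have "u 4 = 0" using u(1)[of 4] gr_large[of 4] by simp
    then have "K (u (Suc 3)) = 0" by (simp add: linear_0[OF linear_K])
    then have "(\<Sum>k\<le>3. K (u (Suc k))) = (\<Sum>k\<le>3. K (u k))"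
      using K_gr0[OF u(1)] by (simp add: numeral_3_eq_3)
    then show ?thesis by (simp add: a u(2) linear_sum[OF linear_K])
  qed
  ultimately show thesis by (rule that)
qed

end

section \<open>Dual bases of the cohomology and the transpose of \<open>\<iota>\<close>\<close>

locale frame_setting = induction_setting A \<iota> K
  for A :: "'c::real_vector dgfa" and \<iota> :: "'c set \<Rightarrow> 'c" and K :: "'c \<Rightarrow> 'c" +
  fixes L :: "'g::real_vector qlie" and R :: "('g, 'c) frame"
  assumes dim0: "coh_dim A 0 1" and dim3: "coh_dim A 3 1"
    and lie: "quadratic_lie_algebra L"
    and frame: "adapted_frame A L \<iota> K R"
begin

lemmas frame_axioms = frame[unfolded adapted_frame_def]

lemma orthonormal: "orthonormal_basis L (lie_dim R) (lie_basis R)"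
  using frame_axioms[THEN conjunct1] by blast

lemma basis1: "coh_basis A 1 (betti1 R) (coh1 R)"
  using frame_axioms[THEN conjunct2, THEN conjunct1] by blast

lemma basis2: "coh_basis A 2 (betti1 R) (coh2 R)"
  using frame_axioms[THEN conjunct2, THEN conjunct2, THEN conjunct1] by blast

lemma dual12: "i < betti1 R \<Longrightarrow> j < betti1 R \<Longrightarrow> coh_pair A \<iota> (coh1 R i) (coh2 R j) = (if i = j then 1 else 0)"
  using frame_axioms[THEN conjunct2, THEN conjunct2, THEN conjunct2, THEN conjunct1] by blast

lemma coh3: "coh3 R \<in> cohomology A 3"
  using frame_axioms[THEN conjunct_drop4, THEN conjunct1] by blast

lemma dual03: "coh_pair A \<iota> (coh_class A (unit A)) (coh3 R) = 1"
  using frame_axioms[THEN conjunct_drop4, THEN conjunct2, THEN conjunct1] by blast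

lemma kex_basis: "k \<le> 3 \<Longrightarrow> basis_of (range K \<inter> gr A k) (kex_dim R k) (kex R k)"
  using frame_axioms[THEN conjunct_drop4, THEN conjunct2, THEN conjunct2] by blast

abbreviation "b1 \<equiv> \<lambda>i. \<iota> (coh1 R i)"
abbreviation "b2 \<equiv> \<lambda>i. \<iota> (coh2 R i)"
abbreviation "b3 \<equiv> \<iota> (coh3 R)"

lemma coh1: "i < betti1 R \<Longrightarrow> coh1 R i \<in> cohomology A 1"
  and coh2: "i < betti1 R \<Longrightarrow> coh2 R i \<in> cohomology A 2"
  using basis1 basis2 by (auto simp: coh_basis_def)

lemma unit_class: "coh_class A (unit A) \<in> cohomology A 0"
  using unit_gr diff_unit by (auto simp: cohomology_def)

lemmas iota_unit' = iota_unit[OF diff_unit]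

lemma basis_gr: "i < betti1 R \<Longrightarrow> b1 i \<in> gr A 1" "i < betti1 R \<Longrightarrow> b2 i \<in> gr A 2" "b3 \<in> gr A 3"
  using iota_gr[OF coh1] iota_gr[OF coh2] iota_gr[OF coh3] by blast+

lemma basis_total: "i < betti1 R \<Longrightarrow> coh1 R i \<in> total_cohomology A"
  "i < betti1 R \<Longrightarrow> coh2 R i \<in> total_cohomology A" "coh3 R \<in> total_cohomology A"
  "coh_class A (unit A) \<in> total_cohomology A"
  by (auto intro: cohomology_total coh1 coh2 coh3 unit_class)

lemma basis_pairs:
  "pair A (unit A) b3 = 1" "pair A b3 (unit A) = 1"
  "i < betti1 R \<Longrightarrow> j < betti1 R \<Longrightarrow> pair A (b1 i) (b2 j) = (if i = j then 1 else 0)"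
  "i < betti1 R \<Longrightarrow> j < betti1 R \<Longrightarrow> pair A (b2 j) (b1 i) = (if i = j then 1 else 0)"
proof -
  show 1: "pair A (unit A) b3 = 1" using dual03 by (simp add: coh_pair_def iota_unit')
  show "pair A b3 (unit A) = 1" using pair_swap[OF basis_gr(3) unit_gr] 1 by simp
  show 2: "pair A (b1 i) (b2 j) = (if i = j then 1 else 0)" if "i < betti1 R" "j < betti1 R" for i j
    using dual12[OF that] by (simp add: coh_pair_def)
  show "pair A (b2 j) (b1 i) = (if i = j then 1 else 0)" if "i < betti1 R" "j < betti1 R" for i j
    using pair_swap[OF basis_gr(2)[OF that(2)] basis_gr(1)[OF that(1)]] 2[OF that] by simp
qed

lemma basis_pairs_0:
  "pair A (unit A) (unit A) = 0" "pair A b3 b3 = 0"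
  "i < betti1 R \<Longrightarrow> pair A (unit A) (b1 i) = 0" "i < betti1 R \<Longrightarrow> pair A (b1 i) (unit A) = 0"
  "i < betti1 R \<Longrightarrow> pair A (unit A) (b2 i) = 0" "i < betti1 R \<Longrightarrow> pair A (b2 i) (unit A) = 0"
  "i < betti1 R \<Longrightarrow> pair A b3 (b1 i) = 0" "i < betti1 R \<Longrightarrow> pair A (b1 i) b3 = 0"
  "i < betti1 R \<Longrightarrow> pair A b3 (b2 i) = 0" "i < betti1 R \<Longrightarrow> pair A (b2 i) b3 = 0"
  "i < betti1 R \<Longrightarrow> j < betti1 R \<Longrightarrow> pair A (b1 i) (b1 j) = 0"
  "i < betti1 R \<Longrightarrow> j < betti1 R \<Longrightarrow> pair A (b2 i) (b2 j) = 0"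
  by ((rule pair_eq_0[OF unit_gr unit_gr] pair_eq_0[OF basis_gr(3) basis_gr(3)]
      pair_eq_0[OF unit_gr basis_gr(1)] pair_eq_0[OF basis_gr(1) unit_gr]
      pair_eq_0[OF unit_gr basis_gr(2)] pair_eq_0[OF basis_gr(2) unit_gr]
      pair_eq_0[OF basis_gr(3) basis_gr(1)] pair_eq_0[OF basis_gr(1) basis_gr(3)]
      pair_eq_0[OF basis_gr(3) basis_gr(2)] pair_eq_0[OF basis_gr(2) basis_gr(3)]
      pair_eq_0[OF basis_gr(1) basis_gr(1)] pair_eq_0[OF basis_gr(2) basis_gr(2)]; simp)+)

text \<open>\<open>dim0\<close> and \<open>dim3\<close> enter here: with them the class of the unit
  and \<open>coh3\<close> span the outer degrees.\<close>

lemma iota_expand: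
  assumes "h \<in> total_cohomology A"
  obtains p q r s where "\<iota> h = p *\<^sub>R unit A + (\<Sum>i<betti1 R. q i *\<^sub>R b1 i) + (\<Sum>i<betti1 R. r i *\<^sub>R b2 i) + s *\<^sub>R b3"
proof -
  let ?z = "\<iota> h"
  obtain u where u: "\<And>k. u k \<in> gr A k" "?z = (\<Sum>k\<le>3. u k)" using gr_decompose[of ?z] by blast
  have du: "diff A (u k) = 0" for k
    by (rule cocycle_components) (use u diff_iota[OF assms] in auto)
  have "?z = (\<Sum>k\<le>3. \<iota> (coh_class A (u k)))"
    using iota_class_iota[OF assms] u(2) iota_class_sum[of "{..3}" u] du by simp
  then have z: "?z = \<iota> (coh_class A (u 0)) + \<iota> (coh_class A (u 1)) + \<iota> (coh_class A (u 2)) + \<iota> (coh_class A (u 3))"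
    by (simp add: numeral_3_eq_3 numeral_2_eq_2)
  have nz: "unit A \<noteq> 0" "b3 \<noteq> 0" using basis_pairs(1) by (auto simp: pair_left pair_right)
  obtain p where p: "\<iota> (coh_class A (u 0)) = p *\<^sub>R unit A"
    by (rule coh_dim_1_span[OF dim0 unit_class _ u(1) du]) (use nz iota_unit' in auto)
  obtain s where s: "\<iota> (coh_class A (u 3)) = s *\<^sub>R b3"
    by (rule coh_dim_1_span[OF dim3 coh3 nz(2) u(1) du])
  obtain q where q: "\<iota> (coh_class A (u 1)) = (\<Sum>i<betti1 R. q i *\<^sub>R b1 i)"
    by (rule coh_basis_span[OF basis1 u(1) du])
  obtain r where r: "\<iota> (coh_class A (u 2)) = (\<Sum>i<betti1 R. r i *\<^sub>R b2 i)"
    by (rule coh_basis_span[OF basis2 u(1) du])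
  show thesis by (rule that) (use z in \<open>simp only: p q r s\<close>)
qed

text \<open>\<open>iota_transpose\<close> is a definite description and says nothing before
  existence and uniqueness are known; the dual bases supply both.\<close>

lemma iota_transpose_total: "iota_transpose A \<iota> a \<in> total_cohomology A"
proof -
  let ?B = "{..<betti1 R}"
  \<comment> \<open>The orthogonal projection of \<open>a\<close>: each basis vector is weighted by
    the pairing of \<open>a\<close> with its dual vector.\<close>
  define v where "v = pair A a b3 *\<^sub>R unit A + (\<Sum>i\<in>?B. pair A a (b2 i) *\<^sub>R b1 i)
    + (\<Sum>i\<in>?B. pair A a (b1 i) *\<^sub>R b2 i) + pair A a (unit A) *\<^sub>R b3"
  have d: "diff A (b1 i) = 0" "diff A (b2 i) = 0" if "i \<in> ?B" for i
    using that basis_total diff_iota by auto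
  have d3: "diff A b3 = 0" using basis_total diff_iota by auto
  have dv: "diff A v = 0" by (simp add: v_def diff_simps d d3 diff_unit)
  have s: "\<iota> (coh_class A (\<Sum>i\<in>?B. c i *\<^sub>R b1 i)) = (\<Sum>i\<in>?B. c i *\<^sub>R b1 i)"
      "\<iota> (coh_class A (\<Sum>i\<in>?B. c i *\<^sub>R b2 i)) = (\<Sum>i\<in>?B. c i *\<^sub>R b2 i)" for c
    by (subst iota_class_sum; simp add: diff_simps d iota_class_scale class_iota basis_total)+
  have jv: "\<iota> (coh_class A v) = v"
    unfolding v_def
    using d d3 diff_unit basis_total
    by (simp add: iota_class_add iota_class_scale s diff_simps class_iota iota_unit')
  have pv: "pair A v (unit A) = pair A a (unit A)" "pair A v b3 = pair A a b3"
      "i < betti1 R \<Longrightarrow> pair A v (b1 i) = pair A a (b1 i)"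
      "i < betti1 R \<Longrightarrow> pair A v (b2 i) = pair A a (b2 i)" for i
    by (simp_all add: v_def pair_left basis_pairs basis_pairs_0 if_distrib[of "\<lambda>x. _ * x"] cong: if_cong)
  have ex: "pair A v (\<iota> g) = pair A a (\<iota> g)" if g: "g \<in> total_cohomology A" for g
    by (rule iota_expand[OF g]) (simp add: pair_right pv)
  have uniq: "h = h'" if h: "h \<in> total_cohomology A" "h' \<in> total_cohomology A"
    and eq: "\<And>g. g \<in> total_cohomology A \<Longrightarrow> pair A (\<iota> h) (\<iota> g) = pair A (\<iota> h') (\<iota> g)" for h h'
  proof -
    obtain p q r s where h1: "\<iota> h = p *\<^sub>R unit A + (\<Sum>i<betti1 R. q i *\<^sub>R b1 i) + (\<Sum>i<betti1 R. r i *\<^sub>R b2 i) + s *\<^sub>R b3"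
      by (rule iota_expand[OF h(1)])
    obtain p' q' r' s' where h2: "\<iota> h' = p' *\<^sub>R unit A + (\<Sum>i<betti1 R. q' i *\<^sub>R b1 i) + (\<Sum>i<betti1 R. r' i *\<^sub>R b2 i) + s' *\<^sub>R b3"
      by (rule iota_expand[OF h(2)])
    note eq' = eq[unfolded h1 h2]
    have "p = p'" using eq'[OF basis_total(3)] by (simp add: pair_left basis_pairs basis_pairs_0)
    moreover have "s = s'" using eq'[OF basis_total(4)] by (simp add: pair_left basis_pairs basis_pairs_0 iota_unit')
    moreover have "q i = q' i" if i: "i < betti1 R" for i
      using eq'[OF basis_total(2)[OF i]] i
      by (simp add: pair_left basis_pairs basis_pairs_0 if_distrib[of "\<lambda>x. _ * x"] cong: if_cong)
    moreover have "r i = r' i" if i: "i < betti1 R" for i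
      using eq'[OF basis_total(1)[OF i]] i
      by (simp add: pair_left basis_pairs basis_pairs_0 if_distrib[of "\<lambda>x. _ * x"] cong: if_cong)
    ultimately have "\<iota> h = \<iota> h'" unfolding h1 h2 by simp
    then show ?thesis by (metis class_iota h)
  qed
  have "\<exists>!h. h \<in> total_cohomology A \<and> (\<forall>g\<in>total_cohomology A. coh_pair A \<iota> h g = pair A a (\<iota> g))"
  proof (rule ex1I[of _ "coh_class A v"])
    show "coh_class A v \<in> total_cohomology A \<and> (\<forall>g\<in>total_cohomology A. coh_pair A \<iota> (coh_class A v) g = pair A a (\<iota> g))"
      using dv jv ex by (auto simp: coh_pair_def intro: total_class)
    fix h assume h: "h \<in> total_cohomology A \<and> (\<forall>g\<in>total_cohomology A. coh_pair A \<iota> h g = pair A a (\<iota> g))"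
    show "h = coh_class A v"
      by (rule uniq) (use h dv jv ex in \<open>auto simp: coh_pair_def intro: total_class\<close>)
  qed
  from theI'[OF this] show ?thesis by (simp add: iota_transpose_def)
qed

text \<open>The homotopy identity splits any \<open>b\<close> into parts in \<open>d (im K)\<close>,
  \<open>im K\<close> and \<open>im \<iota>\<close>, and \<open>x\<close> is orthogonal to the last
  two. This makes the free action nondegenerate on the fiber.\<close>

lemma range_K_nondegenerate:
  assumes "x \<in> range K" "\<And>y. y \<in> range K \<Longrightarrow> pair A x (diff A y) = 0"
  shows "x = 0"
proof (rule pair_nondegenerate)
  fix b
  obtain a where a: "x = K a" using assms(1) by auto
  have b: "b = diff A (K b) + K (diff A b) + \<iota> (iota_transpose A \<iota> b)"
    using homotopy[of b] by (simp add: algebra_simps)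
  have "pair A x (K (diff A b)) = 0" "pair A x (\<iota> (iota_transpose A \<iota> b)) = 0"
    unfolding a by (auto intro!: pair_K_eq_0 K_iota iota_transpose_total)
  then show "pair A x b = 0"
    by (subst b) (simp add: pair_right assms(2))
qed

end

subsection \<open>Inverse matrices\<close>

lemma family_independent:
  fixes E :: "'j \<Rightarrow> 'c::real_vector"
  assumes "finite J" and indep: "\<And>c. (\<Sum>j\<in>J. c j *\<^sub>R E j) = 0 \<Longrightarrow> \<forall>j\<in>J. c j = 0"
  shows "inj_on E J" "independent (E ` J)"
proof -
  show inj: "inj_on E J"
  proof (rule inj_onI, rule ccontr)
    fix i j assume ij: "i \<in> J" "j \<in> J" "E i = E j" "i \<noteq> j"
    let ?c = "\<lambda>k. (if k = i then 1 else 0) - (if k = j then 1 else 0 :: real)"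
    have "(\<Sum>k\<in>J. ?c k *\<^sub>R E k) = (\<Sum>k\<in>J. (if k = i then E k else 0)) - (\<Sum>k\<in>J. (if k = j then E k else 0))"
      unfolding sum_subtractf[symmetric] by (rule sum.cong) auto
    also have "\<dots> = 0" using ij assms(1) by simp
    finally have "\<forall>k\<in>J. ?c k = 0" by (rule indep)
    with ij show False by auto
  qed
  show "independent (E ` J)"
  proof (rule independent_if_scalars_zero)
    fix f x assume f: "(\<Sum>x\<in>E ` J. f x *\<^sub>R x) = 0" and x: "x \<in> E ` J"
    have "(\<Sum>j\<in>J. f (E j) *\<^sub>R E j) = 0" using f by (simp add: sum.reindex[OF inj] o_def)
    then have "\<forall>j\<in>J. f (E j) = 0" by (rule indep)
    with x show "f x = 0" by auto
  qed (use assms(1) in simp)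
qed

lemma span_family:
  fixes E :: "'j \<Rightarrow> 'c::real_vector"
  assumes "finite J" "inj_on E J" "v \<in> span (E ` J)"
  obtains c where "v = (\<Sum>j\<in>J. c j *\<^sub>R E j)"
proof -
  obtain u where "v = (\<Sum>x\<in>E ` J. u x *\<^sub>R x)"
    using assms(1,3) by (auto simp: span_finite)
  then have "v = (\<Sum>j\<in>J. u (E j) *\<^sub>R E j)" by (simp add: sum.reindex[OF assms(2)] o_def)
  then show thesis by (rule that)
qed

text \<open>The rows of \<open>\<beta>\<close>, read in the independent family \<open>E\<close>,
  become vectors \<open>\<psi>\<close>. The trivial kernel makes these independent, so by counting
  they span all of \<open>E\<close>, and the expansion of \<open>E i\<close> in them is row
  \<open>i\<close> of the inverse.\<close>

lemma left_inverse_exists: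
  fixes E :: "'j \<Rightarrow> 'c::real_vector" and \<beta> :: "'j \<Rightarrow> 'j \<Rightarrow> real"
  assumes fin: "finite J" and indep: "\<And>c. (\<Sum>j\<in>J. c j *\<^sub>R E j) = 0 \<Longrightarrow> \<forall>j\<in>J. c j = 0"
    and ker: "\<And>c. (\<forall>m\<in>J. (\<Sum>l\<in>J. c l * \<beta> l m) = 0) \<Longrightarrow> \<forall>l\<in>J. c l = 0"
  shows "\<exists>\<gamma>. \<forall>i\<in>J. \<forall>m\<in>J. (\<Sum>l\<in>J. \<gamma> i l * \<beta> l m) = (if i = m then 1 else 0)"
proof -
  define \<psi> where "\<psi> l = (\<Sum>m\<in>J. \<beta> l m *\<^sub>R E m)" for l
  have \<psi>_sum: "(\<Sum>l\<in>J. c l *\<^sub>R \<psi> l) = (\<Sum>m\<in>J. (\<Sum>l\<in>J. c l * \<beta> l m) *\<^sub>R E m)" for c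
    unfolding \<psi>_def scaleR_sum_right scaleR_sum_left by (subst sum.swap) simp
  have \<psi>_indep: "\<forall>l\<in>J. c l = 0" if "(\<Sum>l\<in>J. c l *\<^sub>R \<psi> l) = 0" for c
  proof (rule ker)
    show "\<forall>m\<in>J. (\<Sum>l\<in>J. c l * \<beta> l m) = 0"
      using that unfolding \<psi>_sum by (rule indep[of "\<lambda>m. \<Sum>l\<in>J. c l * \<beta> l m"])
  qed
  note E = family_independent[OF fin indep] and \<psi> = family_independent[OF fin \<psi>_indep]
  have sub: "\<psi> ` J \<subseteq> span (E ` J)"
  proof (rule image_subsetI)
    fix l assume "l \<in> J"
    show "\<psi> l \<in> span (E ` J)" unfolding \<psi>_def
      by (intro span_sum span_scale span_base imageI)
  qed
  have in_span: "E i \<in> span (\<psi> ` J)" if i: "i \<in> J" for i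
  proof (rule ccontr)
    assume n: "E i \<notin> span (\<psi> ` J)"
    have nm: "E i \<notin> \<psi> ` J" using n span_base[of "E i" "\<psi> ` J"] by argo
    then have "independent (insert (E i) (\<psi> ` J))" using n \<psi>(2) by (simp add: independent_insert)
    moreover have "insert (E i) (\<psi> ` J) \<subseteq> span (E ` J)" using sub i by (simp add: span_base)
    ultimately have "card (insert (E i) (\<psi> ` J)) \<le> card (E ` J)"
      using independent_span_bound[of "E ` J" "insert (E i) (\<psi> ` J)"] finite_imageI[OF fin, of E] by argo
    then show False
      using nm fin by (simp add: card_image E(1) \<psi>(1))
  qed
  have "\<exists>g. \<forall>m\<in>J. (\<Sum>l\<in>J. g l * \<beta> l m) = (if i = m then 1 else 0)" if i: "i \<in> J" for i
  proof -
    obtain g where g: "E i = (\<Sum>l\<in>J. g l *\<^sub>R \<psi> l)"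
      by (rule span_family[OF fin \<psi>(1) in_span[OF i]])
    have "E i = (\<Sum>m\<in>J. if m = i then E m else 0)" using i fin by simp
    also have "\<dots> = (\<Sum>m\<in>J. (if i = m then 1 else 0) *\<^sub>R E m)" by (rule sum.cong) auto
    finally have "(\<Sum>m\<in>J. ((\<Sum>l\<in>J. g l * \<beta> l m) - (if i = m then 1 else 0)) *\<^sub>R E m) = 0"
      using g unfolding \<psi>_sum by (simp add: scaleR_diff_left sum_subtractf)
    then have "\<forall>m\<in>J. (\<Sum>l\<in>J. g l * \<beta> l m) - (if i = m then 1 else 0) = 0"
      by (rule indep[of "\<lambda>m. (\<Sum>l\<in>J. g l * \<beta> l m) - (if i = m then 1 else 0)"])
    then show ?thesis by (intro exI[of _ g]) auto
  qed
  then show ?thesis by metis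
qed

text \<open>A left inverse of a square matrix with trivial left kernel is unique and two-sided, so it
  inherits the grading and the symmetry of the matrix.\<close>

locale hessian_inverse =
  fixes \<Phi> :: "coord set" and q :: superseries and G :: "coord \<Rightarrow> coord \<Rightarrow> real"
  assumes fin: "finite \<Phi>"
    and ker: "\<And>c. (\<forall>z\<in>\<Phi>. (\<Sum>y\<in>\<Phi>. c y * hessian q y z) = 0) \<Longrightarrow> \<forall>y\<in>\<Phi>. c y = 0"
    and supp: "\<And>x y. x \<notin> \<Phi> \<or> y \<notin> \<Phi> \<Longrightarrow> G x y = 0"
    and inv: "\<And>x z. x \<in> \<Phi> \<Longrightarrow> z \<in> \<Phi> \<Longrightarrow> (\<Sum>y\<in>\<Phi>. G x y * hessian q y z) = (if x = z then -1 else 0)"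
    and ghost: "\<And>x y. x \<in> \<Phi> \<Longrightarrow> y \<in> \<Phi> \<Longrightarrow> hessian q x y \<noteq> 0 \<Longrightarrow> ghost x + ghost y = 0"
    and sym: "\<And>x y. x \<in> \<Phi> \<Longrightarrow> y \<in> \<Phi> \<Longrightarrow>
      hessian q y x = (if odd (ghost x) \<and> odd (ghost y) then -1 else 1) * hessian q x y"
begin

lemma unique:
  assumes "\<And>x y. x \<notin> \<Phi> \<or> y \<notin> \<Phi> \<Longrightarrow> G' x y = 0"
    and "\<And>x z. x \<in> \<Phi> \<Longrightarrow> z \<in> \<Phi> \<Longrightarrow> (\<Sum>y\<in>\<Phi>. G' x y * hessian q y z) = (if x = z then -1 else 0)"
  shows "G' = G"
proof (intro ext)
  fix x y
  show "G' x y = G x y"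
  proof (cases "x \<in> \<Phi> \<and> y \<in> \<Phi>")
    case True
    have "\<forall>y\<in>\<Phi>. G' x y - G x y = 0"
      by (rule ker) (use True assms(2) inv in \<open>simp add: left_diff_distrib sum_subtractf\<close>)
    with True show ?thesis by simp
  qed (use assms(1) supp in metis)
qed

lemma propagator_eq: "propagator \<Phi> q = G"
  unfolding propagator_def
  by (rule the_equality) (use supp inv in blast, rule unique, blast+)

text \<open>With \<open>Q\<close> the Hessian, \<open>G Q = -1\<close> gives
  \<open>(Q G + 1) Q = 0\<close>, and \<open>Q\<close> has no left kernel.\<close>

lemma right_inverse:
  assumes "x \<in> \<Phi>" "z \<in> \<Phi>"
  shows "(\<Sum>y\<in>\<Phi>. hessian q x y * G y z) = (if x = z then -1 else 0)"
proof -
  let ?c = "\<lambda>z. (\<Sum>y\<in>\<Phi>. hessian q x y * G y z) + (if x = z then 1 else 0)"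
  have "\<forall>z\<in>\<Phi>. ?c z = 0"
  proof (rule ker, intro ballI)
    fix w assume w: "w \<in> \<Phi>"
    have "(\<Sum>z\<in>\<Phi>. (\<Sum>y\<in>\<Phi>. hessian q x y * G y z) * hessian q z w) =
        (\<Sum>y\<in>\<Phi>. hessian q x y * (\<Sum>z\<in>\<Phi>. G y z * hessian q z w))"
      unfolding sum_distrib_left sum_distrib_right by (subst sum.swap) (simp add: mult.assoc)
    also have "\<dots> = (\<Sum>y\<in>\<Phi>. if y = w then - hessian q x y else 0)"
      by (rule sum.cong) (auto simp: inv w)
    also have "\<dots> = - hessian q x w" using fin w by simp
    finally have "(\<Sum>z\<in>\<Phi>. (\<Sum>y\<in>\<Phi>. hessian q x y * G y z) * hessian q z w) = - hessian q x w" .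
    moreover have "(\<Sum>z\<in>\<Phi>. (if x = z then 1 else 0) * hessian q z w) = hessian q x w"
    proof -
      have "(\<Sum>z\<in>\<Phi>. (if x = z then 1 else 0) * hessian q z w) = (\<Sum>z\<in>\<Phi>. if x = z then hessian q z w else 0)"
        by (rule sum.cong) auto
      then show ?thesis using fin assms(1) by simp
    qed
    ultimately show "(\<Sum>z\<in>\<Phi>. ?c z * hessian q z w) = 0"
      by (simp add: distrib_right sum.distrib)
  qed
  with assms(2) show ?thesis by (auto split: if_splits)
qed

text \<open>Dropping the entries of nonzero total ghost number leaves a left inverse, because the
  Hessian has only entries of total ghost number zero; uniqueness does the rest.\<close>

lemma G_ghost: "G x y \<noteq> 0 \<Longrightarrow> ghost x + ghost y = 0"
proof -
  define G' where "G' x y = (if ghost x + ghost y = 0 then G x y else 0)" for x y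
  have "G' = G"
  proof (rule unique)
    fix x z assume xz: "x \<in> \<Phi>" "z \<in> \<Phi>"
    show "(\<Sum>y\<in>\<Phi>. G' x y * hessian q y z) = (if x = z then -1 else 0)"
    proof (cases "ghost x = ghost z")
      case True
      have "(\<Sum>y\<in>\<Phi>. G' x y * hessian q y z) = (\<Sum>y\<in>\<Phi>. G x y * hessian q y z)"
      proof (rule sum.cong[OF refl])
        fix y assume "y \<in> \<Phi>"
        then show "G' x y * hessian q y z = G x y * hessian q y z"
          using ghost[of y z] xz(2) True by (cases "hessian q y z = 0") (auto simp: G'_def)
      qed
      then show ?thesis using inv xz by simp
    next
      case False
      have "G' x y * hessian q y z = 0" if "y \<in> \<Phi>" for y
        using ghost[of y z] that xz(2) False by (auto simp: G'_def)
      then have "(\<Sum>y\<in>\<Phi>. G' x y * hessian q y z) = 0" by (intro sum.neutral) blast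
      then show ?thesis using False by auto
    qed
  qed (use supp in \<open>auto simp: G'_def\<close>)
  from fun_cong[OF fun_cong[OF this, of x], of y]
  show "G x y \<noteq> 0 \<Longrightarrow> ghost x + ghost y = 0"
    by (auto simp: G'_def split: if_splits)
qed

text \<open>The graded transpose of \<open>G\<close> is again a left inverse, by
  \<open>right_inverse\<close> and the symmetry of the Hessian.\<close>

lemma G_sym: "G y x = (if odd (ghost x) \<and> odd (ghost y) then -1 else 1) * G x y"
proof -
  define s where "s x y = (if odd (ghost x) \<and> odd (ghost y) then -1 else 1 :: real)" for x y
  define G' where "G' x y = s x y * G y x" for x y
  have "G' = G"
  proof (rule unique)
    fix x z assume xz: "x \<in> \<Phi>" "z \<in> \<Phi>"
    have "(\<Sum>y\<in>\<Phi>. G' x y * hessian q y z) = (\<Sum>y\<in>\<Phi>. hessian q z y * G y x)"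
    proof (rule sum.cong[OF refl])
      fix y assume y: "y \<in> \<Phi>"
      show "G' x y * hessian q y z = hessian q z y * G y x"
      proof (cases "hessian q y z = 0 \<or> G y x = 0")
        case True
        then show ?thesis using sym[OF y xz(2)] by (auto simp: G'_def)
      next
        case False
        then have "ghost y + ghost z = 0" "ghost y + ghost x = 0"
          using ghost[OF y xz(2)] G_ghost by auto
        then have p: "odd (ghost x) = odd (ghost y)" "odd (ghost z) = odd (ghost y)" by presburger+
        show ?thesis using sym[OF y xz(2)] by (simp add: G'_def s_def p)
      qed
    qed
    then show "(\<Sum>y\<in>\<Phi>. G' x y * hessian q y z) = (if x = z then -1 else 0)"
      using right_inverse[OF xz(2,1)] by auto
  qed (use supp in \<open>auto simp: G'_def\<close>)
  from fun_cong[OF fun_cong[OF this, of x], of y] show ?thesis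
    by (auto simp: G'_def s_def split: if_splits)
qed

end

section \<open>The fiber and its propagator\<close>

fun lie_index :: "coord \<Rightarrow> nat" where
  "lie_index (A0 a) = a"
| "lie_index (A1 i a) = a"
| "lie_index (A2 i a) = a"
| "lie_index (A3 a) = a"
| "lie_index (Fl k I a) = a"

text \<open>Varying \<open>b\<close> runs through the coordinates that the adjoint action mixes with
  \<open>x\<close>.\<close>

fun with_index :: "coord \<Rightarrow> nat \<Rightarrow> coord" where
  "with_index (A0 a) b = A0 b"
| "with_index (A1 i a) b = A1 i b"
| "with_index (A2 i a) b = A2 i b"
| "with_index (A3 a) b = A3 b"
| "with_index (Fl k I a) b = Fl k I b"

fun form_degree :: "coord \<Rightarrow> nat" where
  "form_degree (A0 a) = 0"
| "form_degree (A1 i a) = 1"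
| "form_degree (A2 i a) = 2"
| "form_degree (A3 a) = 3"
| "form_degree (Fl k I a) = k"

lemma with_index_simps [simp]:
  "lie_index (with_index x b) = b" "with_index (with_index x b) c = with_index x c"
  "with_index x (lie_index x) = x" "form_degree (with_index x b) = form_degree x"
  "ghost (with_index x b) = ghost x"
  by (cases x; simp)+

lemma ghost_form_degree: "ghost x = 1 - int (form_degree x)"
  by (cases x) auto

lemma sum_list_concat: "sum_list (concat xss) = sum_list (map sum_list (xss :: superseries list list))"
  by (induction xss) auto

lemma distinct_concat_map:
  "distinct xs \<Longrightarrow> (\<And>x. x \<in> set xs \<Longrightarrow> distinct (f x)) \<Longrightarrow>
   (\<And>x y. x \<in> set xs \<Longrightarrow> y \<in> set xs \<Longrightarrow> x \<noteq> y \<Longrightarrow> set (f x) \<inter> set (f y) = {}) \<Longrightarrow>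
   distinct (concat (map f xs))"
  by (induction xs) auto

context frame_setting
begin

abbreviation "\<Phi> \<equiv> fiber_coords R"
abbreviation "\<B> \<equiv> base_coords R"
abbreviation "N \<equiv> lie_dim R"
abbreviation "T \<equiv> lie_basis R"

fun elt :: "coord \<Rightarrow> 'c" where
  "elt (A0 a) = \<iota> (coh_class A (unit A))"
| "elt (A1 i a) = b1 i"
| "elt (A2 i a) = b2 i"
| "elt (A3 a) = b3"
| "elt (Fl k I a) = kex R k I"

lemma elt_with_index [simp]: "elt (with_index x b) = elt x"
  by (cases x) auto

definition entry :: "coord \<Rightarrow> 'g \<times> 'c \<times> nat \<times> superseries \<times> int" where
  "entry x = (T (lie_index x), elt x, form_degree x, var x, ghost x)"

definition base_list :: "coord list" where
  "base_list = [A0 a. a \<leftarrow> [0..<N]] @ [A1 i a. i \<leftarrow> [0..<betti1 R], a \<leftarrow> [0..<N]]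
    @ [A2 i a. i \<leftarrow> [0..<betti1 R], a \<leftarrow> [0..<N]] @ [A3 a. a \<leftarrow> [0..<N]]"

definition fiber_list :: "coord list" where
  "fiber_list = [Fl k I a. k \<leftarrow> [0..<4], I \<leftarrow> [0..<kex_dim R k], a \<leftarrow> [0..<N]]"

lemma iota_alpha_eq: "iota_alpha A \<iota> R = map entry base_list"
  by (simp add: iota_alpha_def base_list_def entry_def map_concat o_def)

lemma omega_fiber_eq: "omega_fiber R = map entry fiber_list"
  by (simp add: omega_fiber_def fiber_list_def entry_def map_concat o_def)

lemma set_base_list: "set base_list = \<B>"
  by (auto simp: base_list_def base_coords_def)

lemma set_fiber_list: "set fiber_list = \<Phi>"
  by (auto simp: fiber_list_def fiber_coords_def image_iff)

lemma distinct_base_list: "distinct base_list"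
  unfolding base_list_def
  by (auto simp: distinct_map inj_on_def intro!: distinct_concat_map)

lemma distinct_fiber_list: "distinct fiber_list"
  unfolding fiber_list_def
  by (intro distinct_concat_map) (auto simp: distinct_map inj_on_def)

lemma base_fiber_disjoint: "\<B> \<inter> \<Phi> = {}"
  by (auto simp: base_coords_def fiber_coords_def)

lemma finite_base: "finite \<B>" and finite_fiber: "finite \<Phi>"
  by (simp_all flip: set_base_list set_fiber_list)

lemma orthonormal_form: "a < N \<Longrightarrow> b < N \<Longrightarrow> form L (T a) (T b) = (if a = b then 1 else 0)"
  using orthonormal by (auto simp: orthonormal_basis_def)

definition free_coeff :: "coord \<Rightarrow> coord \<Rightarrow> real" where
  "free_coeff x y = koszul (ghost x) (Suc (form_degree y)) * form L (T (lie_index x)) (T (lie_index y))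
     * pair A (elt x) (diff A (elt y))"

lemma tpair_tdiff:
  assumes "distinct xs" "distinct ys"
  shows "tpair A L (map entry xs) (tdiff A (map entry ys)) =
    (\<Sum>x\<in>set xs. \<Sum>y\<in>set ys. free_coeff x y *\<^sub>R (var x * var y))"
  by (simp add: tpair_def tdiff_def entry_def o_def map_concat sum_list_concat
      sum_list_distinct_conv_sum_set[OF assms(1)] sum_list_distinct_conv_sum_set[OF assms(2)] free_coeff_def)

definition cubic_coeff :: "coord \<Rightarrow> coord \<Rightarrow> coord \<Rightarrow> real" where
  "cubic_coeff x y z = koszul (ghost x) (form_degree y + form_degree z) * koszul (ghost y) (form_degree z)
     * form L (T (lie_index x)) (br L (T (lie_index y)) (T (lie_index z)))
     * pair A (elt x) (mul A (elt y) (elt z)) / 6"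

lemma cubic_action_entries:
  assumes "distinct xs"
  shows "cubic_action A L (map entry xs) =
    (\<Sum>x\<in>set xs. \<Sum>y\<in>set xs. \<Sum>z\<in>set xs. cubic_coeff x y z *\<^sub>R (var x * (var y * var z)))"
  by (simp add: cubic_action_def tpair_def tbracket_def entry_def o_def map_concat sum_list_concat
      sum_list_distinct_conv_sum_set[OF assms] cubic_coeff_def scaleR_sum_right mult_ac)

lemma kex_mem: "k \<le> 3 \<Longrightarrow> I < kex_dim R k \<Longrightarrow> kex R k I \<in> range K \<inter> gr A k"
proof -
  assume k: "k \<le> 3" and I: "I < kex_dim R k"
  have "kex R k I \<in> span (kex R k ` {..<kex_dim R k})" using I by (intro span_base) auto
  then show ?thesis using kex_basis[OF k] by (simp add: basis_of_def)
qed

lemma elt_fiber: "x \<in> \<Phi> \<Longrightarrow> elt x \<in> range K \<inter> gr A (form_degree x)"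
proof -
  assume "x \<in> \<Phi>"
  then obtain k I a where "x = Fl k I a" "k < 4" "I < kex_dim R k" by (auto simp: fiber_coords_def)
  then show ?thesis using kex_mem[of k I] by simp
qed

lemma elt_base: "x \<in> \<B> \<Longrightarrow> elt x \<in> \<iota> ` total_cohomology A \<and> elt x \<in> gr A (form_degree x)"
  unfolding base_coords_def
  using basis_total basis_gr iota_gr[OF unit_class] by auto

lemma elt_gr: "x \<in> \<B> \<union> \<Phi> \<Longrightarrow> elt x \<in> gr A (form_degree x)"
  using elt_base elt_fiber by blast

section \<open>The pairing with \<open>d\<close> on \<open>im K\<close> and its inverse\<close>

definition J :: "(nat \<times> nat) set" where
  "J = (SIGMA k:{..<4}. {..<kex_dim R k})"

abbreviation "E \<equiv> \<lambda>j. kex R (fst j) (snd j)"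

lemma finite_J: "finite J"
  by (simp add: J_def)

lemma kex_independent:
  assumes "(\<Sum>j\<in>J. c j *\<^sub>R E j) = 0"
  shows "\<forall>j\<in>J. c j = 0"
proof -
  define u where "u k = (if k < 4 then \<Sum>I<kex_dim R k. c (k, I) *\<^sub>R kex R k I else 0)" for k
  have u: "u k \<in> gr A k" for k
    unfolding u_def using kex_mem[of k] subspace_gr[of k]
    by (auto intro!: subspace_sum subspace_scale gr_0)
  have "(\<Sum>k\<le>3. u k) = (\<Sum>k<4. \<Sum>I<kex_dim R k. c (k, I) *\<^sub>R kex R k I)"
    unfolding u_def by (rule sum.cong) auto
  also have "\<dots> = 0" using assms by (simp add: J_def sum.Sigma case_prod_beta)
  finally have u0: "u k = 0" for k using gr_sum_eq_0[of u k] u by simp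
  show ?thesis
  proof
    fix j assume "j \<in> J"
    then obtain k I where j: "j = (k, I)" "k < 4" "I < kex_dim R k" by (auto simp: J_def)
    let ?f = "kex R k" and ?S = "{..<kex_dim R k}"
    have b: "inj_on ?f ?S" "independent (?f ` ?S)"
      using kex_basis[of k] j(2) by (auto simp: basis_of_def)
    have "(\<Sum>v\<in>?f ` ?S. c (k, the_inv_into ?S ?f v) *\<^sub>R v) = u k"
      using j(2) by (simp add: u_def sum.reindex[OF b(1)] the_inv_into_f_f[OF b(1)])
    then have "c (k, the_inv_into ?S ?f (?f I)) = 0"
      using independentD[OF b(2), of "?f ` ?S" "\<lambda>v. c (k, the_inv_into ?S ?f v)" "?f I"] j(3) u0 by simp
    then show "c j = 0" using the_inv_into_f_f[OF b(1), of I] j by simp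
  qed
qed

lemma kex_spans:
  assumes "x \<in> range K"
  obtains c where "x = (\<Sum>j\<in>J. c j *\<^sub>R E j)"
proof -
  obtain u where u: "\<And>k. u k \<in> range K \<inter> gr A k" "x = (\<Sum>k\<le>3. u k)"
    by (rule range_K_decompose[OF assms]) blast
  have "\<exists>c. u k = (\<Sum>I<kex_dim R k. c I *\<^sub>R kex R k I)" if "k \<le> 3" for k
  proof -
    have b: "inj_on (kex R k) {..<kex_dim R k}" "u k \<in> span (kex R k ` {..<kex_dim R k})"
      using kex_basis[OF that] u(1)[of k] by (auto simp: basis_of_def)
    show ?thesis by (rule span_family[OF _ b]) auto
  qed
  then obtain c where c: "\<And>k. k \<le> 3 \<Longrightarrow> u k = (\<Sum>I<kex_dim R k. c k I *\<^sub>R kex R k I)" by metis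
  have "x = (\<Sum>k<4. \<Sum>I<kex_dim R k. c k I *\<^sub>R kex R k I)"
    unfolding u(2) by (rule sum.cong) (auto simp: c)
  also have "\<dots> = (\<Sum>j\<in>J. c (fst j) (snd j) *\<^sub>R E j)"
    by (simp add: J_def sum.Sigma case_prod_beta)
  finally show thesis by (rule that[of "\<lambda>j. c (fst j) (snd j)"])
qed

lemma kex_kernel:
  assumes "\<forall>m\<in>J. (\<Sum>l\<in>J. c l * pair A (E l) (diff A (E m))) = 0"
  shows "\<forall>l\<in>J. c l = 0"
proof (rule kex_independent, rule range_K_nondegenerate)
  have "E l \<in> range K" if "l \<in> J" for l using that kex_mem by (auto simp: J_def)
  then show "(\<Sum>l\<in>J. c l *\<^sub>R E l) \<in> range K"
    using linear_subspace_image[OF linear_K subspace_UNIV] by (intro subspace_sum subspace_scale) auto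
  fix y assume "y \<in> range K"
  then obtain e where y: "y = (\<Sum>m\<in>J. e m *\<^sub>R E m)" by (rule kex_spans)
  have "pair A (\<Sum>l\<in>J. c l *\<^sub>R E l) (diff A (E m)) = 0" if "m \<in> J" for m
    using assms that by (simp add: pair_left)
  then show "pair A (\<Sum>l\<in>J. c l *\<^sub>R E l) (diff A y) = 0"
    by (simp add: y diff_simps pair_right)
qed

definition \<gamma> :: "nat \<times> nat \<Rightarrow> nat \<times> nat \<Rightarrow> real" where
  "\<gamma> = (SOME \<gamma>. \<forall>i\<in>J. \<forall>m\<in>J. (\<Sum>l\<in>J. \<gamma> i l * pair A (E l) (diff A (E m))) = (if i = m then 1 else 0))"

lemma \<gamma>_inverse: "i \<in> J \<Longrightarrow> m \<in> J \<Longrightarrow> (\<Sum>l\<in>J. \<gamma> i l * pair A (E l) (diff A (E m))) = (if i = m then 1 else 0)"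
proof -
  assume im: "i \<in> J" "m \<in> J"
  have "\<exists>\<gamma>. \<forall>i\<in>J. \<forall>m\<in>J. (\<Sum>l\<in>J. \<gamma> i l * pair A (E l) (diff A (E m))) = (if i = m then 1 else 0)"
  proof (rule left_inverse_exists[OF finite_J])
    fix c assume "(\<Sum>j\<in>J. c j *\<^sub>R E j) = 0"
    then show "\<forall>j\<in>J. c j = 0" by (rule kex_independent)
  next
    fix c assume "\<forall>m\<in>J. (\<Sum>l\<in>J. c l * pair A (E l) (diff A (E m))) = 0"
    then show "\<forall>l\<in>J. c l = 0" by (rule kex_kernel)
  qed
  from someI_ex[OF this] show ?thesis using im unfolding \<gamma>_def[symmetric] by simp
qed

fun fiber_index :: "coord \<Rightarrow> nat \<times> nat" where
  "fiber_index (Fl k I a) = (k, I)"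
| "fiber_index _ = (0, 0)"

lemma sum_fiber: "(\<Sum>y\<in>\<Phi>. h y) = (\<Sum>j\<in>J. \<Sum>a<N. (h (Fl (fst j) (snd j) a) :: real))"
proof -
  have "(\<Sum>y\<in>\<Phi>. h y) = (\<Sum>p\<in>J \<times> {..<N}. h (Fl (fst (fst p)) (snd (fst p)) (snd p)))"
    by (rule sum.reindex_bij_witness[of _ "\<lambda>p. Fl (fst (fst p)) (snd (fst p)) (snd p)"
          "\<lambda>y. (fiber_index y, lie_index y)"])
      (auto simp: fiber_coords_def J_def)
  then show ?thesis by (simp add: sum.cartesian_product case_prod_beta)
qed

text \<open>The Koszul sign of the free action. It depends on one coordinate alone because the
  degrees add up to 2 wherever the pairing with \<open>d\<close> is nonzero.\<close>

definition fiber_sign :: "coord \<Rightarrow> real" where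
  "fiber_sign y = (if even (form_degree y) then -1 else 1)"

text \<open>The identity in the Lie algebra index times the inverse of the pairing on
  \<open>im K\<close>; the sign undoes the Koszul sign, and the minus comes from the normalization
  \<open>G Q = -1\<close>.\<close>

definition fiber_prop :: "coord \<Rightarrow> coord \<Rightarrow> real" where
  "fiber_prop x y = (if x \<in> \<Phi> \<and> y \<in> \<Phi> \<and> lie_index x = lie_index y
     then - (\<gamma> (fiber_index x) (fiber_index y) * fiber_sign y) else 0)"

lemma pair_diff_degree:
  assumes "x \<in> \<Phi>" "y \<in> \<Phi>" "pair A (elt x) (diff A (elt y)) \<noteq> 0"
  shows "form_degree x + form_degree y = 2"
  using pair_degree[of "elt x" "form_degree x" "diff A (elt y)" "Suc (form_degree y)"] assms
    elt_fiber diff_gr by auto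

lemma lie_index_bound: "x \<in> \<B> \<union> \<Phi> \<Longrightarrow> lie_index x < N"
  by (auto simp: base_coords_def fiber_coords_def)

lemma free_coeff_fiber:
  assumes "x \<in> \<Phi>" "y \<in> \<Phi>"
  shows "free_coeff x y = (if lie_index x = lie_index y
    then fiber_sign x * pair A (elt x) (diff A (elt y)) else 0)"
proof (cases "pair A (elt x) (diff A (elt y)) = 0")
  case False
  have "koszul (ghost x) (Suc (form_degree y)) = fiber_sign x"
    using pair_diff_degree[OF assms False] by (auto simp: koszul_def fiber_sign_def ghost_form_degree) presburger+
  then show ?thesis
    using assms lie_index_bound by (simp add: free_coeff_def orthonormal_form)
qed (simp add: free_coeff_def)

text \<open>\<open>d\<close> is skew-adjoint and the pairing graded symmetric; the total sign is
  compared in the three pairs of degrees with sum 2.\<close>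

lemma free_coeff_sym:
  assumes "x \<in> \<Phi>" "y \<in> \<Phi>"
  shows "free_coeff y x = (if odd (ghost x) \<and> odd (ghost y) then -1 else 1) * free_coeff x y"
proof -
  let ?k = "form_degree x" and ?l = "form_degree y"
  have g: "elt x \<in> gr A ?k" "elt y \<in> gr A ?l" using assms elt_fiber by auto
  have e: "pair A (diff A (elt x)) (elt y) = - ((-1) ^ ?k * pair A (elt x) (diff A (elt y)))"
    using pair_diff[OF g(1), of "elt y"] by (simp add: add_eq_0_iff)
  have s: "pair A (elt y) (diff A (elt x)) = (-1) ^ (?l * Suc ?k) * pair A (diff A (elt x)) (elt y)"
    by (rule pair_swap[OF g(2) diff_gr[OF g(1)]])
  show ?thesis
  proof (cases "pair A (elt x) (diff A (elt y)) = 0")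
    case True
    then show ?thesis using e s assms by (simp add: free_coeff_fiber)
  next
    case False
    have d: "?k + ?l = 2" by (rule pair_diff_degree[OF assms False])
    then consider "?k = 0" "?l = 2" | "?k = 1" "?l = 1" | "?k = 2" "?l = 0" by linarith
    then show ?thesis
      by cases (use e s in \<open>simp_all add: free_coeff_fiber[OF assms] free_coeff_fiber[OF assms(2,1)]
        fiber_sign_def ghost_form_degree\<close>)
  qed
qed

lemma free_coeff_ghost: "x \<in> \<Phi> \<Longrightarrow> y \<in> \<Phi> \<Longrightarrow> free_coeff x y \<noteq> 0 \<Longrightarrow> ghost x + ghost y = 0"
  using pair_diff_degree[of x y] by (auto simp: free_coeff_fiber ghost_form_degree split: if_splits)

abbreviation "q \<equiv> free_action A L (omega_fiber R)"

lemma free_action_fiber: "q = (1 / 2) *\<^sub>R (\<Sum>x\<in>\<Phi>. \<Sum>y\<in>\<Phi>. free_coeff x y *\<^sub>R (var x * var y))"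
  unfolding free_action_def omega_fiber_eq tpair_tdiff[OF distinct_fiber_list distinct_fiber_list] set_fiber_list ..

lemma coeff_var_var: "coeff (var x * var y) {#u, v#} = (if {#x, y#} = {#u, v#} then \<epsilon> {#x#} {#y#} else 0)"
proof -
  have *: "{#x#} + {#y#} = {#x, y#}" by (simp add: add_mset_commute)
  show ?thesis unfolding var_eq_mon mon_times coeff_scaleR coeff_mon mono_sign_def * by auto
qed

text \<open>The coefficients are already graded symmetric, so the two orders of a product of
  distinct coordinates agree and use up the factor 1/2; for a repeated odd coordinate both sides are
  zero.\<close>

lemma hessian_free:
  assumes "x \<in> \<Phi>" "y \<in> \<Phi>"
  shows "hessian q x y = free_coeff x y"
proof -
  have c: "coeff q {#x, y#} = (1 / 2) * (\<Sum>u\<in>\<Phi>. \<Sum>v\<in>\<Phi>. free_coeff u v * (if {#u, v#} = {#x, y#} then \<epsilon> {#u#} {#v#} else 0))"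
    by (simp add: free_action_fiber coeff_var_var)
  show ?thesis
  proof (cases "x = y")
    case True
    have "(\<Sum>u\<in>\<Phi>. \<Sum>v\<in>\<Phi>. free_coeff u v * (if {#u, v#} = {#x, y#} then \<epsilon> {#u#} {#v#} else 0)) =
        (\<Sum>u\<in>\<Phi>. if u = x then (\<Sum>v\<in>\<Phi>. if v = x then free_coeff x x * \<epsilon> {#x#} {#x#} else 0) else 0)"
      by (intro sum.cong refl) (auto simp: True add_eq_conv_ex intro!: sum.neutral sum.cong)
    then have h: "hessian q x y = free_coeff x x * \<epsilon> {#x#} {#x#}"
      using c assms finite_fiber by (simp add: hessian_def True)
    show ?thesis
    proof (cases "odd (ghost x)")
      case odd: True
      then have "free_coeff x x = 0" using free_coeff_sym[OF assms(1) assms(1)] by simp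
      then show ?thesis using h True by simp
    next
      case False
      then have "\<epsilon> {#x#} {#x#} = 1" by (auto simp: mono_sign_def nonvanishing_def inversions_def)
      then show ?thesis using h True by simp
    qed
  next
    case False
    have "(\<Sum>u\<in>\<Phi>. \<Sum>v\<in>\<Phi>. free_coeff u v * (if {#u, v#} = {#x, y#} then \<epsilon> {#u#} {#v#} else 0)) =
        (\<Sum>u\<in>\<Phi>. \<Sum>v\<in>\<Phi>. (if v = y then if u = x then free_coeff x y * \<epsilon> {#x#} {#y#} else 0 else 0)
          + (if v = x then if u = y then free_coeff y x * \<epsilon> {#y#} {#x#} else 0 else 0))"
      using False by (intro sum.cong refl) (auto simp: add_eq_conv_ex)
    also have "\<dots> = free_coeff x y * \<epsilon> {#x#} {#y#} + free_coeff y x * \<epsilon> {#y#} {#x#}"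
      using assms finite_fiber by (simp add: sum.distrib)
    also have "\<epsilon> {#y#} {#x#} = (if odd (ghost x) \<and> odd (ghost y) then -1 else 1) * \<epsilon> {#x#} {#y#}"
      using mono_sign_swap[of "{#y#}" "{#x#}"] by auto
    finally have "coeff q {#x, y#} = free_coeff x y * \<epsilon> {#x#} {#y#}"
      unfolding c free_coeff_sym[OF assms] by auto
    moreover have "\<epsilon> {#x#} {#y#} * \<epsilon> {#x#} {#y#} = 1"
      using False by (intro mono_sign_square) (auto simp: nonvanishing_def)
    ultimately show ?thesis using False by (simp add: hessian_def mult_ac)
  qed
qed

lemma fiber_Fl: "j \<in> J \<Longrightarrow> a < N \<Longrightarrow> Fl (fst j) (snd j) a \<in> \<Phi>"
  by (auto simp: J_def fiber_coords_def)

lemma hessian_inverse: "hessian_inverse \<Phi> q fiber_prop"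
proof
  show "finite \<Phi>" by (rule finite_fiber)
  show "fiber_prop x y = 0" if "x \<notin> \<Phi> \<or> y \<notin> \<Phi>" for x y using that by (auto simp: fiber_prop_def)
  show "ghost x + ghost y = 0" if "x \<in> \<Phi>" "y \<in> \<Phi>" "hessian q x y \<noteq> 0" for x y
    using that free_coeff_ghost by (simp add: hessian_free)
  show "hessian q y x = (if odd (ghost x) \<and> odd (ghost y) then -1 else 1) * hessian q x y"
    if "x \<in> \<Phi>" "y \<in> \<Phi>" for x y
    unfolding hessian_free[OF that] hessian_free[OF that(2,1)] by (rule free_coeff_sym[OF that])
  \<comment> \<open>The Hessian is diagonal in the Lie algebra index, so only the index of
    \<open>z\<close> survives; the Koszul sign is absorbed into the coefficients.\<close>
  have row: "(\<Sum>y\<in>\<Phi>. c y * hessian q y z) =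
      (\<Sum>l\<in>J. (c (Fl (fst l) (snd l) (lie_index z)) * fiber_sign (Fl (fst l) (snd l) (lie_index z)))
        * pair A (E l) (diff A (E (fiber_index z))))" if z: "z \<in> \<Phi>" for c z
  proof -
    have ez: "elt z = E (fiber_index z)" using z by (auto simp: fiber_coords_def)
    have "(\<Sum>y\<in>\<Phi>. c y * hessian q y z) = (\<Sum>y\<in>\<Phi>. c y * free_coeff y z)"
      using z by (simp add: hessian_free)
    also have "\<dots> = (\<Sum>j\<in>J. \<Sum>a<N. if a = lie_index z then
        c (Fl (fst j) (snd j) a) * fiber_sign (Fl (fst j) (snd j) a) * pair A (E j) (diff A (E (fiber_index z))) else 0)"
      unfolding sum_fiber
      by (intro sum.cong refl) (auto simp: free_coeff_fiber[OF fiber_Fl z] ez)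
    also have "\<dots> = (\<Sum>l\<in>J. (c (Fl (fst l) (snd l) (lie_index z)) * fiber_sign (Fl (fst l) (snd l) (lie_index z)))
        * pair A (E l) (diff A (E (fiber_index z))))"
      using lie_index_bound[of z] z by simp
    finally show ?thesis .
  qed
  show "\<forall>y\<in>\<Phi>. c y = 0" if c: "\<forall>z\<in>\<Phi>. (\<Sum>y\<in>\<Phi>. c y * hessian q y z) = 0" for c
  proof
    fix y assume y: "y \<in> \<Phi>"
    let ?c = "\<lambda>l. c (Fl (fst l) (snd l) (lie_index y)) * fiber_sign (Fl (fst l) (snd l) (lie_index y))"
    have "(\<Sum>l\<in>J. ?c l * pair A (E l) (diff A (E m))) = 0" if m: "m \<in> J" for m
    proof -
      have "Fl (fst m) (snd m) (lie_index y) \<in> \<Phi>"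
        using fiber_Fl[OF m] lie_index_bound[of y] y by simp
      from row[OF this, of c] c[rule_format, OF this] show ?thesis by simp
    qed
    then have "\<forall>l\<in>J. ?c l = 0" using kex_kernel[of ?c] by blast
    moreover obtain k I a where "y = Fl k I a" "(k, I) \<in> J"
      using y by (auto simp: fiber_coords_def J_def)
    ultimately show "c y = 0" by (auto simp: fiber_sign_def split: if_splits)
  qed
  show "(\<Sum>y\<in>\<Phi>. fiber_prop x y * hessian q y z) = (if x = z then -1 else 0)" if xz: "x \<in> \<Phi>" "z \<in> \<Phi>" for x z
  proof -
    have J: "fiber_index x \<in> J" "fiber_index z \<in> J" using xz by (auto simp: fiber_coords_def J_def)
    have "(\<Sum>y\<in>\<Phi>. fiber_prop x y * hessian q y z) = (\<Sum>l\<in>J. if lie_index x = lie_index z then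
        - (\<gamma> (fiber_index x) l * pair A (E l) (diff A (E (fiber_index z)))) else 0)"
      unfolding row[OF xz(2)]
      by (rule sum.cong) (use xz fiber_Fl lie_index_bound[of z] in \<open>auto simp: fiber_prop_def fiber_sign_def\<close>)
    also have "\<dots> = (if lie_index x = lie_index z \<and> fiber_index x = fiber_index z then -1 else 0)"
      using \<gamma>_inverse[OF J] by (cases "lie_index x = lie_index z") (auto simp: sum_negf)
    also have "\<dots> = (if x = z then -1 else 0)"
      using xz by (auto simp: fiber_coords_def)
    finally show ?thesis .
  qed
qed

lemma propagator_fiber: "propagator \<Phi> q = fiber_prop"
  by (rule hessian_inverse.propagator_eq[OF hessian_inverse])

lemma gaussian_fiber: "gaussian \<Phi> fiber_prop"
proof
  show "finite \<Phi>" by (rule finite_fiber)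
  show "fiber_prop x y \<noteq> 0 \<Longrightarrow> x \<in> \<Phi> \<and> y \<in> \<Phi>" for x y by (auto simp: fiber_prop_def split: if_splits)
qed (rule hessian_inverse.G_ghost[OF hessian_inverse], assumption,
  rule hessian_inverse.G_sym[OF hessian_inverse])

end

section \<open>The interaction\<close>

lemma wt_var: "wt w (var x) = w x *\<^sub>R var x"
  by (rule superseries_eqI) (simp add: coeff_wt coeff_var)

context frame_setting
begin

section \<open>The cubic vertex\<close>

definition cubic :: "coord set \<Rightarrow> superseries" where
  "cubic S = (\<Sum>x\<in>S. \<Sum>y\<in>S. \<Sum>z\<in>S. cubic_coeff x y z *\<^sub>R (var x * (var y * var z)))"

lemma W_prod_eq: "W_prod A L \<iota> R = cubic \<B>"
  unfolding W_prod_def iota_alpha_eq cubic_action_entries[OF distinct_base_list] set_base_list cubic_def ..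

lemma K_elt: "x \<in> \<B> \<union> \<Phi> \<Longrightarrow> K (elt x) = 0"
  using elt_base elt_fiber K_iota by fastforce

lemma diff_elt_base: "x \<in> \<B> \<Longrightarrow> diff A (elt x) = 0"
  using elt_base diff_iota by fastforce

text \<open>\<open>\<iota>\<close> takes values in cocycles and \<open>d\<close> is skew-adjoint.
  Hence the interaction has no quadratic part.\<close>

lemma free_coeff_base:
  assumes "x \<in> \<B> \<union> \<Phi>" "y \<in> \<B> \<union> \<Phi>" "x \<in> \<B> \<or> y \<in> \<B>"
  shows "free_coeff x y = 0"
proof -
  have "pair A (elt x) (diff A (elt y)) = 0"
  proof (cases "y \<in> \<B>")
    case True
    then show ?thesis by (simp add: diff_elt_base pair_right)
  next
    case False
    then have "diff A (elt x) = 0" using assms(3) diff_elt_base by blast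
    then show ?thesis using pair_diff[OF elt_gr[OF assms(1)], of "elt y"] by (simp add: pair_left)
  qed
  then show ?thesis by (simp add: free_coeff_def)
qed

lemma interaction_eq: "interaction A L \<iota> R = cubic (\<B> \<union> \<Phi>)"
proof -
  have d: "distinct (base_list @ fiber_list)"
    using distinct_base_list distinct_fiber_list base_fiber_disjoint
    by (simp add: set_base_list set_fiber_list)
  have s: "set (base_list @ fiber_list) = \<B> \<union> \<Phi>" by (simp add: set_base_list set_fiber_list)
  have "(\<Sum>x\<in>\<B> \<union> \<Phi>. \<Sum>y\<in>\<B> \<union> \<Phi>. free_coeff x y *\<^sub>R (var x * var y)) =
      (\<Sum>x\<in>\<Phi>. \<Sum>y\<in>\<B> \<union> \<Phi>. free_coeff x y *\<^sub>R (var x * var y))"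
    using finite_base finite_fiber free_coeff_base
    by (intro sum.mono_neutral_right ballI sum.neutral) auto
  also have "\<dots> = (\<Sum>x\<in>\<Phi>. \<Sum>y\<in>\<Phi>. free_coeff x y *\<^sub>R (var x * var y))"
    using finite_base finite_fiber free_coeff_base
    by (intro sum.cong refl sum.mono_neutral_right) auto
  finally have "free_action A L (map entry (base_list @ fiber_list)) = q"
    unfolding free_action_def[of A L "map entry (base_list @ fiber_list)"] tpair_tdiff[OF d d] s
    by (simp only: free_action_fiber)
  then have "interaction A L \<iota> R = cubic_action A L (map entry (base_list @ fiber_list))"
    by (simp add: interaction_def iota_alpha_eq omega_fiber_eq cs_action_def)
  then show ?thesis unfolding cubic_action_entries[OF d] s cubic_def .
qed

lemma cubic_coeff_degree:
  assumes "x \<in> \<B> \<union> \<Phi>" "y \<in> \<B> \<union> \<Phi>" "z \<in> \<B> \<union> \<Phi>" "cubic_coeff x y z \<noteq> 0"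
  shows "ghost x + ghost y + ghost z = 0"
  using pair_degree[OF elt_gr[OF assms(1)] mul_gr[OF elt_gr[OF assms(2)] elt_gr[OF assms(3)]]] assms(4)
  by (auto simp: cubic_coeff_def ghost_form_degree)

lemma even_cubic:
  assumes "S \<subseteq> \<B> \<union> \<Phi>"
  shows "even_series (cubic S)"
  unfolding cubic_def
proof (intro of_parity_sum)
  fix x y z assume "x \<in> S" "y \<in> S" "z \<in> S"
  then have xyz: "x \<in> \<B> \<union> \<Phi>" "y \<in> \<B> \<union> \<Phi>" "z \<in> \<B> \<union> \<Phi>" using assms by auto
  show "even_series (cubic_coeff x y z *\<^sub>R (var x * (var y * var z)))"
  proof (cases "cubic_coeff x y z = 0")
    case False
    have "of_parity (odd (ghost x) \<noteq> (odd (ghost y) \<noteq> odd (ghost z))) (var x * (var y * var z))"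
      by (intro of_parity_times of_parity_simps)
    moreover have "(odd (ghost x) \<noteq> (odd (ghost y) \<noteq> odd (ghost z))) = False"
      using cubic_coeff_degree[OF xyz False] by presburger
    ultimately have "even_series (var x * (var y * var z))" by (simp only:)
    then show ?thesis by (rule of_parity_simps)
  qed simp
qed

lemma wt_cubic:
  assumes "\<And>x y z. x \<in> S \<Longrightarrow> y \<in> S \<Longrightarrow> z \<in> S \<Longrightarrow> cubic_coeff x y z \<noteq> 0 \<Longrightarrow> w x + w y + w z = c"
  shows "wt w (cubic S) = c *\<^sub>R cubic S"
  unfolding cubic_def linear_sum[OF linear_wt] scaleR_sum_right linear_scale[OF linear_wt]
proof (intro sum.cong refl)
  fix x y z assume xyz: "x \<in> S" "y \<in> S" "z \<in> S"
  have "wt w (var x * (var y * var z)) = (w x + w y + w z) *\<^sub>R (var x * (var y * var z))"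
    by (simp add: wt_times wt_var algebra_simps)
  then show "cubic_coeff x y z *\<^sub>R wt w (var x * (var y * var z)) =
      c *\<^sub>R cubic_coeff x y z *\<^sub>R (var x * (var y * var z))"
    using assms[OF xyz] by (cases "cubic_coeff x y z = 0") auto
qed

lemma euler_cubic: "euler (cubic S) = 3 *\<^sub>R cubic S"
  by (rule wt_cubic) simp

lemma ghost_cubic: "S \<subseteq> \<B> \<union> \<Phi> \<Longrightarrow> wt (\<lambda>x. real_of_int (ghost x)) (cubic S) = 0"
  by (subst wt_cubic[where c = 0]) (use cubic_coeff_degree in \<open>auto simp: subset_iff simp flip: of_int_add\<close>)

lemma pd_cubic_monomial:
  "u \<noteq> x \<Longrightarrow> u \<noteq> y \<Longrightarrow> u \<noteq> z \<Longrightarrow> pd u (var x * (var y * var z)) = 0"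
  by (simp add: pd_times pd_var)

lemma pd_cubic_outside: "u \<notin> S \<Longrightarrow> pd u (cubic S) = 0"
  unfolding cubic_def pd_simps
proof (intro sum.neutral ballI)
  fix x y z assume "u \<notin> S" "x \<in> S" "y \<in> S" "z \<in> S"
  then have "pd u (var x * (var y * var z)) = 0" by (intro pd_cubic_monomial) auto
  then show "cubic_coeff x y z *\<^sub>R pd u (var x * (var y * var z)) = 0" by simp
qed

text \<open>Graphs with a leaf \<open>\<alpha>\<^sub>(\<^sub>0\<^sub>)\<close> at a vertex that has an internal edge vanish, because multiplication by the
  unit leaves \<open>K K = 0\<close> or \<open>K \<iota> = 0\<close>.\<close>

lemma pair_elt_fiber:
  assumes "u \<in> \<Phi>" "v \<in> \<B> \<union> \<Phi>"
  shows "pair A (elt u) (elt v) = 0" "pair A (elt v) (elt u) = 0"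
proof -
  obtain a where "elt u = K a" using elt_fiber[OF assms(1)] by auto
  then show 1: "pair A (elt u) (elt v) = 0" using pair_K_eq_0[OF K_elt[OF assms(2)], of a] by simp
  show "pair A (elt v) (elt u) = 0"
    using pair_swap[OF elt_gr[OF assms(2)], of "elt u" "form_degree u"] elt_fiber[OF assms(1)] 1 by simp
qed

text \<open>The unit drops out by \<open>pair_mul\<close> and \<open>unit_mul\<close>; what is left
  is a pairing with an element of \<open>im K\<close>, which \<open>pair_elt_fiber\<close>
  annihilates.\<close>

lemma cubic_coeff_A0:
  assumes S: "x \<in> \<B> \<union> \<Phi>" "y \<in> \<B> \<union> \<Phi>" "z \<in> \<B> \<union> \<Phi>"
    and "x \<in> \<Phi> \<or> y \<in> \<Phi> \<or> z \<in> \<Phi>" "A0 a \<in> {x, y, z}"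
  shows "cubic_coeff x y z = 0"
proof -
  have n: "A0 a \<notin> \<Phi>" by (auto simp: fiber_coords_def)
  have e: "elt (A0 a) = unit A" by (simp add: iota_unit')
  have "pair A (elt x) (mul A (elt y) (elt z)) = 0"
  proof -
    consider "x = A0 a" "y \<in> \<Phi> \<or> z \<in> \<Phi>" | "y = A0 a" "x \<in> \<Phi> \<or> z \<in> \<Phi>" | "z = A0 a" "x \<in> \<Phi> \<or> y \<in> \<Phi>"
      using assms(4,5) n by auto
    then show ?thesis
    proof cases
      case 1
      then show ?thesis using pair_elt_fiber S by (auto simp: pair_mul e unit_mul simp del: elt.simps)
    next
      case 2
      then show ?thesis using pair_elt_fiber S by (auto simp: e unit_mul simp del: elt.simps)
    next
      case 3
      then show ?thesis using pair_elt_fiber S by (auto simp: e unit_mul simp del: elt.simps)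
    qed
  qed
  then show ?thesis by (simp add: cubic_coeff_def)
qed

lemma pd_A0_cubic: "pd (A0 a) (cubic (\<B> \<union> \<Phi>)) = pd (A0 a) (cubic \<B>)"
proof -
  let ?S = "\<B> \<union> \<Phi>"
  let ?t = "\<lambda>x y z. pd (A0 a) (cubic_coeff x y z *\<^sub>R (var x * (var y * var z)))"
  have fin: "finite ?S" using finite_base finite_fiber by simp
  have t: "?t x y z = 0" if "x \<in> ?S" "y \<in> ?S" "z \<in> ?S" "x \<in> \<Phi> \<or> y \<in> \<Phi> \<or> z \<in> \<Phi>" for x y z
  proof (cases "A0 a \<in> {x, y, z}")
    case True
    then show ?thesis using cubic_coeff_A0[OF that] by (simp add: pd_simps)
  next
    case False
    then show ?thesis by (auto simp: pd_simps pd_cubic_monomial)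
  qed
  have "(\<Sum>x\<in>?S. \<Sum>y\<in>?S. \<Sum>z\<in>?S. ?t x y z) = (\<Sum>x\<in>\<B>. \<Sum>y\<in>?S. \<Sum>z\<in>?S. ?t x y z)"
    by (intro sum.mono_neutral_right fin ballI sum.neutral t) auto
  also have "\<dots> = (\<Sum>x\<in>\<B>. \<Sum>y\<in>\<B>. \<Sum>z\<in>?S. ?t x y z)"
    by (intro sum.cong refl sum.mono_neutral_right fin ballI sum.neutral t) auto
  also have "\<dots> = (\<Sum>x\<in>\<B>. \<Sum>y\<in>\<B>. \<Sum>z\<in>\<B>. ?t x y z)"
    by (intro sum.cong refl sum.mono_neutral_right fin ballI t) auto
  finally show ?thesis unfolding cubic_def pd_simps(5) .
qed

subsection \<open>The adjoint action\<close>

lemmas lie_axioms = lie[unfolded quadratic_lie_algebra_def]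

lemma bilinear_br: "bilinear (br L)"
  using lie_axioms[THEN conjunct2, THEN conjunct1] by blast

lemma br_self: "br L x x = 0"
  using lie_axioms[THEN conjunct2, THEN conjunct2, THEN conjunct1] by blast

lemma jacobi: "br L x (br L y z) + br L y (br L z x) + br L z (br L x y) = 0"
  using lie_axioms[THEN conjunct2, THEN conjunct2, THEN conjunct2, THEN conjunct1] by blast

lemma bilinear_form: "bilinear (form L)"
  using lie_axioms[THEN conjunct_drop4, THEN conjunct1] by blast

lemma form_sym: "form L x y = form L y x"
  using lie_axioms[THEN conjunct_drop4, THEN conjunct2, THEN conjunct1] by blast

lemma form_invariant: "form L (br L x y) z = form L x (br L y z)"
  using lie_axioms[THEN conjunct_drop4, THEN conjunct2, THEN conjunct2, THEN conjunct2] by blast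

lemmas br_left = bilinear_ladd[OF bilinear_br] bilinear_lmul[OF bilinear_br] bilinear_lneg[OF bilinear_br]
lemmas br_right = bilinear_radd[OF bilinear_br] bilinear_rmul[OF bilinear_br] bilinear_rneg[OF bilinear_br]
lemmas form_left = bilinear_ladd[OF bilinear_form] bilinear_lmul[OF bilinear_form] bilinear_lneg[OF bilinear_form]
lemmas form_right = bilinear_radd[OF bilinear_form] bilinear_rmul[OF bilinear_form] bilinear_rneg[OF bilinear_form]

lemma br_anti: "br L x y = - br L y x"
proof -
  have "br L (x + y) (x + y) = br L x y + br L y x"
    unfolding br_left br_right br_self[of x] br_self[of y] by simp
  then have "br L x y + br L y x = 0" by (simp add: br_self)
  then show ?thesis by (simp add: eq_neg_iff_add_eq_0)
qed

lemma form_ad: "form L (br L X u) v = - form L u (br L X v)"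
proof -
  have "form L (br L X u) v = - form L (br L u X) v" by (subst br_anti) (simp add: form_left)
  then show ?thesis by (simp add: form_invariant)
qed

lemma cubic_form_invariant:
  "form L (br L X u) (br L v w) + form L u (br L (br L X v) w) + form L u (br L v (br L X w)) = 0"
proof -
  have "br L X (br L v w) = br L (br L X v) w + br L v (br L X w)"
    using jacobi[of X v w] br_anti[of w "br L X v"] br_anti[of w X]
    by (simp add: br_right algebra_simps)
  then have "form L u (br L (br L X v) w) + form L u (br L v (br L X w)) = form L u (br L X (br L v w))"
    by (simp add: form_right)
  then show ?thesis by (simp add: form_ad)
qed

lemma orthonormal_expand: "(\<Sum>a<N. form L (T a) u *\<^sub>R T a) = u"
proof -
  have b: "inj_on T {..<N}" "u \<in> span (T ` {..<N})"
    using orthonormal by (auto simp: orthonormal_basis_def basis_of_def)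
  obtain c where u: "u = (\<Sum>a<N. c a *\<^sub>R T a)" by (rule span_family[OF _ b]) auto
  have "form L (T b) u = c b" if "b < N" for b
  proof -
    have lin: "linear (form L (T b))" using bilinear_form by (simp add: bilinear_def)
    have "form L (T b) u = (\<Sum>a<N. c a * form L (T b) (T a))"
      unfolding u linear_sum[OF lin] linear_scale[OF lin] by simp
    also have "\<dots> = (\<Sum>a<N. if a = b then c b else 0)"
      using that by (intro sum.cong refl) (auto simp: orthonormal_form)
    finally show ?thesis using that by simp
  qed
  then show ?thesis by (simp add: u)
qed

lemma orthonormal_linear:
  assumes "linear f"
  shows "(\<Sum>a<N. form L (T a) u * f (T a)) = (f u :: real)"
proof -
  have "f u = f (\<Sum>a<N. form L (T a) u *\<^sub>R T a)" by (simp only: orthonormal_expand)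
  then show ?thesis by (simp add: linear_sum[OF assms] linear_scale[OF assms])
qed

text \<open>The coefficient of \<open>z\<close> in the coordinate \<open>x\<close> of
  \<open>[X, \<alpha>]\<close>, so that \<open>ad_field X\<close> is the first-order change of a
  function under \<open>\<alpha> \<mapsto> \<alpha> + [X, \<alpha>]\<close>.\<close>

definition ad :: "'g \<Rightarrow> coord \<Rightarrow> coord \<Rightarrow> real" where
  "ad X x z = (if with_index x (lie_index z) = z
     then form L (T (lie_index x)) (br L X (T (lie_index z))) else 0)"

definition stable :: "coord set \<Rightarrow> bool" where
  "stable S \<longleftrightarrow> finite S \<and> (\<forall>x\<in>S. lie_index x < N \<and> (\<forall>b<N. with_index x b \<in> S))"

lemma stable_base: "stable \<B>"
  unfolding stable_def by (rule conjI[OF finite_base]) (auto simp: base_coords_def)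

lemma stable_fiber: "stable \<Phi>"
  unfolding stable_def by (rule conjI[OF finite_fiber]) (auto simp: fiber_coords_def)

lemma stable_H1: "stable (H1_coords R)"
proof -
  have "finite (H1_coords R)"
    by (rule finite_subset[OF _ finite_base]) (auto simp: H1_coords_def base_coords_def)
  then show ?thesis unfolding stable_def by (rule conjI) (auto simp: H1_coords_def)
qed

lemma stable_all: "stable (\<B> \<union> \<Phi>)"
  using stable_base stable_fiber by (auto simp: stable_def)

lemma same_family: "with_index x (lie_index z) = z \<longleftrightarrow> with_index z (lie_index x) = x"
  by (metis with_index_simps(2,3))

lemma ad_family: "stable S \<Longrightarrow> ad X x z \<noteq> 0 \<Longrightarrow> x \<in> S \<Longrightarrow> lie_index z < N \<Longrightarrow> z \<in> S"
  and ad_family': "stable S \<Longrightarrow> ad X x z \<noteq> 0 \<Longrightarrow> z \<in> S \<Longrightarrow> lie_index x < N \<Longrightarrow> x \<in> S"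
  unfolding ad_def stable_def using same_family by (metis)+

lemma sum_family:
  assumes "stable S" "w \<in> S"
  shows "(\<Sum>x\<in>S. if with_index w (lie_index x) = x then h x else 0) = (\<Sum>a<N. h (with_index w a) :: real)"
proof -
  have "(\<Sum>x\<in>S. if with_index w (lie_index x) = x then h x else 0) =
      (\<Sum>x\<in>{x \<in> S. with_index w (lie_index x) = x}. h x)"
    using assms(1) by (simp add: sum.If_cases stable_def Int_def)
  also have "\<dots> = (\<Sum>a<N. h (with_index w a))"
    by (rule sum.reindex_bij_witness[of _ "with_index w" lie_index])
      (use assms in \<open>auto simp: stable_def\<close>)
  finally show ?thesis .
qed

lemma sum_ad_left:
  assumes "stable S" "z \<in> S"
  shows "(\<Sum>x\<in>S. h x * ad X x z) = (\<Sum>a<N. h (with_index z a) * form L (T a) (br L X (T (lie_index z))))"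
proof -
  have "(\<Sum>x\<in>S. h x * ad X x z) = (\<Sum>x\<in>S. if with_index z (lie_index x) = x
      then h x * form L (T (lie_index x)) (br L X (T (lie_index z))) else 0)"
    by (intro sum.cong refl) (simp add: ad_def same_family[of _ z])
  then show ?thesis unfolding sum_family[OF assms] by simp
qed

lemma sum_ad_right:
  assumes "stable S" "x \<in> S"
  shows "(\<Sum>z\<in>S. h z * ad X x z) = (\<Sum>a<N. h (with_index x a) * form L (T (lie_index x)) (br L X (T a)))"
proof -
  have "(\<Sum>z\<in>S. h z * ad X x z) = (\<Sum>z\<in>S. if with_index x (lie_index z) = z
      then h z * form L (T (lie_index x)) (br L X (T (lie_index z))) else 0)"
    by (intro sum.cong refl) (simp add: ad_def)
  then show ?thesis unfolding sum_family[OF assms] by simp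
qed

lemma even_field_ad: "even_field S (ad X)"
  unfolding even_field_def ad_def by (metis with_index_simps(5))

abbreviation "ad_field X \<equiv> linear_field (\<B> \<union> \<Phi>) (ad X)"

lemma ad_field_var:
  assumes "stable S" "S \<subseteq> \<B> \<union> \<Phi>" "x \<in> S"
  shows "ad_field X (var x) = (\<Sum>z\<in>S. ad X x z *\<^sub>R var z)"
proof -
  have fin: "finite (\<B> \<union> \<Phi>)" using finite_base finite_fiber by simp
  have "ad_field X (var x) = (\<Sum>z\<in>\<B> \<union> \<Phi>. ad X x z *\<^sub>R var z)"
    using linear_field_var[OF fin, of x] assms by blast
  also have "\<dots> = (\<Sum>z\<in>S. ad X x z *\<^sub>R var z)"
    using ad_family[OF assms(1) _ assms(3)] lie_index_bound assms(2)
    by (intro sum.mono_neutral_right fin) auto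
  finally show ?thesis .
qed

definition vertex_weight :: "coord \<Rightarrow> coord \<Rightarrow> coord \<Rightarrow> real" where
  "vertex_weight x y z = koszul (ghost x) (form_degree y + form_degree z) * koszul (ghost y) (form_degree z)
     * pair A (elt x) (mul A (elt y) (elt z)) / 6"

lemma cubic_coeff_eq: "cubic_coeff x y z =
    vertex_weight x y z * form L (T (lie_index x)) (br L (T (lie_index y)) (T (lie_index z)))"
  by (simp add: cubic_coeff_def vertex_weight_def)

lemma vertex_weight_with_index [simp]:
  "vertex_weight (with_index x a) y z = vertex_weight x y z"
  "vertex_weight x (with_index y a) z = vertex_weight x y z"
  "vertex_weight x y (with_index z a) = vertex_weight x y z"
  by (simp_all add: vertex_weight_def)

text \<open>Expansion in the orthonormal basis turns each sum over \<open>w\<close> into a bracket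
  with \<open>X\<close> in one slot; what remains is the invariance of the form
  \<open>\<langle>u, [v, w]\<rangle>\<close>.\<close>

lemma cubic_coeff_invariant:
  assumes S: "stable S" and xyz: "x \<in> S" "y \<in> S" "z \<in> S"
  shows "(\<Sum>w\<in>S. cubic_coeff w y z * ad X w x) + (\<Sum>w\<in>S. cubic_coeff x w z * ad X w y)
    + (\<Sum>w\<in>S. cubic_coeff x y w * ad X w z) = 0"
proof -
  let ?u = "T (lie_index x)" and ?v = "T (lie_index y)" and ?w = "T (lie_index z)"
  let ?k = "vertex_weight x y z"
  have lin: "linear (\<lambda>t. form L t (br L ?v ?w))" "linear (\<lambda>t. form L ?u (br L t ?w))"
      "linear (\<lambda>t. form L ?u (br L ?v t))"
    by (rule linearI; simp add: form_left form_right br_left br_right)+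
  have "(\<Sum>w\<in>S. cubic_coeff w y z * ad X w x) = ?k * form L (br L X ?u) (br L ?v ?w)"
  proof -
    have "(\<Sum>w\<in>S. cubic_coeff w y z * ad X w x) =
        (\<Sum>a<N. ?k * (form L (T a) (br L X ?u) * form L (T a) (br L ?v ?w)))"
      unfolding sum_ad_left[OF S xyz(1)] by (simp add: cubic_coeff_eq mult_ac)
    then show ?thesis by (simp only: sum_distrib_left[symmetric] orthonormal_linear[OF lin(1)])
  qed
  moreover have "(\<Sum>w\<in>S. cubic_coeff x w z * ad X w y) = ?k * form L ?u (br L (br L X ?v) ?w)"
  proof -
    have "(\<Sum>w\<in>S. cubic_coeff x w z * ad X w y) =
        (\<Sum>a<N. ?k * (form L (T a) (br L X ?v) * form L ?u (br L (T a) ?w)))"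
      unfolding sum_ad_left[OF S xyz(2)] by (simp add: cubic_coeff_eq mult_ac)
    then show ?thesis by (simp only: sum_distrib_left[symmetric] orthonormal_linear[OF lin(2)])
  qed
  moreover have "(\<Sum>w\<in>S. cubic_coeff x y w * ad X w z) = ?k * form L ?u (br L ?v (br L X ?w))"
  proof -
    have "(\<Sum>w\<in>S. cubic_coeff x y w * ad X w z) =
        (\<Sum>a<N. ?k * (form L (T a) (br L X ?w) * form L ?u (br L ?v (T a))))"
      unfolding sum_ad_left[OF S xyz(3)] by (simp add: cubic_coeff_eq mult_ac)
    then show ?thesis by (simp only: sum_distrib_left[symmetric] orthonormal_linear[OF lin(3)])
  qed
  ultimately show ?thesis
    using cubic_form_invariant[of X ?u ?v ?w] by (simp flip: distrib_left)
qed

lemma sum_rotate: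
  "(\<Sum>x\<in>S. \<Sum>y\<in>S. \<Sum>z\<in>S. g x y z) = (\<Sum>y\<in>S. \<Sum>z\<in>S. \<Sum>x\<in>S. (g x y z :: superseries))"
  by (subst sum.swap, rule sum.cong[OF refl], rule sum.swap)

lemma ad_field_cubic:
  assumes S: "stable S" "S \<subseteq> \<B> \<union> \<Phi>"
  shows "ad_field X (cubic S) = 0"
proof -
  let ?m = "\<lambda>x y z. var x * (var y * var z)"
  have D: "ad_field X (?m x y z) = (\<Sum>w\<in>S. ad X x w *\<^sub>R ?m w y z)
      + (\<Sum>w\<in>S. ad X y w *\<^sub>R ?m x w z) + (\<Sum>w\<in>S. ad X z w *\<^sub>R ?m x y w)"
    if "x \<in> S" "y \<in> S" "z \<in> S" for x y z
    using that
    by (simp add: linear_field_times[OF even_field_ad] ad_field_var[OF S] sum_distrib_left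
        sum_distrib_right distrib_left add.assoc)
  \<comment> \<open>Renaming indices shifts the adjoint action from the coordinates to the
    coefficients; this is applied in each of the three slots.\<close>
  have sw: "(\<Sum>x\<in>S. c x *\<^sub>R (\<Sum>w\<in>S. ad X x w *\<^sub>R h w)) = (\<Sum>x\<in>S. (\<Sum>w\<in>S. c w * ad X w x) *\<^sub>R h x)"
    for c and h :: "coord \<Rightarrow> superseries"
    unfolding scaleR_sum_right scaleR_sum_left by (subst sum.swap) simp
  have "ad_field X (cubic S) =
      (\<Sum>x\<in>S. \<Sum>y\<in>S. \<Sum>z\<in>S. cubic_coeff x y z *\<^sub>R (\<Sum>w\<in>S. ad X x w *\<^sub>R ?m w y z))
    + (\<Sum>x\<in>S. \<Sum>y\<in>S. \<Sum>z\<in>S. cubic_coeff x y z *\<^sub>R (\<Sum>w\<in>S. ad X y w *\<^sub>R ?m x w z))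
    + (\<Sum>x\<in>S. \<Sum>y\<in>S. \<Sum>z\<in>S. cubic_coeff x y z *\<^sub>R (\<Sum>w\<in>S. ad X z w *\<^sub>R ?m x y w))"
    unfolding cubic_def linear_sum[OF linear_linear_field] linear_scale[OF linear_linear_field]

    by (simp add: D scaleR_add_right sum.distrib)
  also have "(\<Sum>x\<in>S. \<Sum>y\<in>S. \<Sum>z\<in>S. cubic_coeff x y z *\<^sub>R (\<Sum>w\<in>S. ad X x w *\<^sub>R ?m w y z)) =
      (\<Sum>x\<in>S. \<Sum>y\<in>S. \<Sum>z\<in>S. (\<Sum>w\<in>S. cubic_coeff w y z * ad X w x) *\<^sub>R ?m x y z)"
    by (subst (1 2) sum_rotate) (simp only: sw)
  also have "(\<Sum>x\<in>S. \<Sum>y\<in>S. \<Sum>z\<in>S. cubic_coeff x y z *\<^sub>R (\<Sum>w\<in>S. ad X y w *\<^sub>R ?m x w z)) =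
      (\<Sum>x\<in>S. \<Sum>z\<in>S. \<Sum>y\<in>S. cubic_coeff x y z *\<^sub>R (\<Sum>w\<in>S. ad X y w *\<^sub>R ?m x w z))"
    by (intro sum.cong refl sum.swap)
  also have "\<dots> = (\<Sum>x\<in>S. \<Sum>z\<in>S. \<Sum>y\<in>S. (\<Sum>w\<in>S. cubic_coeff x w z * ad X w y) *\<^sub>R ?m x y z)"
    by (simp only: sw)
  also have "\<dots> = (\<Sum>x\<in>S. \<Sum>y\<in>S. \<Sum>z\<in>S. (\<Sum>w\<in>S. cubic_coeff x w z * ad X w y) *\<^sub>R ?m x y z)"
    by (intro sum.cong refl sum.swap)
  also have "(\<Sum>x\<in>S. \<Sum>y\<in>S. \<Sum>z\<in>S. cubic_coeff x y z *\<^sub>R (\<Sum>w\<in>S. ad X z w *\<^sub>R ?m x y w)) =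
      (\<Sum>x\<in>S. \<Sum>y\<in>S. \<Sum>z\<in>S. (\<Sum>w\<in>S. cubic_coeff x y w * ad X w z) *\<^sub>R ?m x y z)"
    by (simp only: sw)
  finally have "ad_field X (cubic S) = (\<Sum>x\<in>S. \<Sum>y\<in>S. \<Sum>z\<in>S. ((\<Sum>w\<in>S. cubic_coeff w y z * ad X w x)
      + (\<Sum>w\<in>S. cubic_coeff x w z * ad X w y) + (\<Sum>w\<in>S. cubic_coeff x y w * ad X w z)) *\<^sub>R ?m x y z)"
    by (simp only: sum.distrib scaleR_add_left)
  then show ?thesis by (simp add: cubic_coeff_invariant[OF S(1)])
qed

text \<open>In the Lie algebra index the propagator is the identity, and \<open>ad X\<close> is skew
  for the form. If \<open>w\<close> is a base coordinate, both sums vanish.\<close>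

lemma fiber_prop_invariant:
  assumes x: "x \<in> \<Phi>" and w: "w \<in> \<B> \<union> \<Phi>"
  shows "(\<Sum>y\<in>\<Phi>. fiber_prop x y * ad X w y) + (\<Sum>y\<in>\<Phi>. fiber_prop y w * ad X x y) = 0"
proof (cases "w \<in> \<Phi>")
  case False
  have "ad X w y = 0" if "y \<in> \<Phi>" for y
    using ad_family'[OF stable_fiber _ that] lie_index_bound[OF w] False by blast
  then show ?thesis using False by (simp add: fiber_prop_def)
next
  case w: True
  have N: "lie_index x < N" "lie_index w < N" using x w lie_index_bound by auto
  have fi: "fiber_index (with_index u a) = fiber_index u" "fiber_sign (with_index u a) = fiber_sign u" for u a
    by (cases u; simp add: fiber_sign_def)+
  have \<Phi>: "with_index x a \<in> \<Phi>" "with_index w a \<in> \<Phi>" if "a < N" for a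
    using stable_fiber x w that by (auto simp: stable_def)
  let ?g = "\<gamma> (fiber_index x) (fiber_index w) * fiber_sign w"
  have "(\<Sum>y\<in>\<Phi>. fiber_prop x y * ad X w y) =
      (\<Sum>a<N. if a = lie_index x then - ?g * form L (T (lie_index w)) (br L X (T a)) else 0)"
    unfolding sum_ad_right[OF stable_fiber w]
    by (intro sum.cong refl) (auto simp: fiber_prop_def x \<Phi> fi)
  moreover have "(\<Sum>y\<in>\<Phi>. fiber_prop y w * ad X x y) =
      (\<Sum>a<N. if a = lie_index w then - ?g * form L (T (lie_index x)) (br L X (T a)) else 0)"
    unfolding sum_ad_right[OF stable_fiber x]
    by (intro sum.cong refl) (auto simp: fiber_prop_def w \<Phi> fi)
  moreover have "form L (T (lie_index x)) (br L X (T (lie_index w))) =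
      - form L (T (lie_index w)) (br L X (T (lie_index x)))"
    using form_ad[of X "T (lie_index x)" "T (lie_index w)"] form_sym by simp
  ultimately show ?thesis using N by simp
qed

end

sublocale frame_setting \<subseteq> ci: cubic_interaction \<Phi> fiber_prop "interaction A L \<iota> R"
proof -
  interpret gaussian \<Phi> fiber_prop by (rule gaussian_fiber)
  show "cubic_interaction \<Phi> fiber_prop (interaction A L \<iota> R)"
    by unfold_locales (simp_all add: interaction_eq even_cubic euler_cubic)
qed

section \<open>Structure of the effective action\<close>

lemma has_derivative_prod_mset:
  assumes "\<And>x. x \<in># M \<Longrightarrow> ((\<lambda>s. c x s) has_real_derivative c' x) (at 0)"
  shows "((\<lambda>s. \<Prod>x\<in>#M. c x s) has_real_derivative
    (\<Sum>x\<in>#M. c' x * (\<Prod>y\<in>#M - {#x#}. c y 0))) (at (0::real))"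
  using assms
proof (induction M)
  case (add x M)
  have "((\<lambda>s. c x s * (\<Prod>x\<in>#M. c x s)) has_real_derivative
      c' x * (\<Prod>y\<in>#M. c y 0) + (\<Sum>y\<in>#M. c' y * (\<Prod>z\<in>#M - {#y#}. c z 0)) * c x 0) (at 0)"
    by (rule DERIV_mult) (use add in auto)
  moreover have "(\<Sum>y\<in>#M. c' y * (\<Prod>z\<in>#M - {#y#}. c z 0)) * c x 0 =
      (\<Sum>y\<in>#M. c' y * (\<Prod>z\<in>#add_mset x M - {#y#}. c z 0))"
    unfolding sum_mset_distrib_right
  proof (rule arg_cong[where f = sum_mset], rule image_mset_cong)
    fix y assume "y \<in># M"
    then have "add_mset x M - {#y#} = add_mset x (M - {#y#})"
      by (metis diff_union_swap2 multi_self_add_other_not_self add_mset_diff_bothsides insert_DiffM)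
    then show "c' y * (\<Prod>z\<in>#M - {#y#}. c z 0) * c x 0 = c' y * (\<Prod>z\<in>#add_mset x M - {#y#}. c z 0)"
      by (simp add: mult_ac)
  qed
  ultimately show ?case by simp
qed simp

lemma sum_mset_count:
  assumes "finite H"
  shows "set_mset M \<subseteq> H \<Longrightarrow> (\<Sum>x\<in>#M. h x) = (\<Sum>x\<in>H. real (count M x) * h x)"
proof (induction M)
  case (add x M)
  have "(\<Sum>y\<in>H. real (count (add_mset x M) y) * h y) = (\<Sum>y\<in>H. real (count M y) * h y + (if y = x then h x else 0))"
    by (rule sum.cong) (auto simp: algebra_simps)
  also have "\<dots> = (\<Sum>x\<in>#M. h x) + h x"
    using add assms by (simp add: sum.distrib)
  finally show ?case by simp
qed simp

lemma sum_remove_one: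
  assumes "finite H" "x \<in> H"
  shows "(\<Sum>M\<in>multisets_of_size H (Suc r). if x \<in># M then k (M - {#x#}) M else 0) =
    (\<Sum>N\<in>multisets_of_size H r. (k N (add_mset x N) :: real))"
proof -
  have fin: "finite (multisets_of_size H (Suc r))" using assms(1) by (rule finite_multisets_of_size)
  have "(\<Sum>M\<in>multisets_of_size H (Suc r). if x \<in># M then k (M - {#x#}) M else 0) =
      (\<Sum>M\<in>{M \<in> multisets_of_size H (Suc r). x \<in># M}. k (M - {#x#}) M)"
    using fin by (simp add: sum.If_cases Int_def)
  also have "\<dots> = (\<Sum>N\<in>multisets_of_size H r. k N (add_mset x N))"
  proof (rule sum.reindex_bij_witness[of _ "add_mset x" "\<lambda>M. M - {#x#}"])
    fix M assume M: "M \<in> {M \<in> multisets_of_size H (Suc r). x \<in># M}"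
    then show "M - {#x#} \<in> multisets_of_size H r"
      by (auto simp: multisets_of_size_def size_Diff_singleton dest: in_diffD)
  qed (use assms in \<open>auto simp: multisets_of_size_def\<close>)
  finally show ?thesis .
qed

lemma coeff_var_times:
  "coeff (var z * h) M = (if z \<in># M then \<epsilon> {#z#} (M - {#z#}) * coeff h (M - {#z#}) else 0)"
proof (cases "z \<in># M")
  case True
  then obtain M' where M: "M = {#z#} + M'" by (metis insert_DiffM add_mset_add_single union_commute)
  show ?thesis unfolding M var_eq_mon by (subst coeff_mon_times) auto
next
  case False
  have "coeff (var z * h) M = 0"
  proof (rule ccontr)
    assume "coeff (var z * h) M \<noteq> 0"
    then obtain A B where "A + B = M" "coeff (var z) A \<noteq> 0" by (rule coeff_times_nonzeroE)
    with False show False by (auto simp: coeff_var split: if_splits)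
  qed
  with False show ?thesis by simp
qed

context frame_setting
begin

abbreviation "H1 \<equiv> H1_coords R"

lemma finite_H1: "finite H1"
  using stable_H1 by (simp add: stable_def)

lemma H1_even: "set_mset Q \<subseteq> H1 \<Longrightarrow> x \<in> H1 \<Longrightarrow> \<epsilon> {#x#} Q = 1"
proof -
  assume Q: "set_mset Q \<subseteq> H1" and x: "x \<in> H1"
  have e: "even (ghost y)" if "y \<in> H1" for y using that by (auto simp: H1_coords_def)
  have "nonvanishing ({#x#} + Q)"
    unfolding nonvanishing_def
  proof (intro allI impI)
    fix y assume "odd (ghost y)"
    then have "y \<notin># {#x#} + Q" using e Q x by auto
    then show "count ({#x#} + Q) y \<le> 1" by (simp add: not_in_iff)
  qed
  then show ?thesis using e[OF x] by (simp add: mono_sign_def inversions_def)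
qed

text \<open>Removing one coordinate from each monomial turns both the derivative and the evaluation of
  \<open>ad_field X g\<close> into the same sum.\<close>

lemma eval_ad_derivative:
  assumes g: "ad_field X g = 0"
    and f: "\<And>M. M \<in> multisets_of_size H1 r \<Longrightarrow> coeff f M = coeff g M"
  shows "((\<lambda>s. eval_homogeneous L R f r (\<lambda>i. \<alpha> i + s *\<^sub>R br L X (\<alpha> i))) has_real_derivative 0) (at 0)"
proof -
  define c where "c x s = coord_value L R (\<lambda>i. \<alpha> i + s *\<^sub>R br L X (\<alpha> i)) x" for x s
  define c0 where "c0 x = coord_value L R \<alpha> x" for x
  define c1 where "c1 x = (\<Sum>z\<in>H1. ad X x z * c0 z)" for x
  let ?P = "\<lambda>M. \<Prod>y\<in>#M. c0 y"
  have c_0: "c x 0 = c0 x" for x by (simp add: c_def c0_def)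
  have deriv: "((\<lambda>s. c x s) has_real_derivative c1 x) (at 0)" if x: "x \<in> H1" for x
  proof -
    obtain i a where ia: "x = A1 i a" "i < betti1 R" "a < N" using x by (auto simp: H1_coords_def)
    have lin: "linear (\<lambda>u. form L (T a) (br L X u))"
      by (rule linearI; simp add: form_right br_right)
    have "c1 x = (\<Sum>b<N. c0 (A1 i b) * form L (T a) (br L X (T b)))"
      using sum_ad_right[OF stable_H1 x, of c0 X] by (simp add: c1_def mult.commute ia)
    also have "\<dots> = (\<Sum>b<N. form L (T b) (\<alpha> i) * form L (T a) (br L X (T b)))"
      by (simp add: c0_def)
    also have "\<dots> = form L (T a) (br L X (\<alpha> i))" by (rule orthonormal_linear[OF lin])
    finally have "c1 x = form L (T a) (br L X (\<alpha> i))" .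
    moreover have "c x = (\<lambda>s. form L (T a) (\<alpha> i) + s * form L (T a) (br L X (\<alpha> i)))"
      by (auto simp: c_def ia form_right)
    ultimately show ?thesis by (auto intro!: derivative_eq_intros)
  qed
  have MS: "set_mset M \<subseteq> H1" if "M \<in> multisets_of_size H1 n" for M n
    using that by (simp add: multisets_of_size_def)
  have main: "((\<lambda>s. \<Sum>M\<in>multisets_of_size H1 r. coeff f M * (\<Prod>x\<in>#M. c x s)) has_real_derivative
      (\<Sum>M\<in>multisets_of_size H1 r. coeff f M * (\<Sum>x\<in>#M. c1 x * ?P (M - {#x#})))) (at 0)"
  proof (intro DERIV_sum DERIV_cmult)
    fix M assume "M \<in> multisets_of_size H1 r"
    then have "\<And>x. x \<in># M \<Longrightarrow> ((\<lambda>s. c x s) has_real_derivative c1 x) (at 0)"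
      using MS deriv by blast
    from has_derivative_prod_mset[OF this]
    show "((\<lambda>s. \<Prod>x\<in>#M. c x s) has_real_derivative (\<Sum>x\<in>#M. c1 x * ?P (M - {#x#}))) (at 0)"
      by (simp add: c_0)
  qed
  have "(\<Sum>M\<in>multisets_of_size H1 r. coeff f M * (\<Sum>x\<in>#M. c1 x * ?P (M - {#x#}))) = 0"
  proof (cases r)
    case 0
    then show ?thesis by (simp add: multisets_of_size_def)
  next
    case (Suc n)
    let ?MS = "multisets_of_size H1"
    have pd: "coeff (pd x g) Q = (real (count Q x) + 1) * coeff g (add_mset x Q)"
      if "x \<in> H1" "set_mset Q \<subseteq> H1" for x Q
      using H1_even[OF that(2,1)] by (simp add: coeff_pd)
    have "(\<Sum>M\<in>?MS r. coeff f M * (\<Sum>x\<in>#M. c1 x * ?P (M - {#x#}))) =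
        (\<Sum>M\<in>?MS r. \<Sum>x\<in>H1. if x \<in># M then
          (real (count (M - {#x#}) x) + 1) * coeff g M * (c1 x * ?P (M - {#x#})) else 0)"
    proof (rule sum.cong[OF refl])
      fix M assume M: "M \<in> ?MS r"
      show "coeff f M * (\<Sum>x\<in>#M. c1 x * ?P (M - {#x#})) = (\<Sum>x\<in>H1. if x \<in># M then
          (real (count (M - {#x#}) x) + 1) * coeff g M * (c1 x * ?P (M - {#x#})) else 0)"
        unfolding sum_mset_count[OF finite_H1 MS[OF M]] sum_distrib_left f[OF M]
      proof (rule sum.cong[OF refl])
        fix x
        have "real (count M x) = real (count (M - {#x#}) x) + 1" if "x \<in># M"
          using that by (simp add: Suc_leI of_nat_diff)
        then show "coeff g M * (real (count M x) * (c1 x * ?P (M - {#x#}))) = (if x \<in># M then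
          (real (count (M - {#x#}) x) + 1) * coeff g M * (c1 x * ?P (M - {#x#})) else 0)"
          by (simp add: not_in_iff mult_ac)
      qed
    qed
    \<comment> \<open>A monomial with a marked \<open>x\<close> is written as
      \<open>add_mset x Q\<close>, where its coefficient is that of \<open>pd x g\<close> at
      \<open>Q\<close>. Putting \<open>z\<close> in place of \<open>x\<close> then produces the
      monomials of \<open>var z * pd x g\<close>.\<close>
    also have "\<dots> = (\<Sum>x\<in>H1. \<Sum>Q\<in>?MS n. (real (count Q x) + 1) * coeff g (add_mset x Q) * (c1 x * ?P Q))"
      unfolding Suc by (subst sum.swap) (intro sum.cong refl sum_remove_one[OF finite_H1], assumption)
    also have "\<dots> = (\<Sum>x\<in>H1. \<Sum>Q\<in>?MS n. \<Sum>z\<in>H1. ad X x z * coeff (pd x g) Q * ?P (add_mset z Q))"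
      using MS by (intro sum.cong refl) (simp add: pd c1_def sum_distrib_left sum_distrib_right mult_ac)
    also have "\<dots> = (\<Sum>z\<in>H1. \<Sum>Q\<in>?MS n. \<Sum>x\<in>H1. ad X x z * coeff (pd x g) Q * ?P (add_mset z Q))"
      by (subst sum.swap, subst (2) sum.swap, subst sum.swap) (rule refl)
    also have "\<dots> = (\<Sum>z\<in>H1. \<Sum>M\<in>?MS r. if z \<in># M then
        (\<Sum>x\<in>H1. ad X x z * coeff (pd x g) (M - {#z#}) * ?P M) else 0)"
      unfolding Suc by (intro sum.cong refl sum_remove_one[OF finite_H1, symmetric]) assumption
    also have "\<dots> = (\<Sum>M\<in>?MS r. \<Sum>z\<in>H1. if z \<in># M then
        (\<Sum>x\<in>H1. ad X x z * coeff (pd x g) (M - {#z#}) * ?P M) else 0)"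
      by (rule sum.swap)
    also have "\<dots> = (\<Sum>M\<in>?MS r. coeff (ad_field X g) M * ?P M)"
    proof (rule sum.cong[OF refl])
      fix M assume M: "M \<in> ?MS r"
      have sub: "H1 \<subseteq> \<B> \<union> \<Phi>" by (auto simp: H1_coords_def base_coords_def)
      have fin: "finite (\<B> \<union> \<Phi>)" using finite_base finite_fiber by simp
      have z: "coeff (var z * pd x g) M = (if z \<in># M then coeff (pd x g) (M - {#z#}) else 0)" for x z
      proof (cases "z \<in># M")
        case True
        then have "z \<in> H1" "set_mset (M - {#z#}) \<subseteq> H1" using MS[OF M] by (auto dest: in_diffD)
        then show ?thesis using True H1_even by (simp add: coeff_var_times)
      qed (simp add: coeff_var_times)
      have "coeff (ad_field X g) M = (\<Sum>x\<in>\<B> \<union> \<Phi>. \<Sum>z\<in>\<B> \<union> \<Phi>.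
          ad X x z * (if z \<in># M then coeff (pd x g) (M - {#z#}) else 0))"
        by (simp add: linear_field_def z)
      also have "\<dots> = (\<Sum>x\<in>\<B> \<union> \<Phi>. \<Sum>z\<in>H1. ad X x z * (if z \<in># M then coeff (pd x g) (M - {#z#}) else 0))"
        using MS[OF M] sub by (intro sum.cong refl sum.mono_neutral_right fin) auto
      also have "\<dots> = (\<Sum>z\<in>H1. \<Sum>x\<in>\<B> \<union> \<Phi>. ad X x z * (if z \<in># M then coeff (pd x g) (M - {#z#}) else 0))"
        by (rule sum.swap)
      also have "\<dots> = (\<Sum>z\<in>H1. \<Sum>x\<in>H1. ad X x z * (if z \<in># M then coeff (pd x g) (M - {#z#}) else 0))"
      proof (rule sum.cong[OF refl], rule sum.mono_neutral_right[OF fin sub])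
        fix z assume zH: "z \<in> H1"
        show "\<forall>x\<in>\<B> \<union> \<Phi> - H1. ad X x z * (if z \<in># M then coeff (pd x g) (M - {#z#}) else 0) = 0"
          using ad_family'[OF stable_H1 _ zH] lie_index_bound by fastforce
      qed
      finally show "(\<Sum>z\<in>H1. if z \<in># M then (\<Sum>x\<in>H1. ad X x z * coeff (pd x g) (M - {#z#}) * ?P M) else 0) =
          coeff (ad_field X g) M * ?P M"
        by (simp add: sum_distrib_right) (intro sum.cong refl, auto)
    qed
    also have "\<dots> = 0" by (simp add: g)
    finally show ?thesis .
  qed
  with main show ?thesis unfolding eval_homogeneous_def c_def by simp
qed

text \<open>\<open>W_prod\<close> is the single vertex with all three legs in the base, hence it is
  removed at \<open>n = 1\<close> only.\<close>

definition V' :: "nat \<Rightarrow> superseries" where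
  "V' n = fps_nth ci.V n - (if n = 1 then W_prod A L \<iota> R else 0)"

lemma pd_A0_V': "pd (A0 a) (V' n) = 0"
proof -
  have "pd (A0 a) (fps_nth ci.V n) = (if n = 1 then pd (A0 a) (cubic \<B>) else 0)"
  proof (rule ci.derivation_V[OF linear_pd pd_times_even ci.lap_pd])
    show "pd (A0 a) (interaction A L \<iota> R) = pd (A0 a) (cubic \<B>)"
      unfolding interaction_eq by (rule pd_A0_cubic)
    fix y assume "y \<in> \<Phi>"
    then have "pd y (cubic \<B>) = 0" using base_fiber_disjoint by (intro pd_cubic_outside) auto
    then show "pd y (pd (A0 a) (cubic \<B>)) = 0" using pd_commute[of y "A0 a" "cubic \<B>"] by (simp add: pd_simps)
  qed
  then show ?thesis by (simp add: V'_def W_prod_eq pd_simps)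
qed

lemma pd_outside_V:
  assumes "x \<notin> \<B> \<union> \<Phi>"
  shows "pd x (fps_nth ci.V n) = 0"
proof -
  have "pd x (fps_nth ci.V n) = (if n = 1 then 0 else 0)"
    by (rule ci.derivation_V[OF linear_pd pd_times_even ci.lap_pd])
      (use assms in \<open>auto simp: interaction_eq pd_cubic_outside pd_simps\<close>)
  then show ?thesis by simp
qed

lemma ghost_V': "wt (\<lambda>x. real_of_int (ghost x)) (V' n) = 0"
proof -
  let ?w = "\<lambda>x. real_of_int (ghost x)"
  have "wt ?w (fps_nth ci.V n) = (if n = 1 then 0 else 0)"
  proof (rule ci.derivation_V[OF linear_wt wt_times])
    show "ci.lap (wt ?w f) = wt ?w (ci.lap f)" for f
      by (subst ci.wt_lap[where c = 0]) (use ci.G_ghost in \<open>auto simp flip: of_int_add\<close>)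
  qed (auto simp: interaction_eq ghost_cubic pd_simps)
  then show ?thesis
    by (simp add: V'_def W_prod_eq linear_diff[OF linear_wt] linear_0[OF linear_wt] ghost_cubic)
qed

lemma ad_field_V': "ad_field X (V' n) = 0"
proof -
  have "ad_field X (fps_nth ci.V n) = (if n = 1 then 0 else 0)"
  proof (rule ci.derivation_V[OF linear_linear_field linear_field_times[OF even_field_ad]])
    show "ci.lap (ad_field X f) = ad_field X (ci.lap f)" for f
    proof (rule ci.lap_linear_field[OF _ _ even_field_ad])
      show "ad X x w = 0" if "x \<in> \<B> \<union> \<Phi> - \<Phi>" "w \<in> \<Phi>" for x w
        using ad_family'[OF stable_fiber _ that(2)] lie_index_bound that(1) by blast
    qed (use finite_base finite_fiber fiber_prop_invariant in auto)
  qed (auto simp: interaction_eq ad_field_cubic[OF stable_all] pd_simps)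
  then show ?thesis
    by (simp add: V'_def W_prod_eq linear_diff[OF linear_linear_field] linear_0[OF linear_linear_field]
        ad_field_cubic[OF stable_base])
qed

text \<open>\<open>A0\<close> is the only base coordinate of positive ghost number. Without it,
  total ghost number zero leaves only coordinates of ghost number zero.\<close>

lemma V'_support:
  assumes "coeff (V' n) M \<noteq> 0" "set_mset M \<inter> \<Phi> = {}"
  shows "set_mset M \<subseteq> H1"
proof -
  have M: "set_mset M \<subseteq> \<B>"
  proof
    fix x assume x: "x \<in># M"
    show "x \<in> \<B>"
    proof (rule ccontr)
      assume "x \<notin> \<B>"
      moreover from this have "x \<notin> \<B> \<union> \<Phi>" using x assms(2) by auto
      ultimately have "pd x (V' n) = 0"
        using pd_outside_V by (simp add: V'_def W_prod_eq pd_simps pd_cubic_outside)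
      with assms(1) show False using pd_eq_0_coeff[OF _ x] by blast
    qed
  qed
  have nA0: "A0 a \<notin># M" for a using pd_eq_0_coeff[OF pd_A0_V'] assms(1) by blast
  have neg: "ghost x \<le> 0" if "x \<in># M" for x
    using that M nA0 by (cases x) (auto simp: base_coords_def)
  have "(\<Sum>x\<in>#M. real_of_int (ghost x)) * coeff (V' n) M = 0"
    using arg_cong[OF ghost_V'[of n], of "\<lambda>f. coeff f M"] by (simp add: coeff_wt)
  then have s: "(\<Sum>x\<in>#M. real_of_int (ghost x)) = 0" using assms(1) by simp
  show ?thesis
  proof
    fix x assume x: "x \<in># M"
    then obtain M' where M': "M = add_mset x M'" by (metis insert_DiffM)
    have "(\<Sum>y\<in>#M'. real_of_int (ghost y)) \<le> (\<Sum>y\<in>#M'. 0)"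
      by (rule sum_mset_mono) (use neg in \<open>simp add: M'\<close>)
    then have "real_of_int (ghost x) \<ge> 0" using s by (simp add: M')
    then have "ghost x = 0" using neg[OF x] by simp
    moreover have "x \<in> \<B>" using M x by blast
    ultimately show "x \<in> H1" by (auto simp: base_coords_def H1_coords_def)
  qed
qed

lemma W_prod_support: "coeff (W_prod A L \<iota> R) M \<noteq> 0 \<Longrightarrow> size M = 3 \<and> set_mset M \<inter> \<Phi> = {}"
proof
  assume nz: "coeff (W_prod A L \<iota> R) M \<noteq> 0"
  have "real (size M) * coeff (W_prod A L \<iota> R) M = 3 * coeff (W_prod A L \<iota> R) M"
    using arg_cong[OF euler_cubic[of \<B>], of "\<lambda>f. coeff f M"] by (simp add: coeff_euler W_prod_eq)
  with nz show "size M = 3" by simp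
  show "set_mset M \<inter> \<Phi> = {}"
    using nz pd_eq_0_coeff[OF pd_cubic_outside[of _ \<B>]] base_fiber_disjoint by (auto simp: W_prod_eq)
qed

section \<open>The correction to the product term\<close>

definition F :: "superseries fps" where
  "F = ci.connected - fps_const (W_prod A L \<iota> R)"

text \<open>\<open>fps_const\<close> puts \<open>W_prod\<close> at \<open>k = 0\<close>, where a
  cubic monomial has the index \<open>0 + 3 - 2 = 1\<close>, the place at which \<open>V'\<close>
  subtracts it.\<close>

lemma coeff_F: "coeff (fps_nth F k) M =
    (if set_mset M \<inter> \<Phi> = {} \<and> 2 \<le> 2 * k + size M then coeff (V' (2 * k + size M - 2)) M else 0)"
proof (cases "coeff (W_prod A L \<iota> R) M = 0")
  case True
  then show ?thesis by (simp add: F_def ci.coeff_connected V'_def)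
next
  case False
  with W_prod_support have "size M = 3" "set_mset M \<inter> \<Phi> = {}" by auto
  then show ?thesis by (cases k) (auto simp: F_def ci.coeff_connected V'_def)
qed

lemma F_Fun: "F \<in> Fun_hbar H1"
  unfolding Fun_hbar_def Fun_def using V'_support by (auto simp: coeff_F split: if_splits)

lemma H1_disjoint_fiber: "H1 \<inter> \<Phi> = {}"
  by (auto simp: H1_coords_def fiber_coords_def)

lemma F_invariant: "ad_invariant L R F"
  unfolding ad_invariant_def
proof (intro allI)
  fix k r \<alpha> X
  \<comment> \<open>In degree \<open>r\<close> the whole coefficient of \<open>\<hbar>^k\<close>
    comes from the single vertex number \<open>2 * k + r - 2\<close>, so one \<open>V'\<close>
    serves for all monomials involved.\<close>
  define g where "g = (if 2 \<le> 2 * k + r then V' (2 * k + r - 2) else 0)"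
  show "((\<lambda>s. eval_homogeneous L R (fps_nth F k) r (\<lambda>i. \<alpha> i + s *\<^sub>R br L X (\<alpha> i)))
      has_real_derivative 0) (at 0)"
  proof (rule eval_ad_derivative[of X g])
    show "ad_field X g = 0"
      by (simp add: g_def ad_field_V' linear_0[OF linear_linear_field])
    fix M assume M: "M \<in> multisets_of_size H1 r"
    then have "size M = r" "set_mset M \<inter> \<Phi> = {}"
      using H1_disjoint_fiber by (auto simp: multisets_of_size_def)
    then show "coeff (fps_nth F k) M = coeff g M" by (simp add: coeff_F g_def)
  qed
qed

lemma connected_Fun: "ci.connected \<in> Fun_hbar \<B>"
  unfolding Fun_hbar_def Fun_def
proof (clarsimp simp: ci.coeff_connected split: if_splits)
  fix k M x
  assume "set_mset M \<inter> \<Phi> = {}" "coeff (fps_nth ci.V (2 * k + size M - 2)) M \<noteq> 0" "x \<in># M"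
  then show "x \<in> \<B>" using pd_eq_0_coeff[OF pd_outside_V] by blast
qed

lemma effective_action_eq: "effective_action A L \<iota> R = ci.connected"
  unfolding effective_action_def is_effective_action_def
    ci.effective_unique[OF propagator_fiber connected_Fun]
  by (rule the_eq_trivial)

end

theorem proposition4:
  fixes A :: "'c::real_vector dgfa" and L :: "'g::real_vector qlie"
    and \<iota> :: "'c set \<Rightarrow> 'c" and K :: "'c \<Rightarrow> 'c" and R :: "('g, 'c) frame"
  assumes "dg_frobenius_algebra A"
    and "coh_dim A 0 1" and "coh_dim A 3 1"
    and "quadratic_lie_algebra L"
    and "induction_data A \<iota> K"
    and "adapted_frame A L \<iota> K R"
  shows "\<exists>F. F \<in> Fun_hbar (H1_coords R) \<and> ad_invariant L R F \<and>
    effective_action A L \<iota> R = fps_const (W_prod A L \<iota> R) + F"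
proof -
  interpret frame_setting A \<iota> K L R
    using assms by unfold_locales
  show ?thesis
    using F_Fun F_invariant by (intro exI[of _ F]) (simp add: effective_action_eq F_def)
qed

end
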